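(* Let $A\in\mathbb{R}^{n,n}$ be a Hurwitz matrix ($sI_n-A$ nonsingular for $\mathrm{Re}(s)\ge0$), $B_1\in\mathbb{R}^{n,k}$, $B_2\in\mathbb{R}^{n,q}$, $Q=Q'\in\mathbb{R}^{n+k+q,n+k+q}$, $\sigma(x,v,w)=[x;v;w]'Q[x;v;w]$, $B=[B_1,B_2]$, and for $s\in j\mathbb{R}$ let $\Pi(s)=[(sI_n-A)^{-1}B;\,I_{k+q}]'Q[(sI_n-A)^{-1}B;\,I_{k+q}]=\begin{bmatrix}\Pi_{11}(s)&\Pi_{12}(s)\\ \Pi_{21}(s)&\Pi_{22}(s)\end{bmatrix}$ with $\Pi_{11}(s)\in\mathbb{C}^{k,k}$, $\Pi_{22}(s)\in\mathbb{C}^{q,q}$. Assume there exist $\epsilon>0$ and $s_0\in j\mathbb{R}$ such that $$\begin{bmatrix}\Pi_{11}(s)&\epsilon\Pi_{12}(s)\\ \epsilon\Pi_{21}(s)&-\Pi_{22}(s)\end{bmatrix}\ge0\ \ \forall s\in j\mathbb{R},\qquad \Pi_{11}(s_0)>0,\ \Pi_{22}(s_0)<0.$$ For $a\in\mathbb{R}^n$ define $g:L^2_k\times L^2_q\to\mathbb{R}$ by $g(v,w)=\int_0^\infty\sigma(x(t),v(t),w(t))\,dt$, where $\dot x(t)=Ax(t)+B_1v(t)+B_2w(t)$, $x(0)=a$. Then for every $a\in\mathbb{R}^n$: (a) $g_v(w)=\inf_{v\in L^2_k}g(v,w)$ and $g_w(v)=\sup_{w\in L^2_q}g(v,w)$ are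 (finite and) continuous in the standard norm topologies of $L^2_q$ and $L^2_k$ respectively; (b) $\inf_{v\in L^2_k}\sup_{w\in L^2_q}g(v,w)=\sup_{w\in L^2_q}\inf_{v\in L^2_k}g(v,w)$.
   Context: $j\mathbb{R}=\{s\in\mathbb{C}:\mathrm{Re}(s)=0\}$. $L^2_m$ is the real Hilbert space of square integrable $u:[0,\infty)\to\mathbb{R}^m$ with norm $(\int_0^\infty|u(t)|^2dt)^{1/2}$. $M'$ denotes conjugate transpose; $[x;v;w]$ the stacked vector; $\ge0,>0,<0$ for Hermitian matrices denote semidefinite/definite orderings. *)

theory Defs
  imports "HOL-Analysis.Analysis"
begin

definition stack3 :: "real^('n::finite) \<Rightarrow> real^('k::finite) \<Rightarrow> real^('q::finite) \<Rightarrow> real^('n + ('k + 'q))" where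
  "stack3 x v w = (\<chi> i. case i of Inl a \<Rightarrow> x $ a | Inr (Inl b) \<Rightarrow> v $ b | Inr (Inr c) \<Rightarrow> w $ c)"

definition sigma :: "real^(('n::finite) + (('k::finite) + ('q::finite)))^('n + ('k + 'q)) \<Rightarrow> real^'n \<Rightarrow> real^'k \<Rightarrow> real^'q \<Rightarrow> real" where
  "sigma Q x v w = stack3 x v w \<bullet> (Q *v stack3 x v w)"

definition cmat :: "real^('m::finite)^('n::finite) \<Rightarrow> complex^'m^'n" where
  "cmat M = (\<chi> i j. complex_of_real (M $ i $ j))"

definition ctrans :: "complex^('m::finite)^('n::finite) \<Rightarrow> complex^'n^'m" where
  "ctrans M = (\<chi> i j. cnj (M $ j $ i))"

definition hurwitz :: "real^('n::finite)^'n \<Rightarrow> bool" where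
  "hurwitz A \<longleftrightarrow> (\<forall>s::complex. Re s \<ge> 0 \<longrightarrow> invertible (mat s - cmat A))"

definition hermitian_c :: "complex^('m::finite)^'m \<Rightarrow> bool" where
  "hermitian_c M \<longleftrightarrow> ctrans M = M"

definition cquad :: "complex^('m::finite)^'m \<Rightarrow> complex^'m \<Rightarrow> complex" where
  "cquad M z = (\<Sum>i\<in>UNIV. cnj (z $ i) * (M *v z) $ i)"

definition psd_c :: "complex^('m::finite)^'m \<Rightarrow> bool" where
  "psd_c M \<longleftrightarrow> hermitian_c M \<and> (\<forall>z. Im (cquad M z) = 0 \<and> Re (cquad M z) \<ge> 0)"

definition pd_c :: "complex^('m::finite)^'m \<Rightarrow> bool" where
  "pd_c M \<longleftrightarrow> hermitian_c M \<and> (\<forall>z. z \<noteq> 0 \<longrightarrow> Im (cquad M z) = 0 \<and> Re (cquad M z) > 0)"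

definition nd_c :: "complex^('m::finite)^'m \<Rightarrow> bool" where
  "nd_c M \<longleftrightarrow> pd_c (- M)"

definition Bcat :: "real^('k::finite)^('n::finite) \<Rightarrow> real^('q::finite)^'n \<Rightarrow> complex^('k + 'q)^'n" where
  "Bcat B1 B2 = (\<chi> i j. case j of Inl a \<Rightarrow> complex_of_real (B1 $ i $ a)
                                  | Inr b \<Rightarrow> complex_of_real (B2 $ i $ b))"

definition Mstack :: "real^('n::finite)^'n \<Rightarrow> real^('k::finite)^'n \<Rightarrow> real^('q::finite)^'n \<Rightarrow> complex
                      \<Rightarrow> complex^('k + 'q)^('n + ('k + 'q))" where
  "Mstack A B1 B2 s =
     (let R = matrix_inv (mat s - cmat A) ** Bcat B1 B2
      in \<chi> i j. case i of Inl a \<Rightarrow> R $ a $ j | Inr b \<Rightarrow> (if b = j then 1 else 0))"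

definition Pi_mat :: "real^('n::finite)^'n \<Rightarrow> real^('k::finite)^'n \<Rightarrow> real^('q::finite)^'n
                      \<Rightarrow> real^('n + ('k + 'q))^('n + ('k + 'q)) \<Rightarrow> complex
                      \<Rightarrow> complex^('k + 'q)^('k + 'q)" where
  "Pi_mat A B1 B2 Q s = ctrans (Mstack A B1 B2 s) ** cmat Q ** Mstack A B1 B2 s"

definition Pi11 :: "complex^(('k::finite) + ('q::finite))^('k + 'q) \<Rightarrow> complex^'k^'k" where
  "Pi11 P = (\<chi> i j. P $ Inl i $ Inl j)"

definition Pi22 :: "complex^(('k::finite) + ('q::finite))^('k + 'q) \<Rightarrow> complex^'q^'q" where
  "Pi22 P = (\<chi> i j. P $ Inr i $ Inr j)"

definition Pi_mod :: "real \<Rightarrow> complex^(('k::finite) + ('q::finite))^('k + 'q) \<Rightarrow> complex^('k + 'q)^('k + 'q)" where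
  "Pi_mod \<epsilon> P = (\<chi> i j. case (i, j) of
        (Inl _, Inl _) \<Rightarrow> P $ i $ j
      | (Inr _, Inr _) \<Rightarrow> - P $ i $ j
      | _ \<Rightarrow> complex_of_real \<epsilon> * P $ i $ j)"

text \<open>L^2 space of functions on [0,infinity) (values outside [0,infinity) irrelevant).\<close>
definition L2 :: "(real \<Rightarrow> real^('m::finite)) set" where
  "L2 = {u. u \<in> borel_measurable (restrict_space lborel {0..}) \<and>
            set_integrable lborel {0..} (\<lambda>t. (norm (u t))\<^sup>2)}"

definition L2norm :: "(real \<Rightarrow> real^('m::finite)) \<Rightarrow> real" where
  "L2norm u = sqrt (LINT t:{0..}|lborel. (norm (u t))\<^sup>2)"

definition L2_continuous :: "((real \<Rightarrow> real^('m::finite)) \<Rightarrow> real) \<Rightarrow> bool" where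
  "L2_continuous f \<longleftrightarrow> (\<forall>u\<in>L2. \<forall>e>0. \<exists>d>0. \<forall>u'\<in>L2.
       L2norm (\<lambda>t. u' t - u t) < d \<longrightarrow> \<bar>f u' - f u\<bar> < e)"

text \<open>State trajectory: (Caratheodory) solution of x' = A x + B1 v + B2 w, x(0) = a,
  i.e. x(t) = a + int_0^t (A x + B1 v + B2 w) for t >= 0 (normalised to a for t < 0).\<close>
definition traj :: "real^('n::finite)^'n \<Rightarrow> real^('k::finite)^'n \<Rightarrow> real^('q::finite)^'n \<Rightarrow> real^'n
                    \<Rightarrow> (real \<Rightarrow> real^'k) \<Rightarrow> (real \<Rightarrow> real^'q) \<Rightarrow> real \<Rightarrow> real^'n" where
  "traj A B1 B2 a v w = (THE x. (\<forall>t<0. x t = a) \<and>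
      (\<forall>t\<ge>0. (\<lambda>\<tau>. A *v x \<tau> + B1 *v v \<tau> + B2 *v w \<tau>) integrable_on {0..t} \<and>
              x t = a + integral {0..t} (\<lambda>\<tau>. A *v x \<tau> + B1 *v v \<tau> + B2 *v w \<tau>)))"

definition gfun :: "real^('n::finite)^'n \<Rightarrow> real^('k::finite)^'n \<Rightarrow> real^('q::finite)^'n
                    \<Rightarrow> real^('n + ('k + 'q))^('n + ('k + 'q)) \<Rightarrow> real^'n
                    \<Rightarrow> (real \<Rightarrow> real^'k) \<Rightarrow> (real \<Rightarrow> real^'q) \<Rightarrow> real" where
  "gfun A B1 B2 Q a v w =
     (LINT t:{0..}|lborel. sigma Q (traj A B1 B2 a v w t) (v t) (w t))"

end

theory Submission
  imports Defs "HOL-Computational_Algebra.Fundamental_Theorem_Algebra"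
begin

text \<open>Let x_v and x_w be the responses to v and to w. The hypothesis is a frequency domain inequality
  for the cost sigma(x_v, v, 0) - sigma(x_w, 0, w) + epsilon * (cross term of both) of a system with
  doubled state. For zero initial state this cost is nonnegative: the Gram operator of a square
  integrable trajectory is, by Rantzer's argument, a sum of Gram operators of harmonic oscillations.

  For nonzero initial state the cost is still bounded below. Positivity at a single frequency
  bounds the quadratic form at frequency omega from below by a polynomial multiple of the squared norm of the
  input, and its real zeros can be absorbed into a cascade of filters (b s^2 + c)/(s + 1)^2 applied to the
  input; hence the cost dominates the energy of the filtered input. The term linear in the
  input pairs it with an exponential of A, and A has no imaginary eigenvalues, so that
  this functional factors through the filters and is dominated by the quadratic term.

  Scaling w or v in these inequalities shows that g is bounded below in v and bounded above in w,
  and that its coupling between v and w is bounded by the quadratic terms, with constant 4 / epsilon. A function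
  which is quadratically convex in v and quadratically concave in w, with such a coupling, has
  continuous extremal values and satisfies the minimax equality.\<close>

section \<open>Gram operators as sums of harmonic ones\<close>

text \<open>The obstacle is that strictness is assumed at one frequency only. At other frequencies,
  and in the limit of infinite frequency, the form may degenerate, so neither coercivity in the L2
  norm nor existence of minimizers is available. Hence the square is completed in the filtered input
  and not in the input itself, and the minimax argument uses approximate optimizers, measured in the
  seminorms given by the quadratic part of g. The lower bound at a general frequency comes from the
  optimality system in state, costate and input. Its matrix is affine in the frequency and injective
  at \<omega>0 by strictness, so its inverse grows at most like a quotient of polynomials. The
  coupling enters the doubled cost with half of the admissible factor. As w may be replaced by - w
  in the hypothesis, half of the diagonal terms remain, and the doubled cost is strict at \<omega>0
  in v and w jointly.\<close>

lemma quadratic_nonpos_imp_zero: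
  fixes b c :: real
  assumes "\<And>t. b * t + c * t\<^sup>2 \<le> 0"
  shows "b = 0"
proof (rule ccontr)
  assume b: "b \<noteq> 0"
  \<comment> \<open>Small enough that the linear term wins: b * t = (1 + |c|) * t^2, so even the
    worst sign of c leaves t^2 > 0.\<close>
  define t where "t = b / (1 + \<bar>c\<bar>)"
  have "b * t + c * t\<^sup>2 \<ge> b * t - \<bar>c\<bar> * t\<^sup>2"
    using abs_le_D2[of c "\<bar>c\<bar>"] mult_right_mono[of "-\<bar>c\<bar>" c "t\<^sup>2"] by simp
  moreover have "b * t - \<bar>c\<bar> * t\<^sup>2 = t\<^sup>2"
    by (simp add: t_def power2_eq_square divide_simps) (simp add: algebra_simps)
  moreover have "t\<^sup>2 > 0" using b by (simp add: t_def)
  ultimately show False using assms[of t] by linarith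
qed

text \<open>A maximizer x of the Rayleigh quotient on the unit sphere of V is an eigenvector. The
  residual y = f x - l x lies in V by invariance, and moving x in the direction y changes
  \<open>f z \<bullet> z - l * (z \<bullet> z)\<close> to first order by 2 |y|^2, so y = 0.\<close>

lemma selfadjoint_eigenvector:
  fixes f :: "'a::euclidean_space \<Rightarrow> 'a"
  assumes lin: "linear f" and sa: "\<And>x y. f x \<bullet> y = x \<bullet> f y"
    and V: "subspace V" "V \<noteq> {0}" and inv: "\<And>x. x \<in> V \<Longrightarrow> f x \<in> V"
  obtains x l where "x \<in> V" "norm x = 1" "f x = l *\<^sub>R x"
proof -
  let ?K = "V \<inter> sphere 0 1"
  obtain v where v: "v \<in> V" "v \<noteq> 0" using V by (metis subspace_0 is_singletonI' is_singleton_the_elem singletonD all_not_in_conv)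
  have "v /\<^sub>R norm v \<in> ?K" using v V by (simp add: subspace_scale)
  hence ne: "?K \<noteq> {}" by blast
  have comp: "compact ?K" using V by (simp add: closed_subspace compact_Int_closed Int_commute closed_Int_compact)
  have "continuous_on ?K (\<lambda>x. f x \<bullet> x)"
    using lin by (intro continuous_intros linear_continuous_on) (simp add: linear_conv_bounded_linear)
  then obtain x where x: "x \<in> ?K" and mx: "\<And>y. y \<in> ?K \<Longrightarrow> f y \<bullet> y \<le> f x \<bullet> x"
    using continuous_attains_sup[OF comp ne] by blast
  define l where "l = f x \<bullet> x"
  have xx: "x \<bullet> x = 1" using x by (simp add: norm_eq_1)
  have le: "f y \<bullet> y \<le> l * (y \<bullet> y)" if "y \<in> V" for y
  proof (cases "y = 0")
    case True thus ?thesis using lin by (simp add: linear_0)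
  next
    case False
    have "f (y /\<^sub>R norm y) \<bullet> (y /\<^sub>R norm y) \<le> l"
      unfolding l_def using that False V by (intro mx) (simp add: subspace_scale)
    hence "f y \<bullet> y / (norm y)\<^sup>2 \<le> l"
      using lin by (simp add: linear_scale power2_eq_square field_simps)
    thus ?thesis using False by (simp add: field_simps dot_square_norm)
  qed
  define y where "y = f x - l *\<^sub>R x"
  have yV: "y \<in> V" using x inv V by (simp add: y_def subspace_diff subspace_scale)
  have "2 * (y \<bullet> y) * t + (f y \<bullet> y - l * (y \<bullet> y)) * t\<^sup>2 \<le> 0" for t
  proof -
    have "x + t *\<^sub>R y \<in> V" using x yV V by (simp add: subspace_add subspace_scale)
    from le[OF this] have "f x \<bullet> x + t * (f x \<bullet> y) + t * (f y \<bullet> x) + t\<^sup>2 * (f y \<bullet> y)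
       \<le> l * (x \<bullet> x + 2 * t * (x \<bullet> y) + t\<^sup>2 * (y \<bullet> y))"
      using lin by (simp add: linear_add linear_scale inner_add_left inner_add_right algebra_simps power2_eq_square inner_commute)
    moreover have "f y \<bullet> x = f x \<bullet> y" using sa[of y x] by (simp add: inner_commute)
    moreover have "f x \<bullet> y = y \<bullet> y + l * (x \<bullet> y)" by (simp add: y_def inner_diff_left)
    ultimately show ?thesis using xx by (simp add: l_def[symmetric] algebra_simps)
  qed
  from quadratic_nonpos_imp_zero[OF this] have "y = 0" by simp
  thus thesis using that[of x l] x by (simp add: y_def)
qed

section \<open>Orthonormal families and splittings into invariant subspaces\<close>

definition orthonormal :: "'a::euclidean_space set \<Rightarrow> bool" where
  "orthonormal C \<longleftrightarrow> pairwise orthogonal C \<and> (\<forall>c\<in>C. norm c = 1)"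

lemma orthonormal_finite: "orthonormal C \<Longrightarrow> finite C"
  unfolding orthonormal_def
  by (metis independent_imp_finite norm_zero pairwise_orthogonal_independent zero_neq_one)

lemma orthonormal_inner: "orthonormal C \<Longrightarrow> b \<in> C \<Longrightarrow> c \<in> C \<Longrightarrow> b \<bullet> c = (if b = c then 1 else 0)"
  unfolding orthonormal_def pairwise_def orthogonal_def by (auto simp: norm_eq_1)

lemma orthonormal_expand:
  assumes C: "orthonormal C" and x: "x \<in> span C"
  shows "x = (\<Sum>c\<in>C. (x \<bullet> c) *\<^sub>R c)"
proof -
  note fin = orthonormal_finite[OF C]
  obtain u where u: "x = (\<Sum>c\<in>C. u c *\<^sub>R c)" using x span_finite[OF fin] by auto
  have "x \<bullet> c = u c" if "c \<in> C" for c
  proof -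
    have "x \<bullet> c = (\<Sum>d\<in>C. u d * (if d = c then 1 else 0))"
      unfolding u inner_sum_left using that by (intro sum.cong) (auto simp: orthonormal_inner[OF C])
    also have "\<dots> = u c" using fin that by (simp add: sum.delta if_distrib cong: if_cong)
    finally show ?thesis .
  qed
  thus ?thesis using u by simp
qed

lemma orthonormal_parseval:
  assumes C: "orthonormal C" and x: "x \<in> span C"
  shows "x \<bullet> y = (\<Sum>c\<in>C. (x \<bullet> c) * (y \<bullet> c))"
  proof -
  have "x \<bullet> y = (\<Sum>c\<in>C. (x \<bullet> c) *\<^sub>R c) \<bullet> y" using orthonormal_expand[OF assms] by simp
  also have "\<dots> = (\<Sum>c\<in>C. (x \<bullet> c) * (y \<bullet> c))"
    unfolding inner_sum_left inner_scaleR_left by (simp add: inner_commute[of _ y])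
  finally show ?thesis .
qed

text \<open>Both the spectral theorem and the decomposition of an orthogonal map into rotations
  split off an invariant subspace W and continue on its orthogonal complement.\<close>

lemma orthonormal_split_induct:
  fixes V :: "'a::euclidean_space set"
  assumes V: "subspace V" "I V"
    and split: "\<And>V. subspace V \<Longrightarrow> I V \<Longrightarrow> V \<noteq> {0} \<Longrightarrow>
       \<exists>D. orthonormal D \<and> D \<noteq> {} \<and> D \<subseteq> V \<and> Q D \<and> I {y \<in> V. \<forall>d\<in>D. orthogonal y d}"
    and empty: "Q {}"
    and union: "\<And>C D. finite C \<Longrightarrow> finite D \<Longrightarrow> C \<inter> D = {} \<Longrightarrow> Q C \<Longrightarrow> Q D \<Longrightarrow> Q (C \<union> D)"
  shows "\<exists>C. orthonormal C \<and> span C = V \<and> Q C"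
  using V
proof (induction "dim V" arbitrary: V rule: less_induct)
  case less
  show ?case
  proof (cases "V = {0}")
    case True
    thus ?thesis using empty by (intro exI[of _ "{}"]) (simp add: orthonormal_def)
  next
    case False
    obtain D where D: "orthonormal D" "D \<noteq> {}" "D \<subseteq> V" "Q D" and I: "I {y \<in> V. \<forall>d\<in>D. orthogonal y d}"
      using split[OF less.prems False] by blast
    let ?W = "{y \<in> V. \<forall>d\<in>D. orthogonal y d}"
    have subW: "subspace ?W"
      using less.prems by (auto simp: subspace_def orthogonal_def inner_add_left)
    have finD: "finite D" using D orthonormal_finite by blast
    have "?W \<noteq> V"
    proof
      assume "?W = V"
      obtain d where d: "d \<in> D" using D by blast
      hence "orthogonal d d" using D \<open>?W = V\<close> by blast
      thus False using D d by (auto simp: orthogonal_def orthonormal_def norm_eq_1)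
    qed
    hence "dim ?W < dim V"
      by (metis (no_types, lifting) dim_psubset less.prems(1) mem_Collect_eq psubsetI span_eq_iff subW subsetI)
    then obtain C where C: "orthonormal C" "span C = ?W" "Q C" using less.hyps[OF _ subW I] by blast
    have CW: "C \<subseteq> ?W" using C span_superset by blast
    have disj: "C \<inter> D = {}"
    proof (rule ccontr)
      assume "C \<inter> D \<noteq> {}"
      then obtain d where "d \<in> C" "d \<in> D" by blast
      hence "orthogonal d d" using CW by blast
      thus False using D \<open>d \<in> D\<close> by (auto simp: orthogonal_def orthonormal_def norm_eq_1)
    qed
    have CD: "orthogonal x y" if "x \<in> C" "y \<in> D" for x y
      using that CW by blast
    have on: "orthonormal (C \<union> D)"
    proof -
      have "orthogonal x y" if "x \<in> C \<union> D" "y \<in> C \<union> D" "x \<noteq> y" for x y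
        using that CD CD[THEN orthogonal_commute[THEN iffD1]] C(1) D(1)
        unfolding orthonormal_def pairwise_def by blast
      thus ?thesis using C(1) D(1) unfolding orthonormal_def pairwise_def by blast
    qed
    have "span (C \<union> D) = V"
    proof
      show "span (C \<union> D) \<subseteq> V" using CW D less.prems(1) by (intro span_minimal) auto
      show "V \<subseteq> span (C \<union> D)"
      proof
        fix y assume y: "y \<in> V"
        define p where "p = (\<Sum>d\<in>D. (y \<bullet> d) *\<^sub>R d)"
        have pD: "p \<in> span D" unfolding p_def by (intro span_sum span_scale span_base)
        have "p \<in> V" using pD D less.prems(1) span_minimal by blast
        moreover have "orthogonal (y - p) d" if "d \<in> D" for d
        proof -
          have "p \<bullet> d = (\<Sum>e\<in>D. (y \<bullet> e) * (if e = d then 1 else 0))"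
            unfolding p_def inner_sum_left using that D(1)
            by (intro sum.cong) (auto simp: orthonormal_inner)
          also have "\<dots> = y \<bullet> d" using finD that by (simp add: sum.delta if_distrib cong: if_cong)
          finally show ?thesis by (simp add: orthogonal_def inner_diff_left)
        qed
        ultimately have "y - p \<in> span C" using C y less.prems(1) by (simp add: subspace_diff)
        hence "(y - p) + p \<in> span (C \<union> D)" using pD
          by (intro span_add) (meson span_mono subsetD sup_ge1 sup_ge2)+
        thus "y \<in> span (C \<union> D)" by simp
      qed
    qed
    thus ?thesis using on union[OF orthonormal_finite[OF C(1)] finD disj C(3) D(4)] by blast
  qed
qed

lemma selfadjoint_eigenbasis:
  fixes f :: "'a::euclidean_space \<Rightarrow> 'a"
  assumes lin: "linear f" and sa: "\<And>x y. f x \<bullet> y = x \<bullet> f y"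
  obtains C l where "orthonormal C" "span C = UNIV" "\<And>c. c \<in> C \<Longrightarrow> f c = l c *\<^sub>R c"
proof -
  have "\<exists>C. orthonormal C \<and> span C = UNIV \<and> (\<forall>c\<in>C. \<exists>l. f c = l *\<^sub>R c)"
  proof (rule orthonormal_split_induct[where I = "\<lambda>V. \<forall>x\<in>V. f x \<in> V"])
    fix V :: "'a set" assume V: "subspace V" "\<forall>x\<in>V. f x \<in> V" "V \<noteq> {0}"
    then obtain x l where x: "x \<in> V" "norm x = 1" "f x = l *\<^sub>R x"
      using selfadjoint_eigenvector[OF lin sa, of V] by metis
    show "\<exists>D. orthonormal D \<and> D \<noteq> {} \<and> D \<subseteq> V \<and> (\<forall>c\<in>D. \<exists>l. f c = l *\<^sub>R c) \<and>
       (\<forall>x\<in>{y \<in> V. \<forall>d\<in>D. orthogonal y d}. f x \<in> {y \<in> V. \<forall>d\<in>D. orthogonal y d})"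
      using x V by (intro exI[of _ "{x}"]) (auto simp: orthonormal_def orthogonal_def sa)
  qed auto
  thus thesis using that by metis
qed

text \<open>In an eigenbasis the root acts by \<open>sqrt (l c)\<close>. Writing a Gram operator as
  H H turns the vanishing of its symmetric part into an equality of norms.\<close>

lemma psd_sqrt:
  fixes Z :: "'a::euclidean_space \<Rightarrow> 'a"
  assumes lin: "linear Z" and sa: "\<And>x y. Z x \<bullet> y = x \<bullet> Z y" and psd: "\<And>x. Z x \<bullet> x \<ge> 0"
  obtains H where "linear H" "\<And>x y. H x \<bullet> y = x \<bullet> H y" "\<And>x. H (H x) = Z x"
proof -
  obtain C l where C: "orthonormal C" "span C = UNIV" and l: "\<And>c. c \<in> C \<Longrightarrow> Z c = l c *\<^sub>R c"
    using selfadjoint_eigenbasis[OF lin sa] by metis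
  note fin = orthonormal_finite[OF C(1)]
  have l0: "l c \<ge> 0" if "c \<in> C" for c
    using psd[of c] l[OF that] orthonormal_inner[OF C(1) that that] by simp
  define H where "H y = (\<Sum>c\<in>C. (sqrt (l c) * (y \<bullet> c)) *\<^sub>R c)" for y
  have linH: "linear H"
    unfolding H_def by (rule linearI) (simp_all add: inner_add_left algebra_simps sum.distrib scaleR_sum_right)
  have saH: "H x \<bullet> y = x \<bullet> H y" for x y
    by (simp add: H_def inner_sum_left inner_sum_right inner_commute mult_ac)
  have Hc: "H c = sqrt (l c) *\<^sub>R c" if "c \<in> C" for c
  proof -
    have "H c = (\<Sum>d\<in>C. if d = c then sqrt (l c) *\<^sub>R c else 0)"
      unfolding H_def using that by (intro sum.cong) (auto simp: orthonormal_inner[OF C(1)])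
    thus ?thesis using fin that by simp
  qed
  have HH: "H (H x) = Z x" for x
  proof -
    have x: "x = (\<Sum>c\<in>C. (x \<bullet> c) *\<^sub>R c)" using orthonormal_expand[OF C(1)] C(2) by blast
    have "H (H x) = (\<Sum>c\<in>C. (x \<bullet> c) *\<^sub>R H (H c))"
      by (subst x) (simp add: linear_sum[OF linH] linear_scale[OF linH])
    also have "\<dots> = (\<Sum>c\<in>C. (x \<bullet> c) *\<^sub>R Z c)"
      by (intro sum.cong) (auto simp: Hc linear_scale[OF linH] l l0)
    also have "\<dots> = Z x" by (subst (2) x) (simp add: linear_sum[OF lin] linear_scale[OF lin])
    finally show ?thesis .
  qed
  from that[OF linH saH HH] show thesis .
qed

text \<open>Equal norms give equal inner products and equal kernels, so sending P x to Q x is a well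
  defined isometry from \<open>range P\<close> onto \<open>range Q\<close>. The ranges have the same
  dimension, hence so do their orthogonal complements, and an isometry between the complements
  extends the map to the whole space.\<close>

lemma equal_norm_factor:
  fixes P Q :: "'x::euclidean_space \<Rightarrow> 'z::euclidean_space"
  assumes lP: "linear P" and lQ: "linear Q" and nn: "\<And>x. norm (P x) = norm (Q x)"
  obtains T where "orthogonal_transformation T" "\<And>x. T (P x) = Q x"
proof -
  have ip: "P x \<bullet> P y = Q x \<bullet> Q y" for x y
    using nn[of "x + y"] nn[of x] nn[of y]
    by (simp add: dot_norm linear_add[OF lP, symmetric] linear_add[OF lQ, symmetric])
  have subP: "subspace (range P)" and subQ: "subspace (range Q)"
    using lP lQ by (simp_all add: linear_subspace_image)
  obtain B where B: "B \<subseteq> range P" "pairwise orthogonal B" "\<And>x. x \<in> B \<Longrightarrow> norm x = 1" "independent B"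
      "card B = dim (range P)" "span B = range P"
    using orthonormal_basis_subspace[OF subP] by metis
  have oB: "orthonormal B" unfolding orthonormal_def using B(2,3) by blast
  note finB = orthonormal_finite[OF oB]
  have "\<forall>b\<in>B. \<exists>x. P x = b" using B(1) by blast
  then obtain x where x: "\<And>b. b \<in> B \<Longrightarrow> P (x b) = b" unfolding bchoice_iff by blast
  have Qx: "Q (x b) \<bullet> Q (x c) = (if b = c then 1 else 0)" if "b \<in> B" "c \<in> B" for b c
    using ip[of "x b" "x c"] x that orthonormal_inner[OF oB that] by simp
  \<comment> \<open>T0 sends the orthonormal basis b = P (x b) of \<open>range P\<close> to Q (x b)
    and vanishes on the orthogonal complement; \<open>pr\<close> below is the orthogonal projection
    onto \<open>range P\<close>.\<close>
  define T0 where "T0 y = (\<Sum>b\<in>B. (y \<bullet> b) *\<^sub>R Q (x b))" for y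
  have lT0: "linear T0" unfolding T0_def
    by (rule linearI) (simp_all add: inner_add_left algebra_simps sum.distrib scaleR_sum_right)
  define pr where "pr y = (\<Sum>b\<in>B. (y \<bullet> b) *\<^sub>R b)" for y
  have lpr: "linear pr" unfolding pr_def
    by (rule linearI) (simp_all add: inner_add_left algebra_simps sum.distrib scaleR_sum_right)
  have T0P: "T0 (P u) = Q u" for u
  proof -
    have "P u = pr (P u)" unfolding pr_def using orthonormal_expand[OF oB] B(6) by blast
    also have "\<dots> = P (\<Sum>b\<in>B. (P u \<bullet> b) *\<^sub>R x b)"
      unfolding pr_def by (simp add: linear_sum[OF lP] linear_scale[OF lP] x)
    finally have "P (u - (\<Sum>b\<in>B. (P u \<bullet> b) *\<^sub>R x b)) = 0" by (simp add: linear_diff[OF lP])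
    hence "Q (u - (\<Sum>b\<in>B. (P u \<bullet> b) *\<^sub>R x b)) = 0" using nn by (metis norm_eq_zero)
    thus ?thesis by (simp add: T0_def linear_diff[OF lQ] linear_sum[OF lQ] linear_scale[OF lQ])
  qed
  have dimeq: "dim (range P) = dim (range Q)"
  proof -
    have inj: "inj_on (\<lambda>b. Q (x b)) B" using Qx by (intro inj_onI) (metis zero_neq_one)
    have rg: "range Q = span ((\<lambda>b. Q (x b)) ` B)"
    proof
      show "range Q \<subseteq> span ((\<lambda>b. Q (x b)) ` B)"
      proof
        fix y assume "y \<in> range Q"
        then obtain u where "y = T0 (P u)" using T0P by auto
        thus "y \<in> span ((\<lambda>b. Q (x b)) ` B)" unfolding T0_def
          using span_sum[of B "\<lambda>b. (P u \<bullet> b) *\<^sub>R Q (x b)" "(\<lambda>b. Q (x b)) ` B"]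
          by (simp add: span_scale span_base)
      qed
      show "span ((\<lambda>b. Q (x b)) ` B) \<subseteq> range Q" using subQ by (intro span_minimal) auto
    qed
    have "independent ((\<lambda>b. Q (x b)) ` B)"
    proof (rule pairwise_orthogonal_independent)
      show "pairwise orthogonal ((\<lambda>b. Q (x b)) ` B)"
        using Qx by (auto simp: pairwise_def orthogonal_def)
      show "0 \<notin> (\<lambda>b. Q (x b)) ` B" using Qx by (metis (mono_tags, lifting) image_iff inner_zero_left zero_neq_one)
    qed
    hence "dim (range Q) = card B" unfolding rg
      using inj by (simp add: dim_span dim_eq_card_independent card_image)
    thus ?thesis using B(5) by simp
  qed
  define Pc where "Pc = {y. \<forall>z\<in>range P. orthogonal z y}"
  define Qc where "Qc = {y. \<forall>z\<in>range Q. orthogonal z y}"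
  have sPc: "subspace Pc" and sQc: "subspace Qc"
    by (auto simp: Pc_def Qc_def subspace_def orthogonal_def inner_add_right)
  have "dim Pc = dim Qc"
    using dim_subspace_orthogonal_to_vectors[OF subP subspace_UNIV] dim_subspace_orthogonal_to_vectors[OF subQ subspace_UNIV]
      dimeq by (simp add: Pc_def Qc_def)
  then obtain J where J: "linear J" "J ` Pc = Qc" "\<And>y. y \<in> Pc \<Longrightarrow> norm (J y) = norm y"
    using isometry_subspaces[OF sPc sQc] by metis
  define T where "T y = T0 y + J (y - pr y)" for y
  have lT: "linear T" unfolding T_def
    by (intro linear_compose_add lT0 linear_compose[OF _ J(1), unfolded o_def] linear_compose_sub linear_id[unfolded id_def] lpr)
  have prb: "pr y \<bullet> b = y \<bullet> b" if "b \<in> B" for y b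
  proof -
    have "pr y \<bullet> b = (\<Sum>c\<in>B. (y \<bullet> c) * (if c = b then 1 else 0))"
      unfolding pr_def inner_sum_left using that by (intro sum.cong) (auto simp: orthonormal_inner[OF oB])
    thus ?thesis using finB that by (simp add: sum.delta if_distrib cong: if_cong)
  qed
  have Pcm: "y - pr y \<in> Pc" for y
  proof -
    have "z \<bullet> (y - pr y) = 0" if "z \<in> range P" for z
    proof -
      have "z \<bullet> (y - pr y) = (\<Sum>b\<in>B. (z \<bullet> b) * ((y - pr y) \<bullet> b))"
        using orthonormal_parseval[OF oB] that B(6) by blast
      thus ?thesis by (simp add: inner_diff_left prb)
    qed
    thus ?thesis by (simp add: Pc_def orthogonal_def)
  qed
  have nT: "norm (T y) = norm y" for y
  proof -
    have "T0 y \<in> range Q"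
      using subQ unfolding T0_def by (intro subspace_sum subspace_scale) auto
    hence o1: "T0 y \<bullet> J (y - pr y) = 0" using Pcm[of y] J(2) unfolding Qc_def orthogonal_def by blast
    have "pr y \<in> range P" using subP B(1) unfolding pr_def by (intro subspace_sum subspace_scale) auto
    hence o2: "pr y \<bullet> (y - pr y) = 0" using Pcm[of y] unfolding Pc_def orthogonal_def by blast
    have n0: "T0 y \<bullet> T0 y = (\<Sum>b\<in>B. (y \<bullet> b)\<^sup>2)"
    proof -
      have "T0 y \<bullet> T0 y = (\<Sum>b\<in>B. \<Sum>c\<in>B. (y \<bullet> b) * (y \<bullet> c) * (if c = b then 1 else 0))"
        unfolding T0_def inner_sum_left inner_sum_right by (intro sum.cong refl) (simp add: Qx mult_ac)
      thus ?thesis using finB by (simp add: power2_eq_square if_distrib sum.delta cong: if_cong)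
    qed
    have n1: "pr y \<bullet> pr y = (\<Sum>b\<in>B. (y \<bullet> b)\<^sup>2)"
      by (subst (2) pr_def) (simp add: inner_sum_right prb power2_eq_square)
    have "T y \<bullet> T y = T0 y \<bullet> T0 y + J (y - pr y) \<bullet> J (y - pr y)"
      using o1 by (simp add: T_def inner_add_left inner_add_right inner_commute)
    also have "\<dots> = pr y \<bullet> pr y + (y - pr y) \<bullet> (y - pr y)"
      using n0 n1 J(3)[OF Pcm[of y]] by (simp add: dot_square_norm)
    also have "\<dots> = y \<bullet> y" using o2 by (simp add: inner_diff_left inner_diff_right inner_commute)
    finally show ?thesis by (simp add: norm_eq)
  qed
  have "T (P u) = Q u" for u
  proof -
    have "pr (P u) = P u" unfolding pr_def using orthonormal_expand[OF oB, of "P u"] B(6) by simp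
    thus ?thesis by (simp add: T_def T0P linear_0[OF J(1)])
  qed
  moreover have "orthogonal_transformation T" using lT nT by (simp add: orthogonal_transformation)
  ultimately show thesis using that by blast
qed

text \<open>The real normal form of an orthogonal map: the space splits into invariant lines and
  into planes on which U is a rotation. Of the basis only the sign of the sum of \<tau> is recorded,
  which follows if every line and every rotated plane contributes a nonnegative amount.\<close>

lemma isometry_invariant_basis:
  fixes U U' :: "'a::euclidean_space \<Rightarrow> 'a" and \<tau> :: "'a \<Rightarrow> real"
  assumes lU: "linear U" and lU': "linear U'" and adj: "\<And>x y. U x \<bullet> y = x \<bullet> U' y"
    and UU': "\<And>x. U (U' x) = x" and U'U: "\<And>x. U' (U x) = x"
    and line: "\<And>x l. norm x = 1 \<Longrightarrow> U x = l *\<^sub>R x \<Longrightarrow> \<tau> x \<ge> 0"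
    and plane: "\<And>x y c s. U x = c *\<^sub>R x + s *\<^sub>R y \<Longrightarrow> U y = c *\<^sub>R y - s *\<^sub>R x \<Longrightarrow>
        s \<noteq> 0 \<Longrightarrow> c\<^sup>2 + s\<^sup>2 = 1 \<Longrightarrow> \<tau> x + \<tau> y \<ge> 0"
  shows "\<exists>C. orthonormal C \<and> span C = UNIV \<and> (\<Sum>c\<in>C. \<tau> c) \<ge> 0"
proof (rule orthonormal_split_induct[where I = "\<lambda>V. \<forall>x\<in>V. U x \<in> V \<and> U' x \<in> V"])
  fix V :: "'a set"
  assume V: "subspace V" "\<forall>x\<in>V. U x \<in> V \<and> U' x \<in> V" "V \<noteq> {0}"
  \<comment> \<open>U + U' is self-adjoint and therefore has a real eigenvector x in V, even if U
    has none. Then U' x is a combination of x and U x, so the span of x and U x is invariant under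
    both maps.\<close>
  define S where "S x = U x + U' x" for x
  have "linear S" unfolding S_def using lU lU' by (intro linear_compose_add)
  moreover have "S x \<bullet> y = x \<bullet> S y" for x y
    using adj[of x y] adj[of y x] by (simp add: S_def inner_add_left inner_add_right inner_commute)
  ultimately obtain x l where x: "x \<in> V" "norm x = 1" and Sx: "S x = l *\<^sub>R x"
    using selfadjoint_eigenvector[of S V] V by (metis S_def subspace_add)
  have xx: "x \<bullet> x = 1" using x by (simp add: norm_eq_1)
  define c where "c = U x \<bullet> x"
  have "U' x \<bullet> x = c" using adj[of x x] by (simp add: inner_commute c_def)
  hence "S x \<bullet> x = 2 * c" by (simp add: S_def inner_add_left c_def)
  hence l: "l = 2 * c" using Sx xx by simp
  have U'x: "U' x = (2 * c) *\<^sub>R x - U x" using Sx l by (simp add: S_def algebra_simps)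
  \<comment> \<open>The part of U x orthogonal to x. If it vanishes, x spans an invariant line;
    otherwise x and the normalized w span a plane which U rotates, with cosine c and sine
    |w|.\<close>
  define w where "w = U x - c *\<^sub>R x"
  have wV: "w \<in> V" using V x by (simp add: w_def subspace_diff subspace_scale)
  have wx: "w \<bullet> x = 0" using xx by (simp add: w_def inner_diff_left c_def)
  have "U x \<bullet> U x = 1" using adj[of x "U x"] U'U xx by simp
  hence ww: "w \<bullet> w = 1 - c\<^sup>2" using xx
    by (simp add: w_def inner_diff_left inner_diff_right c_def inner_commute power2_eq_square)
  show "\<exists>D. orthonormal D \<and> D \<noteq> {} \<and> D \<subseteq> V \<and> (\<Sum>c\<in>D. \<tau> c) \<ge> 0 \<and>
       (\<forall>x\<in>{y \<in> V. \<forall>d\<in>D. orthogonal y d}. U x \<in> {y \<in> V. \<forall>d\<in>D. orthogonal y d} \<and>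
          U' x \<in> {y \<in> V. \<forall>d\<in>D. orthogonal y d})"
  proof (cases "w = 0")
    case True
    hence Ux: "U x = c *\<^sub>R x" "U' x = c *\<^sub>R x" using U'x by (simp_all add: w_def scaleR_left.diff[symmetric])
    have "U y \<bullet> x = 0 \<and> U' y \<bullet> x = 0" if "y \<bullet> x = 0" for y
      using that adj[of y x] adj[of x y] Ux by (simp add: inner_commute)
    thus ?thesis using x V(2) line[OF x(2) Ux(1)]
      by (intro exI[of _ "{x}"]) (auto simp: orthonormal_def orthogonal_def)
  next
    case False
    define s where "s = norm w"
    define y where "y = w /\<^sub>R s"
    have s: "s > 0" using False by (simp add: s_def)
    have cs: "c\<^sup>2 + s\<^sup>2 = 1" using ww by (simp add: s_def dot_square_norm)
    have ny: "norm y = 1" using s by (simp add: y_def s_def)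
    have yx: "y \<bullet> x = 0" using wx by (simp add: y_def)
    have yV: "y \<in> V" using wV V by (simp add: y_def subspace_scale)
    have sy: "s *\<^sub>R y = w" using s by (simp add: y_def)
    have Ux: "U x = c *\<^sub>R x + s *\<^sub>R y" unfolding sy by (simp add: w_def)
    have U'x: "U' x = c *\<^sub>R x - s *\<^sub>R y" unfolding U'x Ux mult_2 scaleR_left_distrib by simp
    have "x = U' (U x)" by (simp add: U'U)
    also have "\<dots> = c *\<^sub>R U' x + s *\<^sub>R U' y" by (simp add: Ux linear_add[OF lU'] linear_scale[OF lU'])
    finally have "s *\<^sub>R U' y = x - c *\<^sub>R (c *\<^sub>R x - s *\<^sub>R y)" by (simp add: U'x algebra_simps)
    also have "\<dots> = s *\<^sub>R (s *\<^sub>R x + c *\<^sub>R y)"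
      using arg_cong[OF cs, of "\<lambda>r. r *\<^sub>R x"] by (simp add: algebra_simps power2_eq_square)
    finally have U'y: "U' y = s *\<^sub>R x + c *\<^sub>R y" using s by simp
    have "x = U (U' x)" by (simp add: UU')
    also have "\<dots> = c *\<^sub>R U x - s *\<^sub>R U y" by (simp add: U'x linear_diff[OF lU] linear_scale[OF lU])
    finally have "s *\<^sub>R U y = c *\<^sub>R (c *\<^sub>R x + s *\<^sub>R y) - x" by (simp add: Ux algebra_simps)
    also have "\<dots> = s *\<^sub>R (c *\<^sub>R y - s *\<^sub>R x)"
      using arg_cong[OF cs, of "\<lambda>r. r *\<^sub>R x"] by (simp add: algebra_simps power2_eq_square)
    finally have Uy: "U y = c *\<^sub>R y - s *\<^sub>R x" using s by simp
    have xy: "x \<noteq> y" using xx yx by auto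
    have "U z \<bullet> x = 0 \<and> U z \<bullet> y = 0 \<and> U' z \<bullet> x = 0 \<and> U' z \<bullet> y = 0" if "z \<bullet> x = 0" "z \<bullet> y = 0" for z
      using that adj[of z x] adj[of z y] adj[of x z] adj[of y z] Ux Uy U'x U'y
      by (simp add: inner_commute inner_add_left inner_diff_left inner_add_right inner_diff_right)
    moreover have "\<tau> x + \<tau> y \<ge> 0" using plane[OF Ux Uy _ cs] s by simp
    ultimately show ?thesis using x yV ny V(2) yx xy
      by (intro exI[of _ "{x,y}"])
        (auto simp: orthonormal_def orthogonal_def pairwise_def inner_commute)
  qed
qed (auto simp: sum.union_disjoint)

text \<open>Cyclicity and basis independence of the trace: both sides are the trace of H S H, one in
  the standard basis and one in C.\<close>

lemma orthonormal_trace_swap: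
  fixes S H :: "'a::euclidean_space \<Rightarrow> 'a"
  assumes C: "orthonormal C" "span C = UNIV"
    and sH: "\<And>x y. H x \<bullet> y = x \<bullet> H y" and sS: "\<And>x y. S x \<bullet> y = x \<bullet> S y"
  shows "(\<Sum>b\<in>Basis. S b \<bullet> H (H b)) = (\<Sum>c\<in>C. S (H c) \<bullet> H c)"
proof -
  have HS: "H (S b) \<bullet> c = S (H c) \<bullet> b" for b c
    using sH[of "S b" c] sS[of b "H c"] by (simp add: inner_commute)
  have HC: "H b \<bullet> c = H c \<bullet> b" for b c
    using sH[of b c] by (simp add: inner_commute)
  have "(\<Sum>b\<in>Basis. S b \<bullet> H (H b)) = (\<Sum>b\<in>Basis. H (S b) \<bullet> H b)"
    by (simp add: sH)
  also have "\<dots> = (\<Sum>b\<in>Basis. \<Sum>c\<in>C. (H (S b) \<bullet> c) * (H b \<bullet> c))"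
    using C by (intro sum.cong refl orthonormal_parseval) auto
  also have "\<dots> = (\<Sum>b\<in>Basis. \<Sum>c\<in>C. (S (H c) \<bullet> b) * (H c \<bullet> b))"
    using HS HC by simp
  also have "\<dots> = (\<Sum>c\<in>C. \<Sum>b\<in>Basis. (S (H c) \<bullet> b) * (H c \<bullet> b))" by (rule sum.swap)
  also have "\<dots> = (\<Sum>c\<in>C. S (H c) \<bullet> H c)"
    by (intro sum.cong refl euclidean_inner[symmetric])
  finally show ?thesis .
qed

text \<open>The key step of Rantzer's proof of the Kalman-Yakubovich-Popov lemma: a Gram operator whose
  state/derivative blocks have no symmetric part is a sum of Gram operators of harmonic
  oscillations, because (F+E)H and (F-E)H differ by an orthogonal map.\<close>

lemma rantzer_trace_nonneg:
  fixes Z S :: "'z::euclidean_space \<Rightarrow> 'z" and E F :: "'z \<Rightarrow> 'x::euclidean_space"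
  assumes lZ: "linear Z" and sZ: "\<And>x y. Z x \<bullet> y = x \<bullet> Z y" and psd: "\<And>x. Z x \<bullet> x \<ge> 0"
    and lS: "linear S" and sS: "\<And>x y. S x \<bullet> y = x \<bullet> S y"
    and lE: "linear E" and lF: "linear F"
    and skew: "\<And>y. Z (adjoint E y) \<bullet> adjoint F y = 0"
    and finite_freq: "\<And>\<omega> z1 z2. F z1 = - \<omega> *\<^sub>R E z2 \<Longrightarrow> F z2 = \<omega> *\<^sub>R E z1 \<Longrightarrow> S z1 \<bullet> z1 + S z2 \<bullet> z2 \<ge> 0"
    and infinite_freq: "\<And>z. E z = 0 \<Longrightarrow> S z \<bullet> z \<ge> 0"
  shows "(\<Sum>b\<in>Basis. S b \<bullet> Z b) \<ge> 0"
proof -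
  obtain H where lH: "linear H" and sH: "\<And>x y. H x \<bullet> y = x \<bullet> H y" and HH: "\<And>x. H (H x) = Z x"
    using psd_sqrt[OF lZ sZ psd] by metis
  have zero_freq: "S z \<bullet> z \<ge> 0" if "F z = 0" for z
    using finite_freq[of z 0 0] that by (simp add: linear_0[OF lF] linear_0[OF lE] linear_0[OF lS])
  \<comment> \<open>By \<open>skew\<close> the images under H of the two adjoints at y are
    orthogonal, so their sum and their difference have equal norms.\<close>
  define P Q where "P y = H (adjoint F y - adjoint E y)" and "Q y = H (adjoint F y + adjoint E y)" for y
  note lad = adjoint_linear[OF lE] adjoint_linear[OF lF]
  have lPQ: "linear P" "linear Q" unfolding P_def Q_def
    by (intro linear_compose[OF _ lH, unfolded o_def] linear_compose_sub linear_compose_add lad)+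
  have sk: "H (adjoint E y) \<bullet> H (adjoint F y) = 0" for y
    using skew[of y] sH[of "H (adjoint E y)" "adjoint F y"] by (simp add: HH)
  have nn: "norm (P y) = norm (Q y)" for y
    using sk[of y] by (simp add: norm_eq P_def Q_def linear_add[OF lH] linear_diff[OF lH]
      inner_add_left inner_add_right inner_diff_left inner_diff_right inner_commute)
  obtain T where oT: "orthogonal_transformation T" and TP: "\<And>y. T (P y) = Q y"
    using equal_norm_factor[OF lPQ nn] by blast
  define U where "U = adjoint T"
  have lT: "linear T" using oT by (simp add: orthogonal_transformation_linear)
  have lU: "linear U" unfolding U_def by (rule adjoint_linear[OF lT])
  have adj: "U x \<bullet> y = x \<bullet> T y" for x y
    using adjoint_works[OF lT, of y x] by (simp add: U_def inner_commute)
  have UT: "U (T x) = x" for x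
  proof -
    have "U (T x) \<bullet> y = x \<bullet> y" for y using adj[of "T x" y] oT by (simp add: orthogonal_transformation_def)
    thus ?thesis by (metis vector_eq_ldot inner_commute)
  qed
  have TU: "T (U x) = x" for x
  proof -
    obtain y where "x = T y" using orthogonal_transformation_surj[OF oT] by (metis surjD)
    thus ?thesis by (simp add: UT)
  qed
  \<comment> \<open>The adjoint of T P = Q, with U the adjoint of T: (F + E) H = (F - E) H U. Thus
    invariant lines and planes of U yield harmonic oscillations.\<close>
  have key: "F (H x) + E (H x) = F (H (U x)) - E (H (U x))" for x
  proof -
    have "(F (H x) + E (H x)) \<bullet> y = (F (H (U x)) - E (H (U x))) \<bullet> y" for y
    proof -
      have "(F (H x) + E (H x)) \<bullet> y = x \<bullet> Q y"
        by (simp add: Q_def sH[symmetric] inner_add_left inner_add_right adjoint_works[OF lE] adjoint_works[OF lF])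
      also have "\<dots> = U x \<bullet> P y" by (simp add: adj TP)
      also have "\<dots> = (F (H (U x)) - E (H (U x))) \<bullet> y"
        by (simp add: P_def sH[symmetric] inner_diff_left inner_diff_right adjoint_works[OF lE] adjoint_works[OF lF])
      finally show ?thesis .
    qed
    thus ?thesis by (metis vector_eq_rdot)
  qed
  define \<tau> where "\<tau> x = S (H x) \<bullet> H x" for x
  have "\<exists>C. orthonormal C \<and> span C = UNIV \<and> (\<Sum>c\<in>C. \<tau> c) \<ge> 0"
  proof (rule isometry_invariant_basis[OF lU lT adj UT TU])
    fix x l assume x: "norm x = 1" "U x = l *\<^sub>R x"
    have "norm (U x) = norm x"
      using TU[of x] orthogonal_transformation_norm[OF oT, of "U x"] by simp
    hence "\<bar>l\<bar> = 1" using x by simp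
    \<comment> \<open>Eigenvalue 1 of U corresponds to infinite frequency, where E (H x) = 0, and
      eigenvalue -1 to frequency zero, where F (H x) = 0.\<close>
    hence "l = 1 \<or> l = -1" by linarith
    thus "\<tau> x \<ge> 0"
    proof
      assume "l = 1"
      hence "E (H x) = - E (H x)" using key[of x] x by simp
      hence "E (H x) = 0" by (simp add: eq_neg_iff_add_eq_0 scaleR_2[symmetric])
      thus ?thesis unfolding \<tau>_def by (rule infinite_freq)
    next
      assume "l = -1"
      hence "F (H x) = - F (H x)" using key[of x] x
        by (simp add: linear_neg[OF lH] linear_neg[OF lE] linear_neg[OF lF])
      hence "F (H x) = 0" by (simp add: eq_neg_iff_add_eq_0 scaleR_2[symmetric])
      thus ?thesis unfolding \<tau>_def by (rule zero_freq)
    qed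
  next
    fix x y c s
    assume Ux: "U x = c *\<^sub>R x + s *\<^sub>R y" and Uy: "U y = c *\<^sub>R y - s *\<^sub>R x"
      and s: "s \<noteq> (0::real)" and cs: "c\<^sup>2 + s\<^sup>2 = (1::real)"
    define f1 f2 e1 e2 where "f1 = F (H x)" "f2 = F (H y)" "e1 = E (H x)" "e2 = E (H y)"
    note lin = linear_add[OF lH] linear_diff[OF lH] linear_scale[OF lH]
       linear_add[OF lE] linear_diff[OF lE] linear_scale[OF lE]
       linear_add[OF lF] linear_diff[OF lF] linear_scale[OF lF]
    have k1: "f1 + e1 = c *\<^sub>R (f1 - e1) + s *\<^sub>R (f2 - e2)"
      using key[of x] by (simp add: Ux lin f1_f2_e1_e2_def algebra_simps)
    have k2: "f2 + e2 = c *\<^sub>R (f2 - e2) - s *\<^sub>R (f1 - e1)"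
      using key[of y] by (simp add: Uy lin f1_f2_e1_e2_def algebra_simps)
    have c1: "c \<noteq> 1" using s cs by auto
    \<comment> \<open>The Cayley transform: a rotation by the angle \<theta> corresponds to the
      frequency cot (\<theta>/2) = s / (1 - c).\<close>
    define \<omega> where "\<omega> = s / (1 - c)"
    have "f1 \<bullet> b = (- \<omega> *\<^sub>R e2) \<bullet> b" "f2 \<bullet> b = (\<omega> *\<^sub>R e1) \<bullet> b" for b
    proof -
      define F1 F2 E1 E2 where "F1 = f1 \<bullet> b" "F2 = f2 \<bullet> b" "E1 = e1 \<bullet> b" "E2 = e2 \<bullet> b"
      have q1: "F1 + E1 = c * (F1 - E1) + s * (F2 - E2)"
        using arg_cong[OF k1, of "\<lambda>v. v \<bullet> b"] by (simp add: inner_add_left inner_diff_left F1_F2_E1_E2_def)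
      have q2: "F2 + E2 = c * (F2 - E2) - s * (F1 - E1)"
        using arg_cong[OF k2, of "\<lambda>v. v \<bullet> b"] by (simp add: inner_add_left inner_diff_left F1_F2_E1_E2_def)
      have "2 * (1 - c) * F1 = - 2 * s * E2" "2 * (1 - c) * F2 = 2 * s * E1"
        using q1 q2 cs by algebra+
      hence "F1 = - \<omega> * E2" "F2 = \<omega> * E1" using c1 by (simp_all add: \<omega>_def field_simps)
      thus "f1 \<bullet> b = (- \<omega> *\<^sub>R e2) \<bullet> b" "f2 \<bullet> b = (\<omega> *\<^sub>R e1) \<bullet> b" by (simp_all add: F1_F2_E1_E2_def)
    qed
    hence "f1 = - \<omega> *\<^sub>R e2" "f2 = \<omega> *\<^sub>R e1" by (metis vector_eq_rdot)+
    thus "\<tau> x + \<tau> y \<ge> 0" unfolding \<tau>_def f1_f2_e1_e2_def by (intro finite_freq) auto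
  qed
  then obtain C where C: "orthonormal C" "span C = UNIV" "(\<Sum>c\<in>C. \<tau> c) \<ge> 0" by blast
  have "(\<Sum>b\<in>Basis. S b \<bullet> H (H b)) = (\<Sum>c\<in>C. \<tau> c)"
    unfolding \<tau>_def by (rule orthonormal_trace_swap[OF C(1,2) sH sS])
  thus ?thesis using C(3) by (simp add: HH)
qed

section \<open>Linear differential equations on the half line\<close>

text \<open>A copy of the type of bounded operators with composition as multiplication, for which exp is available.\<close>

typedef (overloaded) ('a::euclidean_space) endo = "UNIV :: ('a \<Rightarrow>\<^sub>L 'a) set"
  morphisms op_of Endo by blast

lemma op_of_Endo [simp]: "op_of (Endo f) = f" by (simp add: Endo_inverse)

instantiation endo :: (euclidean_space) real_normed_algebra_1
begin
definition "0 = Endo 0"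
definition "1 = Endo id_blinfun"
definition "a + b = Endo (op_of a + op_of b)"
definition "a - b = Endo (op_of a - op_of b)"
definition "- a = Endo (- op_of a)"
definition "a * b = Endo (op_of a o\<^sub>L op_of b)"
definition "r *\<^sub>R a = Endo (r *\<^sub>R op_of a)"
definition "norm a = norm (op_of a)"
definition "sgn a = Endo (sgn (op_of a))"
definition "dist a b = dist (op_of a) (op_of b)"
definition [code del]: "(uniformity :: ('a endo \<times> 'a endo) filter) = (INF e\<in>{0<..}. principal {(x, y). dist x y < e})"
definition open_endo :: "'a endo set \<Rightarrow> bool" where [code del]:
  "open_endo S = (\<forall>x\<in>S. \<forall>\<^sub>F (x', y) in uniformity. x' = x \<longrightarrow> y \<in> S)"
instance
proof
  fix a b c :: "'a endo" and r s :: real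
  note [simp] = op_of_inject[symmetric] zero_endo_def one_endo_def plus_endo_def minus_endo_def
      uminus_endo_def times_endo_def scaleR_endo_def norm_endo_def sgn_endo_def dist_endo_def
  show "norm (a * b) \<le> norm a * norm b" by (simp add: norm_blinfun_compose)
  show "norm (a + b) \<le> norm a + norm b" by (simp add: norm_triangle_ineq)
  have "(id_blinfun :: 'a \<Rightarrow>\<^sub>L 'a) \<noteq> 0" by (metis norm_blinfun_id norm_zero zero_neq_one)
  thus "(0 :: 'a endo) \<noteq> 1" by simp
qed (auto simp: op_of_inject[symmetric] zero_endo_def one_endo_def plus_endo_def minus_endo_def
      uminus_endo_def times_endo_def scaleR_endo_def norm_endo_def sgn_endo_def dist_endo_def
      uniformity_endo_def open_endo_def sgn_div_norm dist_norm algebra_simps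
      blinfun.add_left blinfun.add_right blinfun.scaleR_left blinfun.scaleR_right
      intro!: blinfun_eqI)
end

instance endo :: (euclidean_space) banach
proof
  fix X :: "nat \<Rightarrow> 'a endo" assume "Cauchy X"
  hence "Cauchy (\<lambda>n. op_of (X n))" by (simp add: Cauchy_def dist_endo_def)
  then obtain L where "(\<lambda>n. op_of (X n)) \<longlonglongrightarrow> L" by (metis Cauchy_convergent convergent_def)
  hence "X \<longlonglongrightarrow> Endo L" by (simp add: LIMSEQ_iff dist_endo_def norm_endo_def minus_endo_def lim_sequentially dist_norm)
  thus "convergent X" by (auto simp: convergent_def)
qed

section \<open>The exponential flow of a linear map\<close>

definition opflow :: "('a::euclidean_space \<Rightarrow> 'a) \<Rightarrow> real \<Rightarrow> 'a \<Rightarrow>\<^sub>L 'a" where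
  "opflow A t = op_of (exp (t *\<^sub>R Endo (Blinfun A)))"

definition flow :: "('a::euclidean_space \<Rightarrow> 'a) \<Rightarrow> real \<Rightarrow> 'a \<Rightarrow> 'a" where
  "flow A t = blinfun_apply (opflow A t)"

lemma bounded_linear_op_of: "bounded_linear op_of"
  by (rule bounded_linear_intro[where K = 1])
    (simp_all add: plus_endo_def scaleR_endo_def norm_endo_def)

lemma Blinfun_apply: "linear A \<Longrightarrow> blinfun_apply (Blinfun A) = A" for A :: "'a::euclidean_space \<Rightarrow> 'a"
  by (simp add: bounded_linear_Blinfun_apply linear_conv_bounded_linear)

lemma flow_linear: "linear (flow A t)"
  unfolding flow_def using blinfun.bounded_linear_right linear_conv_bounded_linear by blast

lemma flow_0 [simp]: "flow A 0 x = x"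
  by (simp add: flow_def opflow_def one_endo_def)

lemma flow_inverse: "flow A t (flow A (- t) x) = x"
proof -
  have "exp (t *\<^sub>R Endo (Blinfun A)) * exp (- (t *\<^sub>R Endo (Blinfun A))) = 1" by (rule exp_minus_inverse)
  from arg_cong[OF this, of "\<lambda>e. blinfun_apply (op_of e) x"] show ?thesis
    by (simp add: flow_def opflow_def times_endo_def one_endo_def)
qed

lemma flow_commute: "linear A \<Longrightarrow> flow A t (A x) = A (flow A t x)"
proof -
  assume A: "linear A"
  have "exp (t *\<^sub>R Endo (Blinfun A)) * Endo (Blinfun A) = Endo (Blinfun A) * exp (t *\<^sub>R Endo (Blinfun A))"
    by (rule exp_times_scaleR_commute)
  from arg_cong[OF this, of "\<lambda>e. blinfun_apply (op_of e) x"] show ?thesis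
    by (simp add: flow_def opflow_def times_endo_def Blinfun_apply[OF A])
qed

lemma opflow_derivative:
  "(opflow A has_vector_derivative opflow A t o\<^sub>L Blinfun A) (at t within S)"
  using bounded_linear.has_vector_derivative[OF bounded_linear_op_of
      exp_scaleR_has_vector_derivative_right[of "Endo (Blinfun A)" t S]]
  by (simp add: opflow_def[abs_def] times_endo_def)

lemma flow_derivative_comp:
  assumes A: "linear A" and c: "(c has_vector_derivative c') (at t within S)"
  shows "((\<lambda>t. flow A t (c t)) has_vector_derivative A (flow A t (c t)) + flow A t c') (at t within S)"
  using bounded_bilinear.has_vector_derivative[OF bounded_bilinear_blinfun_apply opflow_derivative[of A t S] c]
  by (simp add: flow_def[symmetric] Blinfun_apply[OF A] flow_commute[OF A] add.commute)

lemma flow_derivative: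
  "linear A \<Longrightarrow> ((\<lambda>t. flow A t x) has_vector_derivative A (flow A t x)) (at t within S)"
  using flow_derivative_comp[of A "\<lambda>_. x" 0 t S] by (simp add: linear_0[OF flow_linear])

text \<open>The integrating factor for x' = A x: along a solution c the derivative is zero, which
  gives uniqueness.\<close>

lemma flow_minus_derivative_comp:
  assumes A: "linear A" and c: "(c has_vector_derivative c') (at t within S)"
  shows "((\<lambda>t. flow A (- t) (c t)) has_vector_derivative flow A (- t) (c' - A (c t))) (at t within S)"
proof -
  have "((\<lambda>t. opflow A (- t)) has_vector_derivative - (opflow A (- t) o\<^sub>L Blinfun A)) (at t within S)"
    using vector_diff_chain_within[OF _ opflow_derivative, of uminus "-1" t S A]
    by (simp add: o_def has_vector_derivative_minus[OF has_vector_derivative_id, unfolded id_def])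
  from bounded_bilinear.has_vector_derivative[OF bounded_bilinear_blinfun_apply this c]
  show ?thesis by (simp add: flow_def[symmetric] Blinfun_apply[OF A] blinfun.minus_left linear_diff[OF flow_linear])
qed

lemma continuous_on_flow_minus:
  assumes "continuous_on S f"
  shows "continuous_on S (\<lambda>t. flow A (- t) (f t))"
proof -
  have "continuous_on UNIV (opflow A)"
    by (intro continuous_at_imp_continuous_on ballI has_vector_derivative_continuous[OF opflow_derivative])
  hence "continuous_on S (\<lambda>t. opflow A (- t))"
    by (rule continuous_on_compose2) (simp_all add: continuous_on_minus)
  from bounded_bilinear.continuous_on[OF bounded_bilinear_blinfun_apply this assms]
  show ?thesis by (simp add: flow_def)
qed

text \<open>An absolutely continuous function on the half line, given together with its derivative and
  initial value.\<close>

definition primitive :: "(real \<Rightarrow> 'a::euclidean_space) \<Rightarrow> (real \<Rightarrow> 'a) \<Rightarrow> 'a \<Rightarrow> bool" where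
  "primitive x f a \<longleftrightarrow> (\<forall>t\<ge>0. set_integrable lborel {0..t} f \<and> x t = a + (LINT s:{0..t}|lborel. f s))"

text \<open>\<open>traj\<close> is specified with the gauge integral while the estimates use the
  Lebesgue integral; this is the bridge between them.\<close>

lemma primitive_HK:
  assumes "primitive x f a" "t \<ge> 0"
  shows "f integrable_on {0..t}" "x t = a + integral {0..t} f"
  using assms set_borel_integral_eq_integral[of "{0..t}" f] by (auto simp: primitive_def)

lemma primitive_continuous:
  assumes "primitive x f a" shows "continuous_on {0..} x"
proof -
  have c: "continuous_on {0..T} x" if "T \<ge> 0" for T
  proof -
    have "continuous_on {0..T} (\<lambda>t. a + integral {0..t} f)"
      by (intro continuous_intros indefinite_integral_continuous_1 primitive_HK(1)[OF assms that])
    thus ?thesis using primitive_HK(2)[OF assms] by (subst continuous_on_cong[OF refl]) auto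
  qed
  show ?thesis unfolding continuous_on_eq_continuous_within
  proof
    fix t :: real assume "t \<in> {0..}"
    hence "continuous (at t within {0..t+1}) x" using c[of "t+1"] by (simp add: continuous_on_eq_continuous_within)
    moreover have "at t within {0..} = at t within {0..t+1}"
      by (rule at_within_nhd[of _ "{..<t+1}"]) auto
    ultimately show "continuous (at t within {0..}) x" by simp
  qed
qed

lemma primitive_add:
  assumes "primitive x f a" "primitive y g b"
  shows "primitive (\<lambda>t. x t + y t) (\<lambda>t. f t + g t) (a + b)"
  using assms by (auto simp: primitive_def set_integral_add)

lemma primitive_linear:
  assumes "primitive x f a" "linear L"
  shows "primitive (\<lambda>t. L (x t)) (\<lambda>t. L (f t)) (L a)"
proof -
  have bl: "bounded_linear L" using assms(2) by (simp add: linear_conv_bounded_linear)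
  show ?thesis unfolding primitive_def
  proof (intro allI impI conjI)
    fix t :: real assume "0 \<le> t"
    hence f: "set_integrable lborel {0..t} f" "x t = a + (LINT s:{0..t}|lborel. f s)"
      using assms(1) by (auto simp: primitive_def)
    have e: "(\<lambda>s. indicator {0..t} s *\<^sub>R L (f s)) = (\<lambda>s. L (indicator {0..t} s *\<^sub>R f s))"
      by (simp add: linear_scale[OF assms(2)])
    show "set_integrable lborel {0..t} (\<lambda>s. L (f s))"
      using integrable_bounded_linear[OF bl] f(1) unfolding set_integrable_def e by blast
    show "L (x t) = L a + (LINT s:{0..t}|lborel. L (f s))"
      using integral_bounded_linear[OF bl, of lborel "\<lambda>s. indicator {0..t} s *\<^sub>R f s"] f
      unfolding set_integrable_def set_lebesgue_integral_def e by (simp add: linear_add[OF assms(2)])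
  qed
qed

lemma primitive_cong:
  assumes "primitive x f a" "\<And>t. t \<ge> 0 \<Longrightarrow> y t = x t" "\<And>t. t \<ge> 0 \<Longrightarrow> g t = f t"
  shows "primitive y g a"
proof -
  have "set_integrable lborel {0..t} g \<longleftrightarrow> set_integrable lborel {0..t} f" 
       "(LINT s:{0..t}|lborel. g s) = (LINT s:{0..t}|lborel. f s)" for t
    using assms(3) by (intro set_integrable_cong set_lebesgue_integral_cong; simp)+
  thus ?thesis using assms by (simp add: primitive_def)
qed

lemma primitive_of_derivative:
  assumes d: "\<And>T t. 0 \<le> t \<Longrightarrow> t \<le> T \<Longrightarrow> (x has_vector_derivative f t) (at t within {0..T})"
    and c: "continuous_on {0..} f"
  shows "primitive x f (x 0)"
  unfolding primitive_def
proof (intro allI impI conjI)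
  fix t :: real assume t: "0 \<le> t"
  show si: "set_integrable lborel {0..t} f"
    using borel_integrable_atLeastAtMost'[of 0 t f] continuous_on_subset[OF c, of "{0..t}"] by auto
  have "(f has_integral (x t - x 0)) {0..t}"
    using t d by (intro fundamental_theorem_of_calculus) auto
  thus "x t = x 0 + (LINT s:{0..t}|lborel. f s)"
    using set_borel_integral_eq_integral(2)[OF si] by (simp add: integral_unique)
qed

text \<open>Integration by parts when f and g are merely integrable. The product of the integrals of
  f and g over [0, T] is a double integral over a square. Fubini turns the triangle s \<le> t into
  the integral of (x - a) g and the triangle t < s into the integral of f (y - b).\<close>

lemma primitive_mult:
  fixes x y :: "real \<Rightarrow> real"
  assumes x: "primitive x f a" and y: "primitive y g b"
  shows "primitive (\<lambda>t. x t * y t) (\<lambda>t. f t * y t + x t * g t) (a * b)"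
  unfolding primitive_def
proof (intro allI impI)
  fix T :: real assume T: "0 \<le> T"
  define F where "F s = indicator {0..T} s * f s" for s
  define G where "G s = indicator {0..T} s * g s" for s
  have iF: "integrable lborel F" and iG: "integrable lborel G"
    using x y T by (auto simp: primitive_def F_def[abs_def] G_def[abs_def] set_integrable_def)
  \<comment> \<open>The two triangles must be disjoint: x is written with the closed ray
    \<open>{..t}\<close> and y with the open ray \<open>{..<t}\<close>, which differ by a null
    set.\<close>
  have xt: "x t = a + (\<integral>s. indicator {..t} s * F s \<partial>lborel)"
   and yt: "y t = b + (\<integral>s. indicator {..<t} s * G s \<partial>lborel)" if "t \<in> {0..T}" for t
  proof -
    have e: "indicator {..t} s * (indicator {0..T} s * h s) = indicator {0..t} s *\<^sub>R h s" for s and h :: "real \<Rightarrow> real"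
      using that by (auto simp: indicator_def)
    show "x t = a + (\<integral>s. indicator {..t} s * F s \<partial>lborel)"
      using x that by (simp add: primitive_def F_def e set_lebesgue_integral_def)
    have "y t = b + (\<integral>s. indicator {..t} s * G s \<partial>lborel)"
      using y that by (simp add: primitive_def G_def e set_lebesgue_integral_def)
    moreover have "(\<integral>s. indicator {..<t} s * G s \<partial>lborel) = (\<integral>s. indicator {..t} s * G s \<partial>lborel)"
    proof (rule integral_cong_AE)
      show "AE s in lborel. indicator {..<t} s * G s = indicator {..t} s * G s"
        using AE_lborel_singleton[of t] by eventually_elim (auto simp: indicator_def)
    qed (use iG in \<open>auto intro!: borel_measurable_times borel_measurable_integrable\<close>)
    ultimately show "y t = b + (\<integral>s. indicator {..<t} s * G s \<partial>lborel)" by simp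
  qed
  have cx: "continuous_on {0..T} x" and cy: "continuous_on {0..T} y"
    using primitive_continuous[OF x] primitive_continuous[OF y] by (auto intro: continuous_on_subset)
  have prod: "set_integrable lborel {0..T} (\<lambda>t. u t * h t)" if "continuous_on {0..T} u" "set_integrable lborel {0..T} h" for u h :: "real \<Rightarrow> real"
  proof -
    from compact_imp_bounded[OF compact_continuous_image[OF that(1) compact_Icc]]
    obtain B where "\<forall>y\<in>u ` {0..T}. norm y \<le> B" unfolding bounded_iff by blast
    hence B: "\<bar>u t\<bar> \<le> B" if "t \<in> {0..T}" for t using that by simp
    have mu: "(\<lambda>t. indicator {0..T} t * u t) \<in> borel_measurable lborel"
      using borel_integrable_atLeastAtMost'[OF that(1)] by (auto simp: set_integrable_def dest: borel_measurable_integrable)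
    have "integrable lborel (\<lambda>t. (indicator {0..T} t * u t) * (indicator {0..T} t * h t))"
    proof (rule Bochner_Integration.integrable_bound[where f = "\<lambda>t. B * (indicator {0..T} t * h t)"])
      show "integrable lborel (\<lambda>t. B * (indicator {0..T} t * h t))"
        using that(2) by (simp add: set_integrable_def)
      show "(\<lambda>t. (indicator {0..T} t * u t) * (indicator {0..T} t * h t)) \<in> borel_measurable lborel"
        by (rule borel_measurable_times[OF mu])
          (use that(2) in \<open>auto simp: set_integrable_def dest: borel_measurable_integrable\<close>)
      show "AE t in lborel. norm ((indicator {0..T} t * u t) * (indicator {0..T} t * h t)) \<le> norm (B * (indicator {0..T} t * h t))"
        using B by (intro AE_I2) (force simp: indicator_def abs_mult intro!: mult_right_mono)
    qed
    thus ?thesis unfolding set_integrable_def by (rule Bochner_Integration.integrable_cong[THEN iffD1, rotated -1]) (auto simp: indicator_def)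
  qed
  have f: "set_integrable lborel {0..T} f" and g: "set_integrable lborel {0..T} g" using x y T by (auto simp: primitive_def)
  have ixg: "set_integrable lborel {0..T} (\<lambda>t. x t * g t)" by (rule prod[OF cx g])
  have ify: "set_integrable lborel {0..T} (\<lambda>t. f t * y t)" using prod[OF cy f] by (simp add: mult.commute)
  have i: "set_integrable lborel {0..T} (\<lambda>t. f t * y t + x t * g t)" by (rule set_integral_add(1)[OF ify ixg])
  have mF[measurable]: "F \<in> borel_measurable lborel" and mG[measurable]: "G \<in> borel_measurable lborel"
    using iF iG by (auto dest: borel_measurable_integrable)
  have iFG: "integrable (lborel \<Otimes>\<^sub>M lborel) (\<lambda>(s, t). F s * G t)"
  proof (rule lborel_pair.Fubini_integrable)
    show "integrable lborel (\<lambda>s. \<integral>t. norm (case (s, t) of (s, t) \<Rightarrow> F s * G t) \<partial>lborel)"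
      using iF iG by (simp add: abs_mult)
  qed (use iG in auto)
  define k k' where "k s t = (if s \<le> t then F s * G t else 0)" and "k' s t = (if t < s then F s * G t else 0)" for s t
  have ik: "integrable (lborel \<Otimes>\<^sub>M lborel) (\<lambda>(s, t). k s t)" "integrable (lborel \<Otimes>\<^sub>M lborel) (\<lambda>(s, t). k' s t)"
    unfolding k_def k'_def by (rule Bochner_Integration.integrable_bound[OF iFG]; force)+
  have kk: "(\<lambda>(s, t). F s * G t) = (\<lambda>p. (case p of (s, t) \<Rightarrow> k s t) + (case p of (s, t) \<Rightarrow> k' s t))"
    by (auto simp: k_def k'_def fun_eq_iff)
  have "(\<integral>s. F s \<partial>lborel) * (\<integral>t. G t \<partial>lborel) = (\<integral>s. \<integral>t. F s * G t \<partial>lborel \<partial>lborel)"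
    by simp
  also have "\<dots> = integral\<^sup>L (lborel \<Otimes>\<^sub>M lborel) (\<lambda>(s, t). F s * G t)" by (rule lborel_pair.integral_fst[OF iFG])
  also have "\<dots> = integral\<^sup>L (lborel \<Otimes>\<^sub>M lborel) (\<lambda>(s, t). k s t) + integral\<^sup>L (lborel \<Otimes>\<^sub>M lborel) (\<lambda>(s, t). k' s t)"
    unfolding kk by (rule Bochner_Integration.integral_add[OF ik])
  also have "\<dots> = (\<integral>t. \<integral>s. k s t \<partial>lborel \<partial>lborel) + (\<integral>s. \<integral>t. k' s t \<partial>lborel \<partial>lborel)"
    by (simp only: lborel_pair.integral_fst[OF ik(2)] lborel_pair.integral_snd[OF ik(1)])
  also have "(\<integral>t. \<integral>s. k s t \<partial>lborel \<partial>lborel) = (\<integral>t. (x t - a) * G t \<partial>lborel)"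
  proof (intro Bochner_Integration.integral_cong refl)
    fix t
    show "(\<integral>s. k s t \<partial>lborel) = (x t - a) * G t"
    proof (cases "t \<in> {0..T}")
      case True
      have "(\<integral>s. k s t \<partial>lborel) = (\<integral>s. indicator {..t} s * F s * G t \<partial>lborel)"
        by (intro Bochner_Integration.integral_cong) (auto simp: k_def indicator_def)
      thus ?thesis using xt[OF True] by simp
    next
      case False
      hence "k s t = 0" for s by (simp add: k_def G_def)
      thus ?thesis using False by (simp add: G_def)
    qed
  qed
  also have "(\<integral>s. \<integral>t. k' s t \<partial>lborel \<partial>lborel) = (\<integral>s. F s * (y s - b) \<partial>lborel)"
  proof (intro Bochner_Integration.integral_cong refl)
    fix s
    show "(\<integral>t. k' s t \<partial>lborel) = F s * (y s - b)"
    proof (cases "s \<in> {0..T}")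
      case True
      have "(\<integral>t. k' s t \<partial>lborel) = (\<integral>t. F s * (indicator {..<s} t * G t) \<partial>lborel)"
        by (intro Bochner_Integration.integral_cong) (auto simp: k'_def indicator_def)
      thus ?thesis using yt[OF True] by simp
    next
      case False
      hence "k' s t = 0" for t by (simp add: k'_def F_def)
      thus ?thesis using False by (simp add: F_def)
    qed
  qed
  finally have eq: "(\<integral>s. F s \<partial>lborel) * (\<integral>t. G t \<partial>lborel) =
      (\<integral>t. (x t - a) * G t \<partial>lborel) + (\<integral>s. F s * (y s - b) \<partial>lborel)" .
  have ixG: "integrable lborel (\<lambda>t. x t * G t)" and iyF: "integrable lborel (\<lambda>t. F t * y t)"
    using ixg ify by (auto simp: set_integrable_def F_def[abs_def] G_def[abs_def] mult_ac)
  have IF: "(\<integral>s. F s \<partial>lborel) = x T - a" and IG: "(\<integral>s. G s \<partial>lborel) = y T - b"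
    using x y T by (simp_all add: primitive_def F_def G_def set_lebesgue_integral_def)
  have "(\<integral>t. (x t - a) * G t \<partial>lborel) = (\<integral>t. x t * G t \<partial>lborel) - a * (y T - b)"
    using ixG iG IG by (simp add: left_diff_distrib)
  moreover have "(\<integral>t. F t * (y t - b) \<partial>lborel) = (\<integral>t. F t * y t \<partial>lborel) - (x T - a) * b"
    using iyF iF IF by (simp add: right_diff_distrib)
  moreover have "(LINT t:{0..T}|lborel. f t * y t + x t * g t) = (\<integral>t. F t * y t \<partial>lborel) + (\<integral>t. x t * G t \<partial>lborel)"
    by (subst set_integral_add(2)[OF ify ixg]) (simp add: set_lebesgue_integral_def F_def G_def mult_ac)
  ultimately have "x T * y T = a * b + (LINT t:{0..T}|lborel. f t * y t + x t * g t)"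
    using eq unfolding IF IG by (simp add: algebra_simps)
  thus "set_integrable lborel {0..T} (\<lambda>t. f t * y t + x t * g t) \<and>
     x T * y T = a * b + (LINT t:{0..T}|lborel. f t * y t + x t * g t)"
    using i by blast
qed

lemma primitive_sum:
  "finite I \<Longrightarrow> (\<And>i. i \<in> I \<Longrightarrow> primitive (x i) (f i) (a i)) \<Longrightarrow>
    primitive (\<lambda>t. \<Sum>i\<in>I. x i t) (\<lambda>t. \<Sum>i\<in>I. f i t) (\<Sum>i\<in>I. a i)"
proof (induction rule: finite_induct)
  case empty
  thus ?case by (simp add: primitive_def set_integrable_def set_lebesgue_integral_def)
next
  case (insert i I)
  thus ?case using primitive_add[of "x i" "f i" "a i"] by simp
qed

lemma primitive_inner:
  assumes "primitive x f a" "primitive y g b"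
  shows "primitive (\<lambda>t. x t \<bullet> y t) (\<lambda>t. f t \<bullet> y t + x t \<bullet> g t) (a \<bullet> b)"
proof -
  have "primitive (\<lambda>t. \<Sum>i\<in>Basis. (x t \<bullet> i) * (y t \<bullet> i))
     (\<lambda>t. \<Sum>i\<in>Basis. (f t \<bullet> i) * (y t \<bullet> i) + (x t \<bullet> i) * (g t \<bullet> i)) (\<Sum>i\<in>Basis. (a \<bullet> i) * (b \<bullet> i))"
  proof (rule primitive_sum[OF finite_Basis])
    fix i :: 'a
    have l: "linear (\<lambda>v. v \<bullet> i)" by (simp add: bounded_linear.linear bounded_linear_inner_left)
    show "primitive (\<lambda>t. (x t \<bullet> i) * (y t \<bullet> i)) (\<lambda>t. (f t \<bullet> i) * (y t \<bullet> i) + (x t \<bullet> i) * (g t \<bullet> i)) ((a \<bullet> i) * (b \<bullet> i))"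
      by (rule primitive_mult[OF primitive_linear[OF assms(1) l] primitive_linear[OF assms(2) l]])
  qed
  thus ?thesis by (simp add: euclidean_inner[symmetric] sum.distrib)
qed

text \<open>The forcing b is only locally integrable. Subtracting its primitive z leaves y' = A (y +
  z) with continuous right-hand side, which the variation of constants formula solves in the
  classical sense.\<close>

lemma ode_solution_exists:
  fixes A :: "'a::euclidean_space \<Rightarrow> 'a"
  assumes A: "linear A" and b: "primitive z b a"
  obtains x where "primitive x (\<lambda>t. A (x t) + b t) a"
proof -
  have cz: "continuous_on {0..} z" by (rule primitive_continuous[OF b])
  have cAz: "continuous_on {0..} (\<lambda>t. flow A (- t) (A (z t)))"
    by (rule continuous_on_flow_minus[OF linear_continuous_on_compose[OF cz A]]) 
  define c where "c t = integral {0..t} (\<lambda>s. flow A (- s) (A (z s)))" for t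
  define y where "y t = flow A t (c t)" for t
  have dc: "(c has_vector_derivative flow A (- t) (A (z t))) (at t within {0..T})" if "0 \<le> t" "t \<le> T" for t T
    unfolding c_def using that continuous_on_subset[OF cAz, of "{0..T}"]
    by (intro integral_has_vector_derivative) auto
  have dy: "(y has_vector_derivative A (y t + z t)) (at t within {0..T})" if "0 \<le> t" "t \<le> T" for t T
    using flow_derivative_comp[OF A dc[OF that]] unfolding y_def[abs_def]
    by (simp add: flow_inverse linear_add[OF A])
  have cy: "continuous_on {0..T} y" for T
    unfolding continuous_on_eq_continuous_within using has_vector_derivative_continuous[OF dy] by auto
  have cy': "continuous_on {0..} y" unfolding continuous_on_eq_continuous_within
  proof
    fix t :: real assume "t \<in> {0..}"
    hence "continuous (at t within {0..t+1}) y" using cy[of "t+1"] by (simp add: continuous_on_eq_continuous_within)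
    moreover have "at t within {0..} = at t within {0..t+1}"
      by (rule at_within_nhd[of _ "{..<t+1}"]) auto
    ultimately show "continuous (at t within {0..}) y" by simp
  qed
  have "primitive y (\<lambda>t. A (y t + z t)) (y 0)"
    by (rule primitive_of_derivative[OF dy linear_continuous_on_compose[OF continuous_on_add[OF cy' cz] A]])
  moreover have "y 0 = 0" by (simp add: y_def c_def)
  ultimately have "primitive (\<lambda>t. y t + z t) (\<lambda>t. A (y t + z t) + b t) (0 + a)"
    using primitive_add[OF _ b] by metis
  thus thesis using that by simp
qed

text \<open>Stated with the gauge integral, because it has to apply to the difference of arbitrary
  candidates for \<open>traj\<close>. Such an x is continuous, hence differentiable, and
  \<open>flow A (- t) (x t)\<close> is constant.\<close>

lemma ode_zero_unique:
  fixes A :: "'a::euclidean_space \<Rightarrow> 'a" and x :: "real \<Rightarrow> 'a"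
  assumes A: "linear A" and d: "\<And>t. t \<ge> 0 \<Longrightarrow> (\<lambda>s. A (x s)) integrable_on {0..t} \<and> x t = integral {0..t} (\<lambda>s. A (x s))"
    and T: "T \<ge> 0"
  shows "x T = 0"
proof -
  define I where "I t = integral {0..t} (\<lambda>s. A (x s))" for t
  have xI: "x t = I t" if "t \<in> {0..T}" for t unfolding I_def using d[of t] that by (blast dest: atLeastAtMost_iff[THEN iffD1])
  have "continuous_on {0..T} I" unfolding I_def
    by (rule indefinite_integral_continuous_1) (simp add: d T)
  hence c: "continuous_on {0..T} x" by (rule continuous_on_eq) (simp add: xI)
  have "(I has_vector_derivative A (x t)) (at t within {0..T})" if "t \<in> {0..T}" for t
    unfolding I_def[abs_def] by (rule integral_has_vector_derivative[OF linear_continuous_on_compose[OF c A] that])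
  hence dx: "(x has_vector_derivative A (x t)) (at t within {0..T})" if "t \<in> {0..T}" for t
    by (rule has_vector_derivative_transform[rotated 2]) (use that xI in auto)
  have "((\<lambda>t. flow A (- t) (x t)) has_vector_derivative 0) (at t within {0..T})" if "t \<in> {0..T}" for t
    using flow_minus_derivative_comp[OF A dx[OF that]] by (simp add: linear_0[OF flow_linear])
  then obtain c where "\<And>t. t \<in> {0..T} \<Longrightarrow> flow A (- t) (x t) = c"
    using has_vector_derivative_zero_constant[OF convex_real_interval(5), of 0 T "\<lambda>t. flow A (- t) (x t)"]
    by blast
  hence "flow A (- T) (x T) = flow A (- 0) (x 0)" using T by force
  moreover have "x 0 = 0" using xI[of 0] T by (simp add: I_def)
  ultimately have "flow A (- T) (x T) = 0" by simp
  hence "flow A T (flow A (- T) (x T)) = 0" by (simp add: linear_0[OF flow_linear])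
  thus ?thesis by (simp add: flow_inverse)
qed

section \<open>Square integrable signals on the half line\<close>

abbreviation half_line :: "real measure" where "half_line \<equiv> restrict_space lborel {0..}"

lemma space_half_line [simp]: "space half_line = {0..}"
  by (simp add: space_restrict_space)

lemma integral_half_line:
  fixes f :: "real \<Rightarrow> 'a::{banach,second_countable_topology}"
  shows "integral\<^sup>L half_line f = (LINT t:{0..}|lborel. f t)"
    "integrable half_line f \<longleftrightarrow> set_integrable lborel {0..} f"
  by (simp_all add: integral_restrict_space integrable_restrict_space set_lebesgue_integral_def set_integrable_def)

lemma continuous_measurable_half_line:
  fixes f :: "real \<Rightarrow> 'a::topological_space"
  assumes "continuous_on {0..} f" shows "f \<in> borel_measurable half_line"
proof -
  have "f \<in> borel_measurable (restrict_space borel {0..})"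
    by (rule borel_measurable_continuous_on_restrict[OF assms])
  thus ?thesis by (simp cong: measurable_cong_sets add: sets_restrict_space)
qed

text \<open>The condition of \<open>L2\<close> for values in any Euclidean space, so that states,
  pairs and vectors of filter outputs are covered; \<open>L2_eq\<close> identifies the two.\<close>

definition square_integrable :: "(real \<Rightarrow> 'a::euclidean_space) \<Rightarrow> bool" where
  "square_integrable u \<longleftrightarrow> u \<in> borel_measurable half_line \<and> integrable half_line (\<lambda>t. (norm (u t))\<^sup>2)"

lemma square_integrable_measurable: "square_integrable u \<Longrightarrow> u \<in> borel_measurable half_line"
  by (simp add: square_integrable_def)

lemma square_integrable_bound:
  fixes u :: "real \<Rightarrow> 'a::euclidean_space"
  assumes "u \<in> borel_measurable half_line" "integrable half_line h"
    and "\<And>t. t \<ge> 0 \<Longrightarrow> (norm (u t))\<^sup>2 \<le> h t"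
  shows "square_integrable u"
  unfolding square_integrable_def
proof
  have [measurable]: "u \<in> borel_measurable half_line" by fact
  show "integrable half_line (\<lambda>t. (norm (u t))\<^sup>2)"
    using assms(3) by (intro Bochner_Integration.integrable_bound[OF assms(2)]) (auto intro!: AE_I2 intro: order_trans[OF _ abs_ge_self])
qed fact

lemma square_integrable_zero [simp]: "square_integrable (\<lambda>t. 0)"
  by (simp add: square_integrable_def)

lemma square_integrable_linear:
  assumes u: "square_integrable u" and L: "linear L"
  shows "square_integrable (\<lambda>t. L (u t))"
proof -
  have bl: "bounded_linear L" using L by (simp add: linear_conv_bounded_linear)
  then obtain K where K: "\<And>x. norm (L x) \<le> norm x * K" using bounded_linear.bounded by blast
  show ?thesis
  proof (rule square_integrable_bound)
    show "(\<lambda>t. L (u t)) \<in> borel_measurable half_line"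
      using borel_measurable_continuous_on[OF linear_continuous_on[OF bl] square_integrable_measurable[OF u]] .
    show "integrable half_line (\<lambda>t. (norm (u t))\<^sup>2 * K\<^sup>2)" using u by (simp add: square_integrable_def)
    show "(norm (L (u t)))\<^sup>2 \<le> (norm (u t))\<^sup>2 * K\<^sup>2" for t
      using power_mono[OF K[of "u t"], of 2] by (simp add: power_mult_distrib)
  qed
qed

lemma square_integrable_add:
  assumes u: "square_integrable u" and v: "square_integrable v"
  shows "square_integrable (\<lambda>t. u t + v t)"
proof (rule square_integrable_bound)
  show "(\<lambda>t. u t + v t) \<in> borel_measurable half_line"
    by (intro borel_measurable_add square_integrable_measurable u v)
  show "integrable half_line (\<lambda>t. 2 * (norm (u t))\<^sup>2 + 2 * (norm (v t))\<^sup>2)"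
    using u v by (simp add: square_integrable_def)
  show "(norm (u t + v t))\<^sup>2 \<le> 2 * (norm (u t))\<^sup>2 + 2 * (norm (v t))\<^sup>2" for t
  proof -
    have "(norm (u t + v t))\<^sup>2 \<le> (norm (u t) + norm (v t))\<^sup>2" by (intro power_mono norm_triangle_ineq) simp
    moreover have "(norm (u t) - norm (v t))\<^sup>2 \<ge> 0" by simp
    ultimately show ?thesis by (simp add: power2_sum power2_diff)
  qed
qed

lemma square_integrable_scaleR: "square_integrable u \<Longrightarrow> square_integrable (\<lambda>t. c *\<^sub>R u t)"
  by (erule square_integrable_linear) (simp add: linear_iff algebra_simps)

lemma square_integrable_diff:
  "square_integrable u \<Longrightarrow> square_integrable v \<Longrightarrow> square_integrable (\<lambda>t. u t - v t)"
  using square_integrable_add[of u "\<lambda>t. - 1 *\<^sub>R v t"] square_integrable_scaleR[of v "-1"] by simp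

lemma square_integrable_Pair:
  assumes "square_integrable u" "square_integrable v"
  shows "square_integrable (\<lambda>t. (u t, v t))"
proof -
  have "linear (\<lambda>x. (x, 0))" "linear (\<lambda>y. (0, y))" by (simp_all add: linear_iff)
  from square_integrable_add[OF square_integrable_linear[OF assms(1) this(1)] square_integrable_linear[OF assms(2) this(2)]]
  show ?thesis by simp
qed

lemma square_integrable_inner:
  assumes u: "square_integrable u" and v: "square_integrable v"
  shows "integrable half_line (\<lambda>t. u t \<bullet> v t)"
proof (rule Bochner_Integration.integrable_bound)
  show "integrable half_line (\<lambda>t. (norm (u t))\<^sup>2 + (norm (v t))\<^sup>2)"
    using u v by (simp add: square_integrable_def)
  show "(\<lambda>t. u t \<bullet> v t) \<in> borel_measurable half_line"
    by (intro borel_measurable_inner square_integrable_measurable u v)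
  show "AE t in half_line. norm (u t \<bullet> v t) \<le> norm ((norm (u t))\<^sup>2 + (norm (v t))\<^sup>2)"
  proof (rule AE_I2)
    fix t
    have "\<bar>u t \<bullet> v t\<bar> \<le> norm (u t) * norm (v t)" by (rule Cauchy_Schwarz_ineq2)
    moreover have "(norm (u t) - norm (v t))\<^sup>2 \<ge> 0" by simp
    moreover have "(norm (u t))\<^sup>2 \<ge> 0" "(norm (v t))\<^sup>2 \<ge> 0" by simp_all
    ultimately have "\<bar>u t \<bullet> v t\<bar> \<le> (norm (u t))\<^sup>2 + (norm (v t))\<^sup>2" unfolding power2_diff by linarith
    thus "norm (u t \<bullet> v t) \<le> norm ((norm (u t))\<^sup>2 + (norm (v t))\<^sup>2)" by simp
  qed
qed

lemma square_integrable_locally: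
  assumes u: "square_integrable u"
  shows "set_integrable lborel {0..t} u"
proof -
  have "integrable half_line (\<lambda>s. indicator {0..t} s *\<^sub>R u s)"
  proof (rule Bochner_Integration.integrable_bound)
    have "integrable half_line (\<lambda>s. indicator {0..t} s :: real)"
      by (auto simp: integral_half_line set_integrable_def indicator_inter_arith[symmetric] emeasure_lborel_Icc_eq
        intro!: integrable_real_indicator)
    thus "integrable half_line (\<lambda>s. indicator {0..t} s + (norm (u s))\<^sup>2)"
      using u by (simp add: square_integrable_def)
    have "(\<lambda>s. indicator {0..t} s :: real) \<in> borel_measurable half_line"
      by (intro measurable_restrict_space1) simp
    thus "(\<lambda>s. indicator {0..t} s *\<^sub>R u s) \<in> borel_measurable half_line"
      by (rule borel_measurable_scaleR[OF _ square_integrable_measurable[OF u]])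
    have "x \<le> 1 + x\<^sup>2" for x :: real using zero_le_power2[of "x - 1/2"] by (simp add: power2_diff power2_eq_square algebra_simps)
    thus "AE s in half_line. norm (indicator {0..t} s *\<^sub>R u s) \<le> norm (indicator {0..t} s + (norm (u s))\<^sup>2)"
      by (intro AE_I2) (auto simp: indicator_def)
  qed
  hence "integrable lborel (\<lambda>s. indicator {0..} s *\<^sub>R (indicator {0..t} s *\<^sub>R u s))"
    by (simp add: integral_half_line set_integrable_def)
  moreover have "(\<lambda>s. indicator {0..} s *\<^sub>R (indicator {0..t} s *\<^sub>R u s)) = (\<lambda>s. indicator {0..t} s *\<^sub>R u s)"
    by (auto simp: indicator_def)
  ultimately show ?thesis by (simp add: set_integrable_def)
qed

lemma primitive_exists:
  assumes "square_integrable b"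
  shows "primitive (\<lambda>t. a + (LINT s:{0..t}|lborel. b s)) b a"
  using square_integrable_locally[OF assms] by (simp add: primitive_def)

lemma primitive_limit:
  fixes h :: "real \<Rightarrow> real"
  assumes h: "primitive h f c" and f: "integrable half_line f"
  shows "(h \<longlongrightarrow> c + integral\<^sup>L half_line f) at_top"
proof -
  have "integrable lborel (\<lambda>s. indicator {0..} s *\<^sub>R f s)" using f by (simp add: integral_half_line set_integrable_def)
  from tendsto_integral_at_top[OF _ this]
  have "((\<lambda>t. \<integral>s. indicator {..t} s *\<^sub>R (indicator {0..} s *\<^sub>R f s) \<partial>lborel) \<longlongrightarrow> integral\<^sup>L half_line f) at_top"
    by (simp add: integral_half_line set_lebesgue_integral_def)
  from tendsto_add[OF tendsto_const[of c] this] show ?thesis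
  proof (rule Lim_transform_eventually)
    show "\<forall>\<^sub>F t in at_top. c + (\<integral>s. indicator {..t} s *\<^sub>R (indicator {0..} s *\<^sub>R f s) \<partial>lborel) = h t"
      using eventually_ge_at_top[of 0]
    proof eventually_elim
      case (elim t)
      have "(\<lambda>s. indicator {..t} s *\<^sub>R (indicator {0..} s *\<^sub>R f s)) = (\<lambda>s. indicator {0..t} s *\<^sub>R f s)"
        by (auto simp: indicator_def)
      thus ?case using h elim by (simp add: primitive_def set_lebesgue_integral_def)
    qed
  qed
qed

lemma integrable_limit_zero:
  fixes h :: "real \<Rightarrow> real"
  assumes h: "(h \<longlongrightarrow> L) at_top" and i: "integrable half_line h"
  shows "L = 0"
proof (rule ccontr)
  assume L: "L \<noteq> 0"
  have "\<forall>\<^sub>F t in at_top. dist (h t) L < \<bar>L\<bar> / 2" using h L by (intro tendstoD) auto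
  then obtain T0 where T0: "\<And>t. t \<ge> T0 \<Longrightarrow> dist (h t) L < \<bar>L\<bar> / 2" by (auto simp: eventually_at_top_linorder)
  define T where "T = max 0 T0"
  have big: "\<bar>h t\<bar> \<ge> \<bar>L\<bar> / 2" if "t \<ge> T" for t
    using T0[of t] that by (simp add: T_def dist_real_def abs_if split: if_splits)
  have ia: "integrable lborel (\<lambda>t. indicator {0..} t * \<bar>h t\<bar>)"
    using integrable_abs[OF i[unfolded integral_half_line set_integrable_def]] by (simp add: abs_mult)
  define I where "I = (\<integral>t. indicator {0..} t * \<bar>h t\<bar> \<partial>lborel)"
  have "real n * (\<bar>L\<bar> / 2) \<le> I" for n
  proof -
    have "(\<integral>t. (\<bar>L\<bar> / 2) * indicator {T..T + real n} t \<partial>lborel) \<le> I"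
      unfolding I_def using big ia
      by (intro integral_mono integrable_mult_right integrable_real_indicator)
        (auto simp: indicator_def T_def emeasure_lborel_Icc_eq)
    thus ?thesis by (simp add: mult.commute)
  qed
  moreover obtain n where "real n > I / (\<bar>L\<bar> / 2)" using reals_Archimedean2 by blast
  ultimately show False using L by (simp add: field_simps) (smt (verit))
qed

lemma ibp_half_line:
  assumes x: "primitive x f a" and y: "primitive y g b"
    and "square_integrable x" "square_integrable f" "square_integrable y" "square_integrable g"
    and lx: "(x \<longlongrightarrow> 0) at_top" and ly: "(y \<longlongrightarrow> 0) at_top"
  shows "(\<integral>t. f t \<bullet> y t \<partial>half_line) + (\<integral>t. x t \<bullet> g t \<partial>half_line) = - (a \<bullet> b)"
proof -
  have i: "integrable half_line (\<lambda>t. f t \<bullet> y t)" "integrable half_line (\<lambda>t. x t \<bullet> g t)"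
    using assms square_integrable_inner by blast+
  have "((\<lambda>t. x t \<bullet> y t) \<longlongrightarrow> a \<bullet> b + (\<integral>t. f t \<bullet> y t + x t \<bullet> g t \<partial>half_line)) at_top"
    by (rule primitive_limit[OF primitive_inner[OF x y]]) (intro Bochner_Integration.integrable_add i)
  moreover have "((\<lambda>t. x t \<bullet> y t) \<longlongrightarrow> 0) at_top" using tendsto_inner[OF lx ly] by simp
  ultimately have "a \<bullet> b + (\<integral>t. f t \<bullet> y t + x t \<bullet> g t \<partial>half_line) = 0"
    using tendsto_unique[OF trivial_limit_at_top_linorder] by blast
  thus ?thesis using Bochner_Integration.integral_add[OF i] by linarith
qed

text \<open>The function |x|^2 has the integrable derivative 2 f . x and so converges at infinity;
  being integrable itself, it can only converge to 0.\<close>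

lemma square_integrable_vanishing:
  assumes x: "primitive x f a" and sx: "square_integrable x" and sf: "square_integrable f"
  shows "(x \<longlongrightarrow> 0) at_top"
proof -
  have i: "integrable half_line (\<lambda>t. f t \<bullet> x t + x t \<bullet> f t)"
    by (intro Bochner_Integration.integrable_add square_integrable_inner sx sf)
  have "((\<lambda>t. x t \<bullet> x t) \<longlongrightarrow> a \<bullet> a + (\<integral>t. f t \<bullet> x t + x t \<bullet> f t \<partial>half_line)) at_top"
    by (rule primitive_limit[OF primitive_inner[OF x x] i])
  moreover from integrable_limit_zero[OF this square_integrable_inner[OF sx sx]]
  have "a \<bullet> a + (\<integral>t. f t \<bullet> x t + x t \<bullet> f t \<partial>half_line) = 0" .
  ultimately have "((\<lambda>t. sqrt (x t \<bullet> x t)) \<longlongrightarrow> sqrt 0) at_top" by (intro tendsto_real_sqrt) simp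
  thus ?thesis by (simp add: norm_eq_sqrt_inner[symmetric] tendsto_norm_zero_iff)
qed

lemma bounded_partial_integrals:
  fixes f :: "real \<Rightarrow> real"
  assumes c: "continuous_on {0..} f" and f0: "\<And>t. t \<ge> 0 \<Longrightarrow> f t \<ge> 0"
    and B: "\<And>T. T \<ge> 0 \<Longrightarrow> (LINT t:{0..T}|lborel. f t) \<le> B"
  shows "integrable half_line f" "integral\<^sup>L half_line f \<le> B"
proof -
  define I where "I n = (LINT t:{0..real n}|lborel. f t)" for n
  define g where "g n t = indicator {0..real n} t * f t" for n t
  define h where "h t = indicator {0..} t * f t" for t
  have ig: "integrable lborel (g n)" for n
    using borel_integrable_atLeastAtMost'[OF continuous_on_subset[OF c, of "{0..real n}"]]
    by (simp add: set_integrable_def g_def[abs_def])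
  have Ig: "I n = integral\<^sup>L lborel (g n)" for n by (simp add: I_def g_def[abs_def] set_lebesgue_integral_def)
  have gm: "g m t \<le> g n t" if "m \<le> n" for m n t using that f0[of t] by (auto simp: g_def indicator_def)
  have "incseq I" unfolding Ig by (intro monoI integral_mono ig gm)
  then obtain L where L: "I \<longlonglongrightarrow> L" "\<And>n. I n \<le> L"
    using incseq_convergent[of I B] B by (auto simp: I_def)
  have "L \<le> B" using L(1) B by (intro LIMSEQ_le_const2[OF L(1)]) (auto simp: I_def)
  have lim: "(\<lambda>n. g n t) \<longlonglongrightarrow> h t" for t
  proof (rule tendsto_eventually)
    obtain N where "t \<le> real N" using real_arch_simple by blast
    hence "g n t = h t" if "n \<ge> N" for n using that by (auto simp: g_def h_def indicator_def)
    thus "\<forall>\<^sub>F n in sequentially. g n t = h t" by (auto simp: eventually_sequentially)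
  qed
  have mh: "h \<in> borel_measurable lborel"
    using borel_measurable_LIMSEQ_real[where u = g and u' = h] lim ig by (metis borel_measurable_integrable)
  have "AE t in lborel. mono (\<lambda>n. g n t)" by (intro AE_I2 monoI gm)
  note mc = ig this AE_I2[OF lim] L(1)[unfolded Ig] mh
  have "integrable lborel h" by (rule integrable_monotone_convergence[OF mc])
  thus "integrable half_line f" by (simp add: integral_half_line set_integrable_def h_def[abs_def])
  have "integral\<^sup>L lborel h = L" by (rule integral_monotone_convergence[OF mc])
  thus "integral\<^sup>L half_line f \<le> B" using \<open>L \<le> B\<close>
    by (simp add: integral_half_line set_lebesgue_integral_def h_def[abs_def])
qed

text \<open>P solves A'P + PA = - I. This certificate of stability stands in for spectral
  assumptions. It is available for Hurwitz matrices, for the doubled system built from one, and for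
  minus the identity, which governs the low-pass filters.\<close>

locale lyapunov =
  fixes A P :: "'x::euclidean_space \<Rightarrow> 'x"
  assumes A: "linear A" and P: "linear P" and P_sym: "P x \<bullet> y = x \<bullet> P y" and P_nonneg: "P x \<bullet> x \<ge> 0"
    and lyapunov_eq: "2 * (P x \<bullet> A x) = - (x \<bullet> x)"
begin

text \<open>The derivative of P x . x is - |x|^2 + 2 P b . x, which is at most - |x|^2/2 + 2 p^2
  |b|^2. Integrating up to T and dropping the nonnegative term at T bounds the energy of x uniformly
  in T.\<close>

lemma state_bound:
  "\<exists>C\<ge>0. \<forall>x b a. primitive x (\<lambda>t. A (x t) + b t) a \<longrightarrow> square_integrable b \<longrightarrow>
     square_integrable x \<and> (\<integral>t. (norm (x t))\<^sup>2 \<partial>half_line) \<le> C * ((norm a)\<^sup>2 + (\<integral>t. (norm (b t))\<^sup>2 \<partial>half_line))"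
proof -
  obtain p where p0: "p > 0" and p: "\<And>x. norm (P x) \<le> p * norm x"
    using linear_bounded_pos[OF P] by blast
  \<comment> \<open>The estimate produces 2 p |a|^2 + 4 p^2 J; the sum of the two coefficients
    serves for both terms.\<close>
  define C where "C = 2 * p + 4 * p\<^sup>2"
  have "square_integrable x \<and> (\<integral>t. (norm (x t))\<^sup>2 \<partial>half_line) \<le> C * ((norm a)\<^sup>2 + (\<integral>t. (norm (b t))\<^sup>2 \<partial>half_line))"
    if x: "primitive x (\<lambda>t. A (x t) + b t) a" and b: "square_integrable b" for x b a
  proof -
    define J where "J = (\<integral>t. (norm (b t))\<^sup>2 \<partial>half_line)"
    have J0: "J \<ge> 0" unfolding J_def by (rule Bochner_Integration.integral_nonneg) simp
    have cx: "continuous_on {0..} x" by (rule primitive_continuous[OF x])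
    have ib: "set_integrable lborel {0..} (\<lambda>t. (norm (b t))\<^sup>2)"
      using b by (simp add: square_integrable_def integral_half_line)
    have fin: "(LINT t:{0..T}|lborel. (norm (x t))\<^sup>2) \<le> C * ((norm a)\<^sup>2 + J)" if T: "T \<ge> 0" for T
    proof -
      let ?f = "\<lambda>t. P (A (x t) + b t) \<bullet> x t + P (x t) \<bullet> (A (x t) + b t)"
      have pr: "primitive (\<lambda>t. P (x t) \<bullet> x t) ?f (P a \<bullet> a)"
        by (rule primitive_inner[OF primitive_linear[OF x P] x])
      have fi: "set_integrable lborel {0..T} ?f" and eq: "P (x T) \<bullet> x T = P a \<bullet> a + (LINT t:{0..T}|lborel. ?f t)"
        using pr T by (auto simp: primitive_def)
      have le: "?f t \<le> - (1/2) * (norm (x t))\<^sup>2 + 2 * p\<^sup>2 * (norm (b t))\<^sup>2" for t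
      proof -
        have "?f t = 2 * (P (x t) \<bullet> A (x t)) + 2 * (P (b t) \<bullet> x t)"
          using P_sym[of "A (x t) + b t" "x t"] P_sym[of "b t" "x t"]
          by (simp add: inner_add_left inner_add_right inner_commute)
        also have "\<dots> = - (norm (x t))\<^sup>2 + 2 * (P (b t) \<bullet> x t)" by (simp add: lyapunov_eq dot_square_norm)
        finally have 1: "?f t = - (norm (x t))\<^sup>2 + 2 * (P (b t) \<bullet> x t)" .
        have "P (b t) \<bullet> x t \<le> norm (P (b t)) * norm (x t)" by (rule norm_cauchy_schwarz)
        also have "\<dots> \<le> (p * norm (b t)) * norm (x t)" using p by (intro mult_right_mono) auto
        finally have 2: "P (b t) \<bullet> x t \<le> (p * norm (b t)) * norm (x t)" .
        have "(norm (x t) / 2 - p * norm (b t))\<^sup>2 * 2 \<ge> 0" by simp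
        thus ?thesis using 1 2 by (simp add: power2_diff power_mult_distrib power_divide mult_ac)
      qed
      have ix: "set_integrable lborel {0..T} (\<lambda>t. (norm (x t))\<^sup>2)"
        by (intro borel_integrable_atLeastAtMost' continuous_intros continuous_on_subset[OF cx]) auto
      have ibT: "set_integrable lborel {0..T} (\<lambda>t. (norm (b t))\<^sup>2)"
        by (rule set_integrable_subset[OF ib]) auto
      have ix2: "set_integrable lborel {0..T} (\<lambda>t. (norm (x t))\<^sup>2 / 2)"
        using ix by (rule set_integrable_divide)
      have ib2: "set_integrable lborel {0..T} (\<lambda>t. 2 * p\<^sup>2 * (norm (b t))\<^sup>2)"
        using ibT by (rule set_integrable_mult_right)
      have "(LINT t:{0..T}|lborel. ?f t) \<le> (LINT t:{0..T}|lborel. 2 * p\<^sup>2 * (norm (b t))\<^sup>2 - (norm (x t))\<^sup>2 / 2)"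
        using le by (intro set_integral_mono fi set_integral_diff ix2 ib2) (simp add: algebra_simps)
      also have "\<dots> = 2 * p\<^sup>2 * (LINT t:{0..T}|lborel. (norm (b t))\<^sup>2) - (LINT t:{0..T}|lborel. (norm (x t))\<^sup>2) / 2"
        by (subst set_integral_diff(2)[OF ib2 ix2]) simp
      finally have 3: "(LINT t:{0..T}|lborel. ?f t) \<le> 2 * p\<^sup>2 * (LINT t:{0..T}|lborel. (norm (b t))\<^sup>2) - (LINT t:{0..T}|lborel. (norm (x t))\<^sup>2) / 2" .
      have 4: "(LINT t:{0..T}|lborel. (norm (b t))\<^sup>2) \<le> J"
        unfolding J_def integral_half_line set_lebesgue_integral_def
        using ib ibT by (intro integral_mono) (auto simp: set_integrable_def indicator_def)
      have "P a \<bullet> a \<le> norm (P a) * norm a" by (rule norm_cauchy_schwarz)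
      also have "\<dots> \<le> p * norm a * norm a" using p by (intro mult_right_mono) auto
      finally have 5: "P a \<bullet> a \<le> p * (norm a)\<^sup>2" by (simp add: power2_eq_square mult_ac)
      have "p\<^sup>2 * (LINT t:{0..T}|lborel. (norm (b t))\<^sup>2) \<le> p\<^sup>2 * J" using 4 by (intro mult_left_mono) auto
      hence "(LINT t:{0..T}|lborel. (norm (x t))\<^sup>2) \<le> 2 * p * (norm a)\<^sup>2 + 4 * p\<^sup>2 * J"
        using eq 3 5 P_nonneg[of "x T"] by linarith
      also have "\<dots> \<le> C * (norm a)\<^sup>2 + C * J"
        unfolding C_def using p0 J0 by (intro add_mono mult_right_mono) auto
      finally show ?thesis by (simp add: algebra_simps)
    qed
    have meas: "x \<in> borel_measurable half_line" by (rule continuous_measurable_half_line[OF cx])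
    have "integrable half_line (\<lambda>t. (norm (x t))\<^sup>2)" "(\<integral>t. (norm (x t))\<^sup>2 \<partial>half_line) \<le> C * ((norm a)\<^sup>2 + J)"
      by (rule bounded_partial_integrals[OF _ _ fin]; auto intro!: continuous_intros cx)+
    thus ?thesis using meas by (simp add: square_integrable_def J_def)
  qed
  moreover have "C \<ge> 0" using p0 by (simp add: C_def)
  ultimately show ?thesis by blast
qed

end

text \<open>Zero initial state: the Gram operator of the signal satisfies the hypothesis of Rantzer's
  lemma, because the state vanishes at both ends of the half line.\<close>

lemma quadratic_integral_nonneg:
  fixes F :: "'x::euclidean_space \<times> 'u::euclidean_space \<Rightarrow> 'x" and S :: "'x \<times> 'u \<Rightarrow> 'x \<times> 'u"
  assumes F: "linear F" and S: "linear S" and sS: "\<And>y z. S y \<bullet> z = y \<bullet> S z"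
    and finite_freq: "\<And>\<omega> z1 z2. F z1 = - \<omega> *\<^sub>R fst z2 \<Longrightarrow> F z2 = \<omega> *\<^sub>R fst z1 \<Longrightarrow> S z1 \<bullet> z1 + S z2 \<bullet> z2 \<ge> 0"
    and infinite_freq: "\<And>u. S (0, u) \<bullet> (0, u) \<ge> 0"
    and x: "primitive x (\<lambda>t. F (x t, u t)) 0" and sx: "square_integrable x" and su: "square_integrable u"
  shows "(\<integral>t. S (x t, u t) \<bullet> (x t, u t) \<partial>half_line) \<ge> 0"
proof -
  define z where "z t = (x t, u t)" for t
  have sz: "square_integrable z" unfolding z_def by (rule square_integrable_Pair[OF sx su])
  have zb: "square_integrable (\<lambda>t. z t \<bullet> y)" for y
    by (rule square_integrable_linear[OF sz]) (simp add: bounded_linear.linear bounded_linear_inner_left)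
  have iz: "integrable half_line (\<lambda>t. (z t \<bullet> y) * (z t \<bullet> y'))" for y y'
    using square_integrable_inner[OF zb[of y] zb[of y']] by simp
  \<comment> \<open>The Gram form of the trajectory z = (x, u), with operator Z below. The integral
    to be estimated is the trace of S against Z.\<close>
  define G where "G y y' = (\<integral>t. (z t \<bullet> y) * (z t \<bullet> y') \<partial>half_line)" for y y'
  define Z where "Z y = (\<Sum>b\<in>Basis. G y b *\<^sub>R b)" for y
  have G_add: "G (y + y') w = G y w + G y' w" and G_scale: "G (c *\<^sub>R y) w = c * G y w" 
    and G_sym: "G y w = G w y" for y y' w c
    using Bochner_Integration.integral_add[OF iz iz] by (simp_all add: G_def inner_add_right algebra_simps)
  have lZ: "linear Z" unfolding Z_def
    by (rule linearI) (simp_all add: G_add G_scale scaleR_add_left sum.distrib scaleR_sum_right)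
  have linG: "linear (G y)" for y
    by (rule linearI) (simp_all add: G_sym[of y] G_add G_scale)
  have ZG: "Z y \<bullet> w = G y w" for y w
  proof -
    have "Z y \<bullet> w = (\<Sum>b\<in>Basis. (w \<bullet> b) * G y b)" unfolding Z_def inner_sum_left by (simp add: inner_commute mult.commute)
    also have "\<dots> = G y (\<Sum>b\<in>Basis. (w \<bullet> b) *\<^sub>R b)" by (simp add: linear_sum[OF linG] linear_scale[OF linG])
    finally show ?thesis by (simp add: euclidean_representation)
  qed
  have "(\<Sum>b\<in>Basis. S b \<bullet> Z b) \<ge> 0"
  proof (rule rantzer_trace_nonneg[OF lZ _ _ S sS _ F, where E = fst])
    show "Z y \<bullet> w = y \<bullet> Z w" for y w by (metis ZG G_sym inner_commute)
    show "Z y \<bullet> y \<ge> 0" for y unfolding ZG G_def by (rule Bochner_Integration.integral_nonneg) simp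
    show lfst: "linear (fst :: 'x \<times> 'u \<Rightarrow> 'x)" by (rule linear_fst)
    show "S z \<bullet> z \<ge> 0" if "fst z = 0" for z using infinite_freq[of "snd z"] that by (metis prod.collapse)
    show "Z (adjoint fst y) \<bullet> adjoint F y = 0" for y
    proof -
      have l: "linear (\<lambda>v::'x. v \<bullet> y)" by (simp add: bounded_linear.linear bounded_linear_inner_left)
      have sF: "square_integrable (\<lambda>t. F (x t, u t))" using square_integrable_linear[OF sz F] by (simp add: z_def)
      note sxy = square_integrable_linear[OF sx l] and sfy = square_integrable_linear[OF sF l]
      note py = primitive_linear[OF x l]
      note lim = square_integrable_vanishing[OF py sxy sfy]
      have "(\<integral>t. (F (x t, u t) \<bullet> y) \<bullet> (x t \<bullet> y) \<partial>half_line) + (\<integral>t. (x t \<bullet> y) \<bullet> (F (x t, u t) \<bullet> y) \<partial>half_line) = - ((0 \<bullet> y) \<bullet> (0 \<bullet> y))"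
        by (rule ibp_half_line[OF py py sxy sfy sxy sfy lim lim])
      hence "(\<integral>t. (x t \<bullet> y) * (F (x t, u t) \<bullet> y) \<partial>half_line) = 0" by (simp add: mult.commute)
      thus ?thesis unfolding ZG G_def by (simp add: adjoint_works[OF F] adjoint_works[OF lfst] z_def)
    qed
  qed (use finite_freq in auto)
  also have "(\<Sum>b\<in>Basis. S b \<bullet> Z b) = (\<Sum>b\<in>Basis. G b (S b))"
    by (intro sum.cong refl) (simp add: ZG[symmetric] inner_commute)
  also have "\<dots> = (\<integral>t. (\<Sum>b\<in>Basis. (z t \<bullet> b) * (z t \<bullet> S b)) \<partial>half_line)"
    unfolding G_def by (rule Bochner_Integration.integral_sum[symmetric]) (rule iz)
  also have "\<dots> = (\<integral>t. S (z t) \<bullet> z t \<partial>half_line)"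
  proof (intro Bochner_Integration.integral_cong refl)
    fix t
    have "(\<Sum>b\<in>Basis. (z t \<bullet> b) * (z t \<bullet> S b)) = (\<Sum>b\<in>Basis. (S (z t) \<bullet> b) * (z t \<bullet> b))"
      by (simp only: sS[of "z t"] mult.commute)
    thus "(\<Sum>b\<in>Basis. (z t \<bullet> b) * (z t \<bullet> S b)) = S (z t) \<bullet> z t"
      using euclidean_inner[of "S (z t)" "z t"] by simp
  qed
  finally show ?thesis by (simp add: z_def)
qed

section \<open>Polynomials of operators and filter coefficients\<close>

definition polymap :: "('a::real_vector \<Rightarrow> 'a) \<Rightarrow> real poly \<Rightarrow> 'a \<Rightarrow> 'a" where
  "polymap K p z = (\<Sum>k\<le>degree p. coeff p k *\<^sub>R (K ^^ k) z)"

lemma polymap_bound: "degree p \<le> N \<Longrightarrow> polymap K p z = (\<Sum>k\<le>N. coeff p k *\<^sub>R (K ^^ k) z)"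
  unfolding polymap_def by (rule sum.mono_neutral_left) (auto simp: coeff_eq_0)

lemma polymap_0 [simp]: "polymap K 0 z = 0" by (simp add: polymap_def)

lemma polymap_pCons: "polymap K (pCons c p) z = c *\<^sub>R z + polymap K p (K z)"
proof -
  have "polymap K (pCons c p) z = (\<Sum>k\<le>Suc (degree p). coeff (pCons c p) k *\<^sub>R (K ^^ k) z)"
    by (rule polymap_bound) (rule degree_pCons_le)
  thus ?thesis by (simp add: sum.atMost_Suc_shift polymap_def funpow_swap1 del: sum.atMost_Suc)
qed

lemma polymap_add: "polymap K (p + q) z = polymap K p z + polymap K q z"
  using polymap_bound[of p "max (degree p) (degree q)" K z] polymap_bound[of q "max (degree p) (degree q)" K z]
    polymap_bound[OF degree_add_le_max[of p q], of K z]
  by (simp add: sum.distrib scaleR_add_left)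

lemma polymap_smult: "polymap K (smult c p) z = c *\<^sub>R polymap K p z"
  using polymap_bound[OF degree_smult_le[of c p], of K z]
  by (simp add: polymap_def scaleR_sum_right)

context
  fixes K :: "'a::real_vector \<Rightarrow> 'a" assumes K: "linear K"
begin

lemma linear_funpow: "linear (K ^^ k)"
proof (induction k)
  case (Suc k)
  show ?case using linear_compose[OF Suc K] by (simp add: o_def)
qed (simp add: id_def linear_ident)

lemma linear_polymap: "linear (polymap K p)"
  unfolding polymap_def by (intro linear_compose_sum ballI linear_compose_scale_right linear_funpow)

lemma polymap_comm: "polymap K p (K z) = K (polymap K p z)"
  unfolding polymap_def by (simp add: linear_sum[OF K] linear_scale[OF K] funpow_swap1)

lemma polymap_mult: "polymap K (p * q) z = polymap K p (polymap K q z)"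
proof (induction p arbitrary: z)
  case (pCons c p)
  have "polymap K (pCons c p * q) z = c *\<^sub>R polymap K q z + polymap K (p * q) (K z)"
    by (simp add: mult_pCons_left polymap_add polymap_smult polymap_pCons)
  thus ?case by (simp add: pCons.IH polymap_comm polymap_pCons)
qed simp

end

section \<open>Annihilating polynomials and lower bounds for linear pencils\<close>

lemma linear_dependence_exists:
  fixes v :: "nat \<Rightarrow> 'a::euclidean_space"
  shows "\<exists>c. (\<exists>k\<le>DIM('a). c k \<noteq> (0::real)) \<and> (\<Sum>k\<le>DIM('a). c k *\<^sub>R v k) = 0"
proof (cases "inj_on v {..DIM('a)}")
  case False
  then obtain i j where ij: "i \<le> DIM('a)" "j \<le> DIM('a)" "i \<noteq> j" "v i = v j" by (auto simp: inj_on_def)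
  define c where "c k = (if k = i then 1 else if k = j then -1 else 0 :: real)" for k
  have "(\<Sum>k\<le>DIM('a). c k *\<^sub>R v k) = (\<Sum>k\<in>{i,j}. c k *\<^sub>R v k)"
    by (rule sum.mono_neutral_right) (use ij in \<open>auto simp: c_def\<close>)
  also have "\<dots> = 0" using ij by (simp add: c_def)
  finally show ?thesis using ij by (intro exI[of _ c]) (auto simp: c_def)
next
  case True
  hence "card (v ` {..DIM('a)}) = Suc DIM('a)" by (simp add: card_image)
  hence "dependent (v ` {..DIM('a)})" by (intro dependent_biggerset) auto
  then obtain u where u: "(\<Sum>x\<in>v ` {..DIM('a)}. u x *\<^sub>R x) = 0" "\<exists>x\<in>v ` {..DIM('a)}. u x \<noteq> 0"
    using dependent_finite[of "v ` {..DIM('a)}"] by auto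
  thus ?thesis using sum.reindex[OF True, of "\<lambda>x. u x *\<^sub>R x"]
    by (intro exI[of _ "\<lambda>k. u (v k)"]) (auto simp: o_def)
qed

text \<open>Among the first DIM + 1 iterates of a basis vector there is a linear relation, and the
  product of these polynomials over the basis annihilates everything. The degree bound is generous,
  but an explicit one is required because it later fixes the number of filters.\<close>

lemma annihilating_poly_exists:
  fixes K :: "'a::euclidean_space \<Rightarrow> 'a"
  assumes K: "linear K"
  obtains p where "p \<noteq> 0" "degree p \<le> DIM('a) * DIM('a)" "\<And>z. polymap K p z = 0"
proof -
  have one: "\<exists>p. p \<noteq> 0 \<and> degree p \<le> DIM('a) \<and> polymap K p b = 0" for b
  proof -
    obtain c k where c: "k \<le> DIM('a)" "c k \<noteq> 0" "(\<Sum>k\<le>DIM('a). c k *\<^sub>R (K ^^ k) b) = 0"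
      using linear_dependence_exists[of "\<lambda>k. (K ^^ k) b"] by blast
    define p where "p = (\<Sum>k\<le>DIM('a). monom (c k) k)"
    have cf: "coeff p j = (if j \<le> DIM('a) then c j else 0)" for j
      by (simp add: p_def coeff_sum if_distrib cong: if_cong)
    have "degree p \<le> DIM('a)" by (rule degree_le) (simp add: cf)
    moreover from this have "polymap K p b = 0" using c(3) by (simp add: polymap_bound cf)
    moreover have "p \<noteq> 0" using c(1,2) cf[of k] by auto
    ultimately show ?thesis by blast
  qed
  have "\<exists>p. p \<noteq> 0 \<and> degree p \<le> card I * DIM('a) \<and> (\<forall>b\<in>I. polymap K p b = 0)" if "finite I" for I :: "'a set"
    using that
  proof (induction rule: finite_induct)
    case empty show ?case by (intro exI[of _ 1]) simp
  next
    case (insert b I)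
    obtain p where p: "p \<noteq> 0" "degree p \<le> card I * DIM('a)" "\<forall>b\<in>I. polymap K p b = 0" using insert.IH by blast
    obtain r where r: "r \<noteq> 0" "degree r \<le> DIM('a)" "polymap K r b = 0" using one by blast
    have "polymap K (p * r) b = 0" using r by (simp add: polymap_mult[OF K] linear_0[OF linear_polymap[OF K]])
    moreover have "polymap K (p * r) d = 0" if "d \<in> I" for d
      using p that by (subst mult.commute) (simp add: polymap_mult[OF K] linear_0[OF linear_polymap[OF K]])
    moreover have "degree (p * r) \<le> card (insert b I) * DIM('a)"
      using degree_mult_le[of p r] p r insert.hyps by simp
    ultimately show ?case using p r by (intro exI[of _ "p * r"]) auto
  qed
  from this[OF finite_Basis] obtain p where p: "p \<noteq> 0" "degree p \<le> DIM('a) * DIM('a)" "\<forall>b\<in>Basis. polymap K p b = 0" by blast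
  have "polymap K p z = 0" for z
    by (rule linear_eq_0_on_span[OF linear_polymap[OF K], of Basis]) (use p in auto)
  thus thesis using that p by blast
qed

text \<open>A bound for the inverse of I + t K that degenerates only at the zeros of \<delta>. With
  y = z + t K z, the vector t K z equals - z up to y, hence t^k K^k z equals (-1)^k z up to a
  multiple of (1 + |t|)^k |y|. Inserting this into t^d p(K) z = 0 shows that \<delta>(t) z is of the
  size of these errors.\<close>

lemma pencil_lower_bound:
  fixes K :: "'a::euclidean_space \<Rightarrow> 'a"
  assumes K: "linear K"
  obtains \<delta> C where "\<delta> \<noteq> 0" "degree \<delta> \<le> DIM('a) * DIM('a)"
    "\<And>t z. \<bar>poly \<delta> t\<bar> * norm z \<le> C * (1 + \<bar>t\<bar>) ^ (DIM('a) * DIM('a)) * norm (z + t *\<^sub>R K z)"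
proof -
  obtain p where p: "p \<noteq> 0" "degree p \<le> DIM('a) * DIM('a)" "\<And>z. polymap K p z = 0"
    using annihilating_poly_exists[OF K] by blast
  define d where "d = degree p"
  \<comment> \<open>\<delta>(t) = t^d p(-1/t), the reversed annihilating polynomial. Its constant
    coefficient is, up to sign, the leading coefficient of p, so \<delta> is not zero.\<close>
  define \<delta> where "\<delta> = (\<Sum>k\<le>d. monom (coeff p k * (-1) ^ k) (d - k))"
  have "coeff \<delta> 0 = (\<Sum>k\<le>d. if k = d then coeff p k * (-1) ^ k else 0)"
    unfolding \<delta>_def coeff_sum by (intro sum.cong) auto
  hence "coeff \<delta> 0 = coeff p d * (-1) ^ d" by simp
  hence \<delta>0: "\<delta> \<noteq> 0" using p(1) by (auto simp: d_def)
  have deg: "degree \<delta> \<le> DIM('a) * DIM('a)"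
    unfolding \<delta>_def using p(2) by (intro degree_sum_le) (auto simp: d_def intro: order_trans[OF degree_monom_le])
  have p\<delta>: "poly \<delta> t = (\<Sum>k\<le>d. coeff p k * (-1) ^ k * t ^ (d - k))" for t
    by (simp add: \<delta>_def poly_sum poly_monom)
  obtain B where B: "B > 0" "\<And>x. norm (K x) \<le> B * norm x" using linear_bounded_pos[OF K] by blast
  have step: "\<exists>C\<ge>0. \<forall>t z. norm (t ^ k *\<^sub>R (K ^^ k) z - (-1) ^ k *\<^sub>R z) \<le> C * (1 + \<bar>t\<bar>) ^ k * norm (z + t *\<^sub>R K z)" for k
  proof (induction k)
    case 0 show ?case by (intro exI[of _ 0]) simp
  next
    case (Suc k)
    then obtain C where C: "C \<ge> 0" "\<And>t z. norm (t ^ k *\<^sub>R (K ^^ k) z - (-1) ^ k *\<^sub>R z) \<le> C * (1 + \<bar>t\<bar>) ^ k * norm (z + t *\<^sub>R K z)" by blast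
    have "norm (t ^ Suc k *\<^sub>R (K ^^ Suc k) z - (-1) ^ Suc k *\<^sub>R z) \<le> (B * C + 1) * (1 + \<bar>t\<bar>) ^ Suc k * norm (z + t *\<^sub>R K z)" for t z
    proof -
      define e where "e = t ^ k *\<^sub>R (K ^^ k) z - (-1) ^ k *\<^sub>R z"
      define y where "y = z + t *\<^sub>R K z"
      have "t ^ Suc k *\<^sub>R (K ^^ Suc k) z - (-1) ^ Suc k *\<^sub>R z = t *\<^sub>R K e + (-1) ^ k *\<^sub>R y"
        by (simp add: e_def y_def linear_diff[OF K] linear_scale[OF K] algebra_simps)
      hence "norm (t ^ Suc k *\<^sub>R (K ^^ Suc k) z - (-1) ^ Suc k *\<^sub>R z) \<le> \<bar>t\<bar> * norm (K e) + norm y"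
        using norm_triangle_ineq[of "t *\<^sub>R K e" "(-1) ^ k *\<^sub>R y"] by simp
      also have "\<dots> \<le> \<bar>t\<bar> * (B * (C * (1 + \<bar>t\<bar>) ^ k * norm y)) + norm y"
        using B C(2)[of t z] by (intro add_right_mono mult_left_mono order_trans[OF B(2)]) (auto simp: e_def y_def)
      also have "\<dots> \<le> (1 + \<bar>t\<bar>) * (B * (C * (1 + \<bar>t\<bar>) ^ k * norm y)) + (1 + \<bar>t\<bar>) ^ Suc k * norm y"
        using B(1) C(1) mult_right_mono[OF one_le_power[of "1 + \<bar>t\<bar>" "Suc k"], of "norm y"]
        by (intro add_mono mult_right_mono) auto
      also have "\<dots> = (B * C + 1) * (1 + \<bar>t\<bar>) ^ Suc k * norm y" by (simp add: algebra_simps)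
      finally show ?thesis by (simp add: y_def)
    qed
    thus ?case using B C by (intro exI[of _ "B * C + 1"]) auto
  qed
  then obtain c where c: "\<And>k. c k \<ge> 0"
     "\<And>k t z. norm (t ^ k *\<^sub>R (K ^^ k) z - (-1) ^ k *\<^sub>R z) \<le> c k * (1 + \<bar>t\<bar>) ^ k * norm (z + t *\<^sub>R K z)"
    by metis
  define C where "C = (\<Sum>k\<le>d. \<bar>coeff p k\<bar> * c k)"
  have C0: "C \<ge> 0" unfolding C_def using c(1) by (intro sum_nonneg) auto
  have "\<bar>poly \<delta> t\<bar> * norm z \<le> C * (1 + \<bar>t\<bar>) ^ (DIM('a) * DIM('a)) * norm (z + t *\<^sub>R K z)" for t z
  proof -
    define y where "y = z + t *\<^sub>R K z"
    define e where "e k = t ^ k *\<^sub>R (K ^^ k) z - (-1) ^ k *\<^sub>R z" for k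
    have "(\<Sum>k\<le>d. (coeff p k * t ^ (d - k)) *\<^sub>R (t ^ k *\<^sub>R (K ^^ k) z)) = t ^ d *\<^sub>R polymap K p z"
      unfolding polymap_def scaleR_sum_right d_def[symmetric]
      by (intro sum.cong refl) (simp add: power_add[symmetric] mult.commute mult.assoc)
    hence z: "(\<Sum>k\<le>d. (coeff p k * t ^ (d - k)) *\<^sub>R (t ^ k *\<^sub>R (K ^^ k) z)) = 0" by (simp add: p(3))
    have "(\<Sum>k\<le>d. (coeff p k * t ^ (d - k)) *\<^sub>R e k) = 0 - poly \<delta> t *\<^sub>R z"
      unfolding z[symmetric] p\<delta> e_def scaleR_sum_left sum_subtractf[symmetric]
      by (intro sum.cong refl) (simp add: scaleR_diff_right mult_ac)
    hence "\<bar>poly \<delta> t\<bar> * norm z = norm (\<Sum>k\<le>d. (coeff p k * t ^ (d - k)) *\<^sub>R e k)" by simp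
    also have "\<dots> \<le> (\<Sum>k\<le>d. (\<bar>coeff p k\<bar> * c k) * ((1 + \<bar>t\<bar>) ^ (DIM('a) * DIM('a)) * norm y))"
    proof (rule sum_norm_le)
      fix k assume k: "k \<in> {..d}"
      have "norm ((coeff p k * t ^ (d - k)) *\<^sub>R e k) = \<bar>coeff p k\<bar> * (\<bar>t\<bar> ^ (d - k) * norm (e k))"
        by (simp add: abs_mult power_abs)
      also have "\<dots> \<le> \<bar>coeff p k\<bar> * ((1 + \<bar>t\<bar>) ^ (d - k) * (c k * (1 + \<bar>t\<bar>) ^ k * norm y))"
        using c by (intro mult_left_mono mult_mono power_mono) (auto simp: e_def y_def)
      also have "\<dots> = (\<bar>coeff p k\<bar> * c k) * ((1 + \<bar>t\<bar>) ^ (d - k + k) * norm y)" by (simp only: power_add mult_ac)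
      also have "\<dots> \<le> (\<bar>coeff p k\<bar> * c k) * ((1 + \<bar>t\<bar>) ^ (DIM('a) * DIM('a)) * norm y)"
        using k c(1) p(2) by (intro mult_left_mono mult_right_mono power_increasing) (auto simp: d_def)
      finally show "norm ((coeff p k * t ^ (d - k)) *\<^sub>R e k) \<le> (\<bar>coeff p k\<bar> * c k) * ((1 + \<bar>t\<bar>) ^ (DIM('a) * DIM('a)) * norm y)" .
    qed
    also have "\<dots> = C * (1 + \<bar>t\<bar>) ^ (DIM('a) * DIM('a)) * norm y" by (simp add: C_def sum_distrib_right mult.assoc)
    finally show ?thesis by (simp add: y_def)
  qed
  thus thesis using that \<delta>0 deg by blast
qed

lemma rootless_poly_bounded_below:
  fixes p :: "real poly"
  assumes "\<And>x. poly p x \<noteq> 0"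
  obtains c where "c > 0" "\<And>x. c \<le> \<bar>poly p x\<bar>"
proof (cases "degree p = 0")
  case True
  then obtain a where "p = [:a:]" by (metis degree_eq_zeroE)
  thus thesis using that[of "\<bar>a\<bar>"] assms by auto
next
  case False
  have "filterlim (poly p) at_infinity at_infinity" using False by (intro filterlim_poly_at_infinity) auto 
  hence "\<forall>\<^sub>F x in at_infinity. norm (poly p x) \<ge> 1"
    using filterlim_at_infinity[of 0 "poly p" at_infinity] by force
  then obtain R where R: "\<And>x. norm x \<ge> R \<Longrightarrow> \<bar>poly p x\<bar> \<ge> 1" by (auto simp: eventually_at_infinity)
  have "compact (cball (0::real) \<bar>R\<bar>)" "cball (0::real) \<bar>R\<bar> \<noteq> {}" by auto
  then obtain x0 where x0: "\<And>x. x \<in> cball 0 \<bar>R\<bar> \<Longrightarrow> \<bar>poly p x0\<bar> \<le> \<bar>poly p x\<bar>"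
    using continuous_attains_inf[of "cball 0 \<bar>R\<bar>" "\<lambda>x. \<bar>poly p x\<bar>"]
      continuous_on_rabs[OF poly_isCont[THEN continuous_at_imp_continuous_on[OF ballI]]] by blast
  have "min 1 \<bar>poly p x0\<bar> \<le> \<bar>poly p x\<bar>" for x
    using R[of x] x0[of x] by (cases "norm x \<ge> R") auto
  thus thesis using that[of "min 1 \<bar>poly p x0\<bar>"] assms by auto
qed

text \<open>The i-th filter is (b s^2 + c)/(s+1)^2. Real zeros of the lower bound are compensated by filters
  with (b, c) = (1, a^2), nonreal zeros by low-pass filters with (b, c) = (0, 1).\<close>

lemma filter_coefficients_exist:
  fixes \<delta> :: "real poly"
  assumes "\<delta> \<noteq> 0" "degree \<delta> \<le> N"
  shows "\<exists>b c. (\<forall>i. b i = 0 \<and> c i = 1 \<or> b i = 1 \<and> (\<exists>a. c i = a\<^sup>2)) \<and>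
    (\<exists>C\<ge>0. \<forall>w::real. (\<Prod>i<N. \<bar>c i - b i * w\<^sup>2\<bar> / (1 + w\<^sup>2)) * (1 + \<bar>w\<bar>) ^ N \<le> C * \<bar>poly \<delta> w\<bar>)"
  using assms
proof (induction N arbitrary: \<delta>)
  case 0
  then obtain a where "\<delta> = [:a:]" "a \<noteq> 0" by (metis degree_eq_zeroE le_0_eq pCons_0_0)
  thus ?case by (intro exI[of _ "\<lambda>_. 0"] exI[of _ "\<lambda>_. 1"] conjI exI[of _ "1 / \<bar>a\<bar>"]) auto
next
  case (Suc N)
  have w1: "1 + \<bar>w\<bar> \<le> 2 * (1 + w\<^sup>2)" and w2: "(1 + \<bar>w\<bar>)\<^sup>2 \<le> 2 * (1 + w\<^sup>2)" for w :: real
  proof -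
    have "2 * \<bar>w\<bar> \<le> 1 + w\<^sup>2" using zero_le_power2[of "\<bar>w\<bar> - 1"] by (simp add: power2_diff)
    moreover have "0 \<le> w\<^sup>2" by simp
    ultimately show "1 + \<bar>w\<bar> \<le> 2 * (1 + w\<^sup>2)" "(1 + \<bar>w\<bar>)\<^sup>2 \<le> 2 * (1 + w\<^sup>2)"
      unfolding power2_sum power2_abs by (simp; linarith)+
  qed
  show ?case
  proof (cases "\<exists>a. poly \<delta> a = 0")
    case True
    then obtain a \<delta>' where \<delta>': "\<delta> = [:-a, 1:] * \<delta>'" by (auto simp: poly_eq_0_iff_dvd dvd_def)
    have "\<delta>' \<noteq> 0" using Suc.prems(1) \<delta>' by auto
    moreover from this have "degree \<delta> = Suc (degree \<delta>')" unfolding \<delta>' by (subst degree_mult_eq) auto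
    ultimately have "\<delta>' \<noteq> 0" "degree \<delta>' \<le> N" using Suc.prems(2) by auto
    from Suc.IH[OF this] obtain b c C where bc: "\<And>i. b i = 0 \<and> c i = 1 \<or> b i = 1 \<and> (\<exists>a. c i = a\<^sup>2)"
      and C: "C \<ge> 0" "\<And>w. (\<Prod>i<N. \<bar>c i - b i * w\<^sup>2\<bar> / (1 + w\<^sup>2)) * (1 + \<bar>w\<bar>) ^ N \<le> C * \<bar>poly \<delta>' w\<bar>" by blast
    \<comment> \<open>The new filter vanishes at w = a and cancels the root: a^2 - w^2 = (a - w)(a +
      w), and |a + w| (1 + |w|) / (1 + w^2) is at most 2 (1 + |a|), which also pays for one more
      factor 1 + |w|.\<close>
    define b' c' where "b' i = (if i = N then 1 else b i)" and "c' i = (if i = N then a\<^sup>2 else c i)" for i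
    have "(\<Prod>i<Suc N. \<bar>c' i - b' i * w\<^sup>2\<bar> / (1 + w\<^sup>2)) * (1 + \<bar>w\<bar>) ^ Suc N \<le> C * (2 * (1 + \<bar>a\<bar>)) * \<bar>poly \<delta> w\<bar>" for w
    proof -
      have "\<bar>a + w\<bar> \<le> (1 + \<bar>a\<bar>) * (1 + \<bar>w\<bar>)"
        using abs_triangle_ineq[of a w] mult_nonneg_nonneg[of "\<bar>a\<bar>" "\<bar>w\<bar>"] unfolding distrib_left distrib_right by linarith
      hence "\<bar>a + w\<bar> * (1 + \<bar>w\<bar>) \<le> (1 + \<bar>a\<bar>) * (1 + \<bar>w\<bar>) * (1 + \<bar>w\<bar>)" by (rule mult_right_mono) simp
      also have "\<dots> \<le> (1 + \<bar>a\<bar>) * (2 * (1 + w\<^sup>2))"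
        unfolding mult.assoc power2_eq_square[symmetric] using w2[of w] by (intro mult_left_mono) auto
      finally have "\<bar>a - w\<bar> * (\<bar>a + w\<bar> * (1 + \<bar>w\<bar>)) \<le> \<bar>a - w\<bar> * ((1 + \<bar>a\<bar>) * (2 * (1 + w\<^sup>2)))"
        by (rule mult_left_mono) simp
      moreover have "\<bar>a\<^sup>2 - w\<^sup>2\<bar> = \<bar>a - w\<bar> * \<bar>a + w\<bar>" by (simp add: abs_mult[symmetric] power2_eq_square algebra_simps)
      moreover have "1 + w\<^sup>2 > 0" by (simp add: add_pos_nonneg)
      ultimately have f: "\<bar>a\<^sup>2 - w\<^sup>2\<bar> / (1 + w\<^sup>2) * (1 + \<bar>w\<bar>) \<le> 2 * (1 + \<bar>a\<bar>) * \<bar>w - a\<bar>"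
        using abs_minus_commute[of w a] by (simp add: pos_divide_le_eq algebra_simps)
      have "(\<Prod>i<Suc N. \<bar>c' i - b' i * w\<^sup>2\<bar> / (1 + w\<^sup>2)) * (1 + \<bar>w\<bar>) ^ Suc N
          = ((\<Prod>i<N. \<bar>c i - b i * w\<^sup>2\<bar> / (1 + w\<^sup>2)) * (1 + \<bar>w\<bar>) ^ N) * (\<bar>a\<^sup>2 - w\<^sup>2\<bar> / (1 + w\<^sup>2) * (1 + \<bar>w\<bar>))"
        by (simp add: b'_def c'_def)
      also have "\<dots> \<le> (C * \<bar>poly \<delta>' w\<bar>) * (2 * (1 + \<bar>a\<bar>) * \<bar>w - a\<bar>)"
        by (rule mult_mono[OF C(2) f]) (use C(1) in \<open>auto intro!: mult_nonneg_nonneg prod_nonneg\<close>)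
      also have "\<dots> = C * (2 * (1 + \<bar>a\<bar>)) * \<bar>(w - a) * poly \<delta>' w\<bar>" unfolding abs_mult by (simp only: mult_ac)
      also have "(w - a) * poly \<delta>' w = poly \<delta> w" by (simp add: \<delta>' algebra_simps)
      finally show ?thesis .
    qed
    moreover have "b' i = 0 \<and> c' i = 1 \<or> b' i = 1 \<and> (\<exists>a. c' i = a\<^sup>2)" for i
      using bc[of i] by (auto simp: b'_def c'_def)
    moreover have "C * (2 * (1 + \<bar>a\<bar>)) \<ge> 0" using C by simp
    ultimately show ?thesis by blast
  next
    case False
    then obtain m where m: "m > 0" "\<And>w. m \<le> \<bar>poly \<delta> w\<bar>" using rootless_poly_bounded_below[of \<delta>] by auto
    \<comment> \<open>Without real roots all remaining filters have the gain 1 / (1 + w^2), which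
      absorbs the powers of 1 + |w|, while \<delta> stays away from 0 by m.\<close>
    have "(\<Prod>i<Suc N. \<bar>1 - 0 * w\<^sup>2\<bar> / (1 + w\<^sup>2)) * (1 + \<bar>w\<bar>) ^ Suc N \<le> 2 ^ Suc N / m * \<bar>poly \<delta> w\<bar>" for w
    proof -
      have pos: "1 + w\<^sup>2 > 0" by (simp add: add_pos_nonneg)
      have "(\<Prod>i<Suc N. \<bar>1 - 0 * w\<^sup>2\<bar> / (1 + w\<^sup>2)) * (1 + \<bar>w\<bar>) ^ Suc N = ((1 + \<bar>w\<bar>) / (1 + w\<^sup>2)) ^ Suc N"
        unfolding power_divide by (simp add: power_divide del: power_Suc)
      also have "\<dots> \<le> 2 ^ Suc N" using w1[of w] pos by (intro power_mono) (auto simp: pos_divide_le_eq)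
      also have "\<dots> \<le> 2 ^ Suc N * (\<bar>poly \<delta> w\<bar> / m)" using m by (simp add: pos_le_divide_eq)
      finally show ?thesis by simp
    qed
    moreover have "2 ^ Suc N / m \<ge> 0" using m by simp
    ultimately show ?thesis by (intro exI[of _ "\<lambda>_. 0"] exI[of _ "\<lambda>_. 1"]) blast
  qed
qed

section \<open>Costs bounded below by filtered inputs\<close>

text \<open>Two copies, for real and imaginary part, of ((costate, state), input).\<close>

type_synonym ('a, 'b) pencil = "(('a \<times> 'a) \<times> 'b) \<times> (('a \<times> 'a) \<times> 'b)"

text \<open>The premises of \<open>fdi\<close> and \<open>strict\<close> express i \<omega> x = A x
  + B u for x = x1 + i x2 and u = u1 + i u2: the energy is nonnegative at every frequency and
  positive at \<omega>0. By \<open>sylvester\<close>, M solves A'M + MA = - S_xx with S_xx the state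
  block of S; this removes the state from the cross term between a free and a forced
  response.\<close>

locale kyp = lyapunov A P for A P :: "'x::euclidean_space \<Rightarrow> 'x" +
  fixes B :: "'u::euclidean_space \<Rightarrow> 'x" and S :: "'x \<times> 'u \<Rightarrow> 'x \<times> 'u" and M :: "'x \<Rightarrow> 'x" and \<omega>0 :: real
  assumes B: "linear B" and S: "linear S" and S_sym: "S z \<bullet> z' = z \<bullet> S z'"
    and M: "linear M" and sylvester: "A y \<bullet> M x + y \<bullet> M (A x) = - (fst (S (y, 0)) \<bullet> x)"
    and fdi: "A x1 + B u1 = - \<omega> *\<^sub>R x2 \<Longrightarrow> A x2 + B u2 = \<omega> *\<^sub>R x1 \<Longrightarrow>
        S (x1, u1) \<bullet> (x1, u1) + S (x2, u2) \<bullet> (x2, u2) \<ge> 0"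
    and strict: "A x1 + B u1 = - \<omega>0 *\<^sub>R x2 \<Longrightarrow> A x2 + B u2 = \<omega>0 *\<^sub>R x1 \<Longrightarrow> u1 \<noteq> 0 \<or> u2 \<noteq> 0 \<Longrightarrow>
        S (x1, u1) \<bullet> (x1, u1) + S (x2, u2) \<bullet> (x2, u2) > 0"
begin

text \<open>Complex vectors are represented by pairs of real vectors: x1 + i x2 is the response at
  frequency w to the harmonic input u1 + i u2.\<close>

definition harmonic :: "real \<Rightarrow> 'u \<Rightarrow> 'u \<Rightarrow> 'x \<Rightarrow> 'x \<Rightarrow> bool" where
  "harmonic \<omega> u1 u2 x1 x2 \<longleftrightarrow> A x1 + B u1 = - \<omega> *\<^sub>R x2 \<and> A x2 + B u2 = \<omega> *\<^sub>R x1"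

definition energy :: "'u \<Rightarrow> 'u \<Rightarrow> 'x \<Rightarrow> 'x \<Rightarrow> real" where
  "energy u1 u2 x1 x2 = S (x1, u1) \<bullet> (x1, u1) + S (x2, u2) \<bullet> (x2, u2)"

text \<open>The Lyapunov equation applied to both parts of a harmonic response; the terms with
  \<omega> cancel because P is symmetric. This is the source of the bounds on the response that are
  uniform in \<omega>, and with zero input it excludes imaginary eigenvalues of A.\<close>

lemma harmonic_norm:
  assumes "harmonic \<omega> u1 u2 x1 x2"
  shows "(norm x1)\<^sup>2 + (norm x2)\<^sup>2 = 2 * (P x1 \<bullet> B u1) + 2 * (P x2 \<bullet> B u2)"
proof -
  have "A x1 = - \<omega> *\<^sub>R x2 - B u1" "A x2 = \<omega> *\<^sub>R x1 - B u2" using assms by (simp_all add: harmonic_def algebra_simps)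
  hence "2 * (P x1 \<bullet> A x1) + 2 * (P x2 \<bullet> A x2) = - 2 * (P x1 \<bullet> B u1) - 2 * (P x2 \<bullet> B u2)
      - 2 * \<omega> * (P x1 \<bullet> x2) + 2 * \<omega> * (P x2 \<bullet> x1)" by (simp add: inner_diff_right)
  moreover have "P x1 \<bullet> x2 = P x2 \<bullet> x1" using P_sym[of x1 x2] by (simp add: inner_commute)
  ultimately show ?thesis by (simp add: lyapunov_eq dot_square_norm)
qed

lemma harmonic_zero:
  assumes "A x1 = - \<omega> *\<^sub>R x2" "A x2 = \<omega> *\<^sub>R x1" shows "x1 = 0" "x2 = 0"
proof -
  have "harmonic \<omega> 0 0 x1 x2" using assms by (simp add: harmonic_def linear_0[OF B])
  from harmonic_norm[OF this] have "(norm x1)\<^sup>2 + (norm x2)\<^sup>2 = 0" by (simp add: linear_0[OF B])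
  thus "x1 = 0" "x2 = 0" by (auto simp: sum_power2_eq_zero_iff)
qed

lemma harmonic_bound: "\<exists>C>0. \<forall>\<omega> u1 u2 x1 x2. harmonic \<omega> u1 u2 x1 x2 \<longrightarrow>
    (norm x1)\<^sup>2 + (norm x2)\<^sup>2 \<le> C * ((norm u1)\<^sup>2 + (norm u2)\<^sup>2)"
proof -
  have "linear (\<lambda>u. adjoint P (B u))" using linear_compose[OF B adjoint_linear[OF P]] by (simp add: o_def)
  then obtain p where p: "p > 0" "\<And>u. norm (adjoint P (B u)) \<le> p * norm u" using linear_bounded_pos by blast
  have one: "2 * (P x \<bullet> B u) \<le> (norm x)\<^sup>2 / 2 + 2 * p\<^sup>2 * (norm u)\<^sup>2" for x u
  proof -
    have "P x \<bullet> B u = x \<bullet> adjoint P (B u)" by (simp add: adjoint_works[OF P])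
    also have "\<dots> \<le> norm x * norm (adjoint P (B u))" by (rule norm_cauchy_schwarz)
    also have "\<dots> \<le> norm x * (p * norm u)" using p by (intro mult_left_mono) auto
    finally have "P x \<bullet> B u \<le> norm x * (p * norm u)" .
    moreover have "(norm x / 2 - p * norm u)\<^sup>2 \<ge> 0" by simp
    ultimately show ?thesis by (simp add: power2_diff power_mult_distrib power_divide mult_ac)
  qed
  have "(norm x1)\<^sup>2 + (norm x2)\<^sup>2 \<le> 4 * p\<^sup>2 * ((norm u1)\<^sup>2 + (norm u2)\<^sup>2)" if "harmonic \<omega> u1 u2 x1 x2" for \<omega> u1 u2 x1 x2
    using harmonic_norm[OF that] one[of x1 u1] one[of x2 u2] by (simp add: algebra_simps)
  thus ?thesis using p(1) by (intro exI[of _ "4 * p\<^sup>2"]) auto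
qed

lemma resolvent_surj: "\<exists>x1 x2. A x1 + \<omega> *\<^sub>R x2 = r1 \<and> A x2 - \<omega> *\<^sub>R x1 = r2"
proof -
  define f where "f z = (A (fst z) + \<omega> *\<^sub>R snd z, A (snd z) - \<omega> *\<^sub>R fst z)" for z :: "'x \<times> 'x"
  have lf: "linear f"
    unfolding f_def by (rule linearI) (simp_all add: linear_add[OF A] linear_scale[OF A] algebra_simps)
  have "inj f"
  proof (subst linear_injective_0[OF lf], intro allI impI)
    fix z assume "f z = 0"
    hence "A (fst z) = - \<omega> *\<^sub>R snd z" "A (snd z) = \<omega> *\<^sub>R fst z"
      by (simp_all add: f_def zero_prod_def eq_neg_iff_add_eq_0)
    from harmonic_zero[OF this] show "z = 0" by (simp add: prod_eq_iff)
  qed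
  hence "surj f" by (rule eucl.linear_inj_imp_surj[OF lf])
  then obtain z where "f z = (r1, r2)" by (metis surjD)
  thus ?thesis by (auto simp: f_def)
qed

lemma harmonic_exists: "\<exists>x1 x2. harmonic \<omega> u1 u2 x1 x2"
proof -
  obtain x1 x2 where "A x1 + \<omega> *\<^sub>R x2 = - B u1" "A x2 - \<omega> *\<^sub>R x1 = - B u2" using resolvent_surj by blast
  hence "harmonic \<omega> u1 u2 x1 x2" unfolding harmonic_def by (simp add: algebra_simps eq_neg_iff_add_eq_0)
  thus ?thesis by blast
qed

section \<open>Costates, the gradient of the energy and the optimality system\<close>

definition A' where "A' = adjoint A"
definition B' where "B' = adjoint B"

lemma adj: "linear A'" "linear B'" "A x \<bullet> y = x \<bullet> A' y" "B u \<bullet> y = u \<bullet> B' y"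
  by (simp_all add: A'_def B'_def adjoint_linear A B adjoint_works)

lemma adjoint_resolvent_zero:
  assumes "A' l1 = \<omega> *\<^sub>R l2" "A' l2 = - \<omega> *\<^sub>R l1" shows "l1 = 0" "l2 = 0"
proof -
  obtain x1 x2 where x: "A x1 + \<omega> *\<^sub>R x2 = l1" "A x2 - \<omega> *\<^sub>R x1 = l2" using resolvent_surj by blast
  have "l1 \<bullet> l1 + l2 \<bullet> l2 = (A x1 + \<omega> *\<^sub>R x2) \<bullet> l1 + (A x2 - \<omega> *\<^sub>R x1) \<bullet> l2" by (simp add: x)
  also have "\<dots> = 0" unfolding inner_add_left inner_diff_left inner_scaleR_left adj(3) assms
    by (simp add: inner_commute)
  finally have "(norm l1)\<^sup>2 + (norm l2)\<^sup>2 = 0" by (simp add: dot_square_norm)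
  thus "l1 = 0" "l2 = 0" by (auto simp: sum_power2_eq_zero_iff)
qed

lemma adjoint_resolvent_surj: "\<exists>l1 l2. A' l1 - \<omega> *\<^sub>R l2 = r1 \<and> A' l2 + \<omega> *\<^sub>R l1 = r2"
proof -
  define f where "f z = (A' (fst z) - \<omega> *\<^sub>R snd z, A' (snd z) + \<omega> *\<^sub>R fst z)" for z :: "'x \<times> 'x"
  have lf: "linear f"
    unfolding f_def by (rule linearI) (simp_all add: linear_add[OF adj(1)] linear_scale[OF adj(1)] algebra_simps)
  have "inj f"
  proof (subst linear_injective_0[OF lf], intro allI impI)
    fix z assume "f z = 0"
    hence "A' (fst z) = \<omega> *\<^sub>R snd z" "A' (snd z) = - \<omega> *\<^sub>R fst z"
      by (simp_all add: f_def zero_prod_def eq_neg_iff_add_eq_0)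
    from adjoint_resolvent_zero[OF this] show "z = 0" by (simp add: prod_eq_iff)
  qed
  hence "surj f" by (rule eucl.linear_inj_imp_surj[OF lf])
  then obtain z where "f z = (r1, r2)" by (metis surjD)
  thus ?thesis by (auto simp: f_def)
qed

text \<open>Costates solving the adjoint equation eliminate the response y, so the polarized energy
  becomes a pairing with the input v alone. Hence \<open>snd (S (x, u)) - B' l\<close> is the
  Hermitian frequency domain matrix applied to u, half of the gradient of the energy.\<close>

lemma costate_identity:
  assumes l: "A' l1 - \<omega> *\<^sub>R l2 = fst (S (x1, u1))" "A' l2 + \<omega> *\<^sub>R l1 = fst (S (x2, u2))"
    and h: "harmonic \<omega> v1 v2 y1 y2"
  shows "S (x1, u1) \<bullet> (y1, v1) + S (x2, u2) \<bullet> (y2, v2)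
    = (snd (S (x1, u1)) - B' l1) \<bullet> v1 + (snd (S (x2, u2)) - B' l2) \<bullet> v2"
proof -
  have 1: "A y1 = - \<omega> *\<^sub>R y2 - B v1" "A y2 = \<omega> *\<^sub>R y1 - B v2" using h by (simp_all add: harmonic_def algebra_simps)
  have "fst (S (x1, u1)) \<bullet> y1 + fst (S (x2, u2)) \<bullet> y2
      = A y1 \<bullet> l1 - \<omega> * (l2 \<bullet> y1) + A y2 \<bullet> l2 + \<omega> * (l1 \<bullet> y2)"
    unfolding l[symmetric] adj(3) inner_add_left inner_diff_left inner_scaleR_left by (simp add: inner_commute)
  also have "\<dots> = - (B v1 \<bullet> l1) - B v2 \<bullet> l2"
    unfolding 1 inner_diff_left inner_scaleR_left by (simp add: inner_commute)
  also have "\<dots> = - (B' l1 \<bullet> v1) - B' l2 \<bullet> v2" unfolding adj(4) by (simp add: inner_commute)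
  finally show ?thesis by (simp add: inner_prod_def inner_diff_left)
qed

text \<open>A positive semidefinite matrix Pi of norm at most D satisfies |Pi u|^2 \<le> D (Pi u .
  u): evaluate the nonnegative energy at u - g / D with g = Pi u. The point is that D does not
  depend on \<omega>.\<close>

lemma costate_bound: "\<exists>C>0. \<forall>\<omega> u1 u2 x1 x2 l1 l2. harmonic \<omega> u1 u2 x1 x2 \<longrightarrow>
    A' l1 - \<omega> *\<^sub>R l2 = fst (S (x1, u1)) \<longrightarrow> A' l2 + \<omega> *\<^sub>R l1 = fst (S (x2, u2)) \<longrightarrow>
    (norm (snd (S (x1, u1)) - B' l1))\<^sup>2 + (norm (snd (S (x2, u2)) - B' l2))\<^sup>2 \<le> C * energy u1 u2 x1 x2"
proof -
  obtain C where C: "C > 0" "\<And>\<omega> u1 u2 x1 x2. harmonic \<omega> u1 u2 x1 x2 \<Longrightarrow>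
      (norm x1)\<^sup>2 + (norm x2)\<^sup>2 \<le> C * ((norm u1)\<^sup>2 + (norm u2)\<^sup>2)" using harmonic_bound by blast
  obtain s where s: "s > 0" "\<And>z. norm (S z) \<le> s * norm z" using linear_bounded_pos[OF S] by blast
  have Sz: "S (x, u) \<bullet> (x, u) \<le> s * ((norm x)\<^sup>2 + (norm u)\<^sup>2)" for x u
  proof -
    have "S (x, u) \<bullet> (x, u) \<le> norm (S (x, u)) * norm (x, u)" by (rule norm_cauchy_schwarz)
    also have "\<dots> \<le> (s * norm (x, u)) * norm (x, u)" using s by (intro mult_right_mono) auto
    also have "\<dots> = s * ((norm x)\<^sup>2 + (norm u)\<^sup>2)" by (simp add: norm_Pair)
    finally show ?thesis .
  qed
  \<comment> \<open>s bounds S, and C + 1 bounds |x|^2 + |u|^2 in terms of |u|^2, uniformly in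
    \<omega>.\<close>
  define D where "D = s * (C + 1)"
  have D: "D > 0" using s C by (simp add: D_def)
  have "(norm g1)\<^sup>2 + (norm g2)\<^sup>2 \<le> D * energy u1 u2 x1 x2"
    if h: "harmonic \<omega> u1 u2 x1 x2" and l: "A' l1 - \<omega> *\<^sub>R l2 = fst (S (x1, u1))" "A' l2 + \<omega> *\<^sub>R l1 = fst (S (x2, u2))"
      and g: "g1 = snd (S (x1, u1)) - B' l1" "g2 = snd (S (x2, u2)) - B' l2" for \<omega> u1 u2 x1 x2 l1 l2 g1 g2
  proof -
    obtain y1 y2 where y: "harmonic \<omega> g1 g2 y1 y2" using harmonic_exists by blast
    define G where "G = (norm g1)\<^sup>2 + (norm g2)\<^sup>2"
    \<comment> \<open>The minimizer of the bound \<open>energy\<close> - 2 r G + r^2 D G over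
      r.\<close>
    define r where "r = 1 / D"
    have hh: "harmonic \<omega> (u1 - r *\<^sub>R g1) (u2 - r *\<^sub>R g2) (x1 - r *\<^sub>R y1) (x2 - r *\<^sub>R y2)"
      using h y unfolding harmonic_def
      by (simp add: linear_diff[OF A] linear_diff[OF B] linear_scale[OF A] linear_scale[OF B] algebra_simps scaleR_add_right[symmetric])
    have "energy g1 g2 y1 y2 \<le> s * ((norm y1)\<^sup>2 + (norm y2)\<^sup>2) + s * G"
      using Sz[of y1 g1] Sz[of y2 g2] by (simp add: energy_def G_def algebra_simps)
    also have "\<dots> \<le> s * (C * G) + s * G" using C(2)[OF y] s by (simp add: G_def)
    finally have eg: "energy g1 g2 y1 y2 \<le> D * G" by (simp add: D_def algebra_simps)
    have cross: "S (x1, u1) \<bullet> (y1, g1) + S (x2, u2) \<bullet> (y2, g2) = G"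
      using costate_identity[OF l y] by (simp add: g G_def dot_square_norm)
    have split: "S (x - r *\<^sub>R y, u - r *\<^sub>R v) \<bullet> (x - r *\<^sub>R y, u - r *\<^sub>R v)
       = S (x, u) \<bullet> (x, u) - 2 * r * (S (x, u) \<bullet> (y, v)) + r\<^sup>2 * (S (y, v) \<bullet> (y, v))" for x y u v
    proof -
      have e: "(x - r *\<^sub>R y, u - r *\<^sub>R v) = (x, u) - r *\<^sub>R (y, v)" by simp
      show ?thesis unfolding e linear_diff[OF S] linear_scale[OF S]
        using S_sym[of "(y, v)" "(x, u)"]
        by (simp only: inner_diff_left inner_diff_right inner_scaleR_left inner_scaleR_right inner_commute[of "(y,v)" "S (x,u)"])
           (simp add: algebra_simps power2_eq_square)
    qed
    have "energy (u1 - r *\<^sub>R g1) (u2 - r *\<^sub>R g2) (x1 - r *\<^sub>R y1) (x2 - r *\<^sub>R y2) \<ge> 0"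
      using fdi hh unfolding energy_def harmonic_def by blast
    hence "energy u1 u2 x1 x2 - 2 * r * (S (x1, u1) \<bullet> (y1, g1) + S (x2, u2) \<bullet> (y2, g2)) + r\<^sup>2 * energy g1 g2 y1 y2 \<ge> 0"
      unfolding energy_def split by (simp add: algebra_simps)
    moreover have "r\<^sup>2 * energy g1 g2 y1 y2 \<le> r\<^sup>2 * (D * G)" using eg by (rule mult_left_mono) simp
    moreover have "r\<^sup>2 * (D * G) = r * G" using D by (simp add: r_def power2_eq_square)
    ultimately have "r * G \<le> energy u1 u2 x1 x2" unfolding cross by linarith
    thus ?thesis using D by (simp add: r_def G_def field_simps)
  qed
  thus ?thesis using D by blast
qed

text \<open>The optimality system of the control problem at frequency \<omega>: the residuals of the
  state equation and of the costate equation, and the gradient. The frequency domain matrix is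
  rational in \<omega>; this one is affine.\<close>

definition pencil :: "real \<Rightarrow> ('x, 'u) pencil \<Rightarrow> ('x, 'u) pencil" where
  "pencil \<omega> = (\<lambda>(((l1, x1), u1), ((l2, x2), u2)).
     (((A x1 + B u1 + \<omega> *\<^sub>R x2, A' l1 - \<omega> *\<^sub>R l2 - fst (S (x1, u1))), snd (S (x1, u1)) - B' l1),
      ((A x2 + B u2 - \<omega> *\<^sub>R x1, A' l2 + \<omega> *\<^sub>R l1 - fst (S (x2, u2))), snd (S (x2, u2)) - B' l2)))"

definition pencil_slope :: "('x, 'u) pencil \<Rightarrow> ('x, 'u) pencil" where
  "pencil_slope = (\<lambda>(((l1, x1), u1), ((l2, x2), u2)). (((x2, - l2), 0), ((- x1, l1), 0)))"

lemma linear_pencil: "linear (pencil \<omega>)"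
proof -
  have S_add: "S (x + x', u + u') = S (x, u) + S (x', u')" and S_scale: "S (r *\<^sub>R x, r *\<^sub>R u) = r *\<^sub>R S (x, u)" for x x' u u' r
    using linear_add[OF S, of "(x, u)" "(x', u')"] linear_scale[OF S, of r "(x, u)"] by simp_all
  show ?thesis
    by (rule linearI) (auto simp: pencil_def S_add S_scale linear_add[OF A] linear_scale[OF A] linear_add[OF B] linear_scale[OF B]
      linear_add[OF adj(1)] linear_scale[OF adj(1)] linear_add[OF adj(2)] linear_scale[OF adj(2)] algebra_simps)
qed

lemma linear_pencil_slope: "linear pencil_slope"
  by (rule linearI) (auto simp: pencil_slope_def algebra_simps)

lemma pencil_affine: "pencil \<omega> w = pencil \<omega>0 w + (\<omega> - \<omega>0) *\<^sub>R pencil_slope w"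
  by (auto simp: pencil_def pencil_slope_def algebra_simps split: prod.splits)

text \<open>On the kernel the gradient vanishes, so \<open>costate_identity\<close>, applied to the
  response itself, gives energy 0. Strictness at \<omega>0 forces u = 0, and then state and costate
  vanish because A has no imaginary eigenvalue.\<close>

lemma inj_pencil: "inj (pencil \<omega>0)"
proof (subst linear_injective_0[OF linear_pencil], intro allI impI)
  fix w assume w: "pencil \<omega>0 w = 0"
  obtain l1 x1 u1 l2 x2 u2 where wd: "w = (((l1, x1), u1), ((l2, x2), u2))" by (metis surj_pair)
  have h: "harmonic \<omega>0 u1 u2 x1 x2"
    using w by (simp add: wd pencil_def zero_prod_def harmonic_def eq_neg_iff_add_eq_0)
  have l: "A' l1 - \<omega>0 *\<^sub>R l2 = fst (S (x1, u1))" "A' l2 + \<omega>0 *\<^sub>R l1 = fst (S (x2, u2))"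
    and g: "snd (S (x1, u1)) - B' l1 = 0" "snd (S (x2, u2)) - B' l2 = 0"
    using w by (simp_all add: wd pencil_def zero_prod_def)
  have "energy u1 u2 x1 x2 = 0" using costate_identity[OF l h] unfolding g energy_def by simp
  hence u: "u1 = 0" "u2 = 0" using strict[of x1 u1 x2 u2] h by (auto simp: harmonic_def energy_def)
  hence x: "x1 = 0" "x2 = 0" using harmonic_zero[of x1 \<omega>0 x2] h by (auto simp: harmonic_def linear_0[OF B])
  have "S (0, 0) = 0" using linear_0[OF S] by (simp add: zero_prod_def)
  hence "A' l1 = \<omega>0 *\<^sub>R l2" "A' l2 = - \<omega>0 *\<^sub>R l1" using l by (simp_all add: u x eq_neg_iff_add_eq_0)
  from adjoint_resolvent_zero[OF this] show "w = 0" by (simp add: wd u x zero_prod_def)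
qed

text \<open>A harmonic response together with its costate is mapped by the pencil to zero residuals
  and the gradient g. So u is bounded by g through the inverse of the pencil, and g by the energy
  through \<open>costate_bound\<close>.\<close>

lemma harmonic_energy_bound:
  defines "N \<equiv> DIM(('x, 'u) pencil) * DIM(('x, 'u) pencil)"
  shows "\<exists>\<delta> C. \<delta> \<noteq> 0 \<and> degree \<delta> \<le> N \<and> C > 0 \<and> (\<forall>\<omega> u1 u2 x1 x2. harmonic \<omega> u1 u2 x1 x2 \<longrightarrow>
     (poly \<delta> \<omega>)\<^sup>2 * ((norm u1)\<^sup>2 + (norm u2)\<^sup>2) \<le> C * ((1 + \<bar>\<omega>\<bar>) ^ N)\<^sup>2 * energy u1 u2 x1 x2)"
proof -
  obtain R where R: "linear R" "\<And>w. R (pencil \<omega>0 w) = w"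
    using linear_injective_left_inverse[OF linear_pencil inj_pencil] by (auto simp: o_def fun_eq_iff)
  obtain r where r: "r > 0" "\<And>w. norm (R w) \<le> r * norm w" using linear_bounded_pos[OF R(1)] by blast
  \<comment> \<open>\<open>pencil \<omega>\<close> is \<open>pencil \<omega>0\<close> composed with
    I + (\<omega> - \<omega>0) K, so the frequency shift is the parameter t of
    \<open>pencil_lower_bound\<close>. This is why \<delta>0 is composed with the shift by \<omega>0
    below.\<close>
  define K where "K w = R (pencil_slope w)" for w
  have "linear K" unfolding K_def using linear_compose[OF linear_pencil_slope R(1)] by (simp add: o_def)
  from pencil_lower_bound[OF this] obtain \<delta>0 C0 where \<delta>0: "\<delta>0 \<noteq> 0" "degree \<delta>0 \<le> N"
    and C0: "\<And>t w. \<bar>poly \<delta>0 t\<bar> * norm w \<le> C0 * (1 + \<bar>t\<bar>) ^ N * norm (w + t *\<^sub>R K w)" unfolding N_def by blast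
  obtain G where G: "G > 0" "\<And>\<omega> u1 u2 x1 x2 l1 l2. harmonic \<omega> u1 u2 x1 x2 \<Longrightarrow>
    A' l1 - \<omega> *\<^sub>R l2 = fst (S (x1, u1)) \<Longrightarrow> A' l2 + \<omega> *\<^sub>R l1 = fst (S (x2, u2)) \<Longrightarrow>
    (norm (snd (S (x1, u1)) - B' l1))\<^sup>2 + (norm (snd (S (x2, u2)) - B' l2))\<^sup>2 \<le> G * energy u1 u2 x1 x2"
    using costate_bound by blast
  define \<delta> where "\<delta> = pcompose \<delta>0 [:-\<omega>0, 1:]"
  have p\<delta>: "poly \<delta> \<omega> = poly \<delta>0 (\<omega> - \<omega>0)" for \<omega> by (simp add: \<delta>_def poly_pcompose)
  have \<delta>: "\<delta> \<noteq> 0" "degree \<delta> \<le> N" using \<delta>0 by (simp_all add: \<delta>_def pcompose_eq_0_iff degree_pcompose)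
  define C where "C = (C0 * (1 + \<bar>\<omega>0\<bar>) ^ N * r)\<^sup>2 * G + 1"
  have "(poly \<delta> \<omega>)\<^sup>2 * ((norm u1)\<^sup>2 + (norm u2)\<^sup>2) \<le> C * ((1 + \<bar>\<omega>\<bar>) ^ N)\<^sup>2 * energy u1 u2 x1 x2"
    if h: "harmonic \<omega> u1 u2 x1 x2" for \<omega> u1 u2 x1 x2
  proof -
    have e0: "energy u1 u2 x1 x2 \<ge> 0" using fdi h unfolding energy_def harmonic_def by blast
    obtain l1 l2 where l: "A' l1 - \<omega> *\<^sub>R l2 = fst (S (x1, u1))" "A' l2 + \<omega> *\<^sub>R l1 = fst (S (x2, u2))"
      using adjoint_resolvent_surj by blast
    define w where "w = (((l1, x1), u1), ((l2, x2), u2))"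
    define g1 g2 where "g1 = snd (S (x1, u1)) - B' l1" and "g2 = snd (S (x2, u2)) - B' l2"
    have pw: "pencil \<omega> w = (((0, 0), g1), ((0, 0), g2))"
      using h l by (simp add: pencil_def w_def g1_def g2_def harmonic_def)
    have np: "(norm (pencil \<omega> w))\<^sup>2 = (norm g1)\<^sup>2 + (norm g2)\<^sup>2" unfolding pw by (simp add: norm_Pair)
    have "w + (\<omega> - \<omega>0) *\<^sub>R K w = R (pencil \<omega> w)"
      by (simp add: pencil_affine[of \<omega>] K_def linear_add[OF R(1)] linear_scale[OF R(1)] R(2))
    with C0[of "\<omega> - \<omega>0" w] have "\<bar>poly \<delta> \<omega>\<bar> * norm w \<le> C0 * (1 + \<bar>\<omega> - \<omega>0\<bar>) ^ N * norm (R (pencil \<omega> w))"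
      by (simp add: p\<delta>)
    also have "\<dots> \<le> \<bar>C0\<bar> * (1 + \<bar>\<omega> - \<omega>0\<bar>) ^ N * norm (R (pencil \<omega> w))"
      by (intro mult_right_mono) auto
    also have "\<dots> \<le> \<bar>C0\<bar> * ((1 + \<bar>\<omega>0\<bar>) * (1 + \<bar>\<omega>\<bar>)) ^ N * (r * norm (pencil \<omega> w))"
    proof (intro mult_mono mult_left_mono power_mono r(2))
      have "\<bar>\<omega> - \<omega>0\<bar> \<le> \<bar>\<omega>\<bar> + \<bar>\<omega>0\<bar>" by (rule abs_triangle_ineq4)
      moreover have "0 \<le> \<bar>\<omega>0\<bar> * \<bar>\<omega>\<bar>" by simp
      ultimately show "1 + \<bar>\<omega> - \<omega>0\<bar> \<le> (1 + \<bar>\<omega>0\<bar>) * (1 + \<bar>\<omega>\<bar>)" unfolding distrib_left distrib_right by linarith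
    qed (use r in auto)
    finally have "\<bar>poly \<delta> \<omega>\<bar> * norm w \<le> \<bar>C0\<bar> * ((1 + \<bar>\<omega>0\<bar>) * (1 + \<bar>\<omega>\<bar>)) ^ N * (r * norm (pencil \<omega> w))" .
    hence "(\<bar>poly \<delta> \<omega>\<bar> * norm w)\<^sup>2 \<le> (\<bar>C0\<bar> * ((1 + \<bar>\<omega>0\<bar>) * (1 + \<bar>\<omega>\<bar>)) ^ N * (r * norm (pencil \<omega> w)))\<^sup>2"
      by (rule power_mono) simp
    also have "\<dots> = (C0 * (1 + \<bar>\<omega>0\<bar>) ^ N * r)\<^sup>2 * ((1 + \<bar>\<omega>\<bar>) ^ N)\<^sup>2 * ((norm g1)\<^sup>2 + (norm g2)\<^sup>2)"
      unfolding np[symmetric] by (simp add: power_mult_distrib)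
    also have "\<dots> \<le> (C0 * (1 + \<bar>\<omega>0\<bar>) ^ N * r)\<^sup>2 * ((1 + \<bar>\<omega>\<bar>) ^ N)\<^sup>2 * (G * energy u1 u2 x1 x2)"
      using G(2)[OF h l] by (intro mult_left_mono) (auto simp: g1_def g2_def)
    also have "\<dots> = ((C0 * (1 + \<bar>\<omega>0\<bar>) ^ N * r)\<^sup>2 * G) * (((1 + \<bar>\<omega>\<bar>) ^ N)\<^sup>2 * energy u1 u2 x1 x2)" by (simp only: mult_ac)
    also have "\<dots> \<le> C * (((1 + \<bar>\<omega>\<bar>) ^ N)\<^sup>2 * energy u1 u2 x1 x2)" unfolding C_def using e0 by (intro mult_right_mono) auto
    finally have 1: "(\<bar>poly \<delta> \<omega>\<bar> * norm w)\<^sup>2 \<le> C * (((1 + \<bar>\<omega>\<bar>) ^ N)\<^sup>2 * energy u1 u2 x1 x2)" .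
    have "(norm u1)\<^sup>2 + (norm u2)\<^sup>2 \<le> (norm w)\<^sup>2" by (simp add: w_def norm_Pair)
    hence "(poly \<delta> \<omega>)\<^sup>2 * ((norm u1)\<^sup>2 + (norm u2)\<^sup>2) \<le> (poly \<delta> \<omega>)\<^sup>2 * (norm w)\<^sup>2" by (rule mult_left_mono) simp
    also have "\<dots> = (\<bar>poly \<delta> \<omega>\<bar> * norm w)\<^sup>2" by (simp add: power_mult_distrib)
    finally show ?thesis using 1 by (simp add: mult.assoc)
  qed
  moreover have "C > 0" unfolding C_def using G by (intro add_nonneg_pos) auto
  ultimately show ?thesis using \<delta> by blast
qed

end

section \<open>Filters, their cascades and their gains\<close>

lemma primitive_Pair:
  assumes "primitive x f a" "primitive y g b"
  shows "primitive (\<lambda>t. (x t, y t)) (\<lambda>t. (f t, g t)) (a, b)"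
proof -
  have "linear (\<lambda>x. (x, 0))" "linear (\<lambda>y. (0, y))" by (simp_all add: linear_iff)
  from primitive_add[OF primitive_linear[OF assms(1) this(1)] primitive_linear[OF assms(2) this(2)]]
  show ?thesis by simp
qed

lemma vec_lambda_sum_axis: "(\<Sum>j\<in>UNIV. axis j (f j)) = (\<chi> j. f j)" for f :: "'e::finite \<Rightarrow> 'u::euclidean_space"
  by (simp add: vec_eq_iff axis_def if_distrib[of "\<lambda>z. z $ _"] cong: if_cong)

lemma linear_axis: "linear (axis j :: 'u::euclidean_space \<Rightarrow> 'u ^ 'e::finite)"
  by (rule linearI) (simp_all add: axis_def vec_eq_iff)

lemma primitive_vec:
  fixes x :: "'e::finite \<Rightarrow> real \<Rightarrow> 'u::euclidean_space"
  assumes "\<And>j. primitive (x j) (f j) (a j)"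
  shows "primitive (\<lambda>t. \<chi> j. x j t) (\<lambda>t. \<chi> j. f j t) (\<chi> j. a j)"
proof -
  have "primitive (\<lambda>t. axis j (x j t)) (\<lambda>t. axis j (f j t)) (axis j (a j))" for j
    by (rule primitive_linear[OF assms linear_axis])
  from primitive_sum[where I = UNIV and x = "\<lambda>j t. axis j (x j t)" and f = "\<lambda>j t. axis j (f j t)"
      and a = "\<lambda>j. axis j (a j)", OF finite this]
  show ?thesis by (simp add: vec_lambda_sum_axis)
qed

lemma square_integrable_sum:
  "finite I \<Longrightarrow> (\<And>i. i \<in> I \<Longrightarrow> square_integrable (u i)) \<Longrightarrow> square_integrable (\<lambda>t. \<Sum>i\<in>I. u i t)"
  by (induction rule: finite_induct) (auto intro: square_integrable_add)

lemma square_integrable_vec: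
  fixes x :: "'e::finite \<Rightarrow> real \<Rightarrow> 'u::euclidean_space"
  assumes "\<And>j. square_integrable (x j)"
  shows "square_integrable (\<lambda>t. \<chi> j. x j t)"
proof -
  have "square_integrable (\<lambda>t. axis j (x j t))" for j by (rule square_integrable_linear[OF assms linear_axis])
  from square_integrable_sum[where I = UNIV and u = "\<lambda>j t. axis j (x j t)", OF finite this]
  show ?thesis by (simp add: vec_lambda_sum_axis)
qed

lemma lyapunov_uminus: "lyapunov (\<lambda>x. - x) (\<lambda>x. x /\<^sub>R 2)"
  by standard (auto simp: linear_iff algebra_simps)

lemma (in lyapunov) solution_square_integrable:
  assumes "primitive x (\<lambda>t. A (x t) + b t) a" "square_integrable b"
  shows "square_integrable x" "square_integrable (\<lambda>t. A (x t) + b t)" "(x \<longlongrightarrow> 0) at_top"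
proof -
  show x: "square_integrable x" using state_bound assms by blast
  show d: "square_integrable (\<lambda>t. A (x t) + b t)" by (intro square_integrable_add square_integrable_linear[OF x A] assms(2))
  show "(x \<longlongrightarrow> 0) at_top" by (rule square_integrable_vanishing[OF assms(1) x d])
qed

text \<open>The filter 1/(s+1) with zero initial state. A choice suffices, since only the equation
  and square integrability on the half line are used; values at negative times are left
  open.\<close>

definition lowpass :: "(real \<Rightarrow> 'u::euclidean_space) \<Rightarrow> real \<Rightarrow> 'u" where
  "lowpass y = (SOME p. primitive p (\<lambda>t. y t - p t) 0 \<and> square_integrable p)"

lemma lowpass:
  assumes "square_integrable y"
  shows "primitive (lowpass y) (\<lambda>t. y t - lowpass y t) 0" "square_integrable (lowpass y)"
proof -
  interpret lyapunov "\<lambda>x::'a. - x" "\<lambda>x. x /\<^sub>R 2" by (rule lyapunov_uminus)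
  obtain p where p: "primitive p (\<lambda>t. - p t + y t) 0" using ode_solution_exists[OF A primitive_exists[OF assms]] by blast
  have "square_integrable p" by (rule solution_square_integrable[OF p assms])
  moreover have "primitive p (\<lambda>t. y t - p t) 0" using p by simp
  ultimately have "\<exists>p. primitive p (\<lambda>t. y t - p t) 0 \<and> square_integrable p" by blast
  from someI_ex[OF this] show "primitive (lowpass y) (\<lambda>t. y t - lowpass y t) 0" "square_integrable (lowpass y)"
    by (auto simp: lowpass_def)
qed

text \<open>The filter (b s^2 + c)/(s+1)^2, realized through the low-pass outputs p = y/(s+1) and q = y/(s+1)^2,
  for which s^2 q = y - 2 p + q.\<close>

definition bandstop :: "real \<Rightarrow> real \<Rightarrow> (real \<Rightarrow> 'u::euclidean_space) \<Rightarrow> real \<Rightarrow> 'u" where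
  "bandstop b c y t = b *\<^sub>R (y t - 2 *\<^sub>R lowpass y t + lowpass (lowpass y) t) + c *\<^sub>R lowpass (lowpass y) t"

lemma square_integrable_bandstop: "square_integrable y \<Longrightarrow> square_integrable (bandstop b c y)"
  unfolding bandstop_def[abs_def]
  by (intro square_integrable_add square_integrable_scaleR square_integrable_diff lowpass(2)) auto

text \<open>The cascade as a map on signals. Its pointwise counterpart \<open>cascade\<close>
  expresses the same output through the states of a finite-dimensional system.\<close>

fun filtered :: "(nat \<Rightarrow> real) \<Rightarrow> (nat \<Rightarrow> real) \<Rightarrow> (real \<Rightarrow> 'u::euclidean_space) \<Rightarrow> nat \<Rightarrow> real \<Rightarrow> 'u" where
  "filtered b c v 0 = v"
| "filtered b c v (Suc i) = bandstop (b i) (c i) (filtered b c v i)"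

lemma square_integrable_filtered: "square_integrable v \<Longrightarrow> square_integrable (filtered b c v i)"
  by (induction i) (auto intro: square_integrable_bandstop)

text \<open>Output of the first i filters as a function of the input u and the low-pass states s of all filters.\<close>

fun cascade :: "(nat \<Rightarrow> real) \<Rightarrow> (nat \<Rightarrow> real) \<Rightarrow> (nat \<Rightarrow> 'e::finite) \<Rightarrow> nat \<Rightarrow> ('u::euclidean_space^'e) \<times> ('u^'e) \<Rightarrow> 'u \<Rightarrow> 'u" where
  "cascade b c idx 0 s u = u"
| "cascade b c idx (Suc i) s u = b i *\<^sub>R (cascade b c idx i s u - 2 *\<^sub>R (fst s $ idx i) + snd s $ idx i) + c i *\<^sub>R (snd s $ idx i)"

lemma cascade_add: "cascade b c idx i (s + s') (u + u') = cascade b c idx i s u + cascade b c idx i s' u'"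
  by (induction i) (simp_all add: algebra_simps)

lemma cascade_scale: "cascade b c idx i (r *\<^sub>R s) (r *\<^sub>R u) = r *\<^sub>R cascade b c idx i s u"
  by (induction i) (simp_all add: algebra_simps)

text \<open>In complex notation p = (1 + i \<omega>) q and y = (1 + i \<omega>)^2 q, while the
  output is (c - b \<omega>^2) q.\<close>

lemma bandstop_gain:
  fixes y1 y2 p1 p2 q1 q2 :: "'u::euclidean_space"
  assumes y: "y1 - p1 = - \<omega> *\<^sub>R p2" "y2 - p2 = \<omega> *\<^sub>R p1" and p: "p1 - q1 = - \<omega> *\<^sub>R q2" "p2 - q2 = \<omega> *\<^sub>R q1"
  shows "(norm (b *\<^sub>R (y1 - 2 *\<^sub>R p1 + q1) + c *\<^sub>R q1))\<^sup>2 + (norm (b *\<^sub>R (y2 - 2 *\<^sub>R p2 + q2) + c *\<^sub>R q2))\<^sup>2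
    = (\<bar>c - b * \<omega>\<^sup>2\<bar> / (1 + \<omega>\<^sup>2))\<^sup>2 * ((norm y1)\<^sup>2 + (norm y2)\<^sup>2)"
proof -
  have p1: "p1 = q1 - \<omega> *\<^sub>R q2" and p2: "p2 = q2 + \<omega> *\<^sub>R q1" using p by (simp_all add: algebra_simps)
  have y1: "y1 = (1 - \<omega>\<^sup>2) *\<^sub>R q1 - (\<omega> + \<omega>) *\<^sub>R q2" and y2: "y2 = (1 - \<omega>\<^sup>2) *\<^sub>R q2 + (\<omega> + \<omega>) *\<^sub>R q1"
    using y unfolding p1 p2 scaleR_left_distrib by (simp_all add: algebra_simps power2_eq_square)
  have z: "b *\<^sub>R (y1 - 2 *\<^sub>R p1 + q1) + c *\<^sub>R q1 = (c - b * \<omega>\<^sup>2) *\<^sub>R q1"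
    "b *\<^sub>R (y2 - 2 *\<^sub>R p2 + q2) + c *\<^sub>R q2 = (c - b * \<omega>\<^sup>2) *\<^sub>R q2"
    unfolding y1 y2 p1 p2 scaleR_2 scaleR_left_distrib by (simp_all add: algebra_simps)
  have "(norm y1)\<^sup>2 + (norm y2)\<^sup>2 = ((1 - \<omega>\<^sup>2)\<^sup>2 + (2 * \<omega>)\<^sup>2) * (q1 \<bullet> q1 + q2 \<bullet> q2)"
    unfolding y1 y2 power2_norm_eq_inner
    by (simp add: inner_diff_left inner_diff_right inner_add_left inner_add_right inner_commute power2_eq_square)
       (simp add: algebra_simps)
  also have "(1 - \<omega>\<^sup>2)\<^sup>2 + (2 * \<omega>)\<^sup>2 = (1 + \<omega>\<^sup>2)\<^sup>2" by (simp add: power2_eq_square algebra_simps)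
  finally have "(norm y1)\<^sup>2 + (norm y2)\<^sup>2 = (1 + \<omega>\<^sup>2)\<^sup>2 * (q1 \<bullet> q1 + q2 \<bullet> q2)" .
  moreover have "1 + \<omega>\<^sup>2 \<noteq> 0" by (metis add_pos_nonneg less_numeral_extra(1) less_numeral_extra(3) zero_le_power2)
  ultimately show ?thesis unfolding z
    by (simp add: power_mult_distrib power_divide power2_norm_eq_inner distrib_left)
qed

lemma cascade_gain:
  fixes s1 s2 :: "('u::euclidean_space^'e::finite) \<times> ('u^'e)"
  assumes "\<And>i. i < N \<Longrightarrow> cascade b c idx i s1 u1 - fst s1 $ idx i = - \<omega> *\<^sub>R (fst s2 $ idx i)"
    "\<And>i. i < N \<Longrightarrow> cascade b c idx i s2 u2 - fst s2 $ idx i = \<omega> *\<^sub>R (fst s1 $ idx i)"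
    "\<And>i. i < N \<Longrightarrow> fst s1 $ idx i - snd s1 $ idx i = - \<omega> *\<^sub>R (snd s2 $ idx i)"
    "\<And>i. i < N \<Longrightarrow> fst s2 $ idx i - snd s2 $ idx i = \<omega> *\<^sub>R (snd s1 $ idx i)"
  shows "i \<le> N \<Longrightarrow> (norm (cascade b c idx i s1 u1))\<^sup>2 + (norm (cascade b c idx i s2 u2))\<^sup>2
    = (\<Prod>j<i. \<bar>c j - b j * \<omega>\<^sup>2\<bar> / (1 + \<omega>\<^sup>2))\<^sup>2 * ((norm u1)\<^sup>2 + (norm u2)\<^sup>2)"
proof (induction i)
  case (Suc i)
  hence i: "i < N" by simp
  show ?case unfolding cascade.simps bandstop_gain[OF assms(1)[OF i] assms(2)[OF i] assms(3)[OF i] assms(4)[OF i]]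
    using Suc by (simp add: power_mult_distrib power_divide mult_ac)
qed simp

lemma cascade_zero_state: "cascade b c idx i 0 u = (\<Prod>j<i. b j) *\<^sub>R u"
  by (induction i) (simp_all add: mult.commute)

section \<open>The zero-state cost dominates the energy of the filtered input\<close>

context kyp begin

text \<open>The gains compensate the real zeros of \<delta> and the growth of (1 + |\<omega>|)^N in
  \<open>harmonic_energy_bound\<close>. N is bounded only from below because it will be the
  cardinality of a type.\<close>

lemma filter_bound:
  assumes N: "DIM(('x, 'u) pencil) * DIM(('x, 'u) pencil) \<le> N"
  shows "\<exists>b c \<kappa>. (\<forall>i. b i = 0 \<and> c i = 1 \<or> b i = 1 \<and> (\<exists>a. c i = a\<^sup>2)) \<and> \<kappa> > 0 \<and>
    (\<forall>\<omega> u1 u2 x1 x2. harmonic \<omega> u1 u2 x1 x2 \<longrightarrow>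
      \<kappa> * (\<Prod>i<N. \<bar>c i - b i * \<omega>\<^sup>2\<bar> / (1 + \<omega>\<^sup>2))\<^sup>2 * ((norm u1)\<^sup>2 + (norm u2)\<^sup>2) \<le> energy u1 u2 x1 x2)"
proof -
  define D where "D = DIM(('x, 'u) pencil) * DIM(('x, 'u) pencil)"
  obtain \<delta> C where \<delta>: "\<delta> \<noteq> 0" "degree \<delta> \<le> D" and C: "C > 0"
    and h: "\<And>\<omega> u1 u2 x1 x2. harmonic \<omega> u1 u2 x1 x2 \<Longrightarrow>
     (poly \<delta> \<omega>)\<^sup>2 * ((norm u1)\<^sup>2 + (norm u2)\<^sup>2) \<le> C * ((1 + \<bar>\<omega>\<bar>) ^ D)\<^sup>2 * energy u1 u2 x1 x2"
    using harmonic_energy_bound unfolding D_def by blast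
  have "degree \<delta> \<le> N" using \<delta> N by (simp add: D_def)
  from filter_coefficients_exist[OF \<delta>(1) this] obtain b c C' where bc: "\<And>i. b i = 0 \<and> c i = 1 \<or> b i = 1 \<and> (\<exists>a. c i = a\<^sup>2)"
    and C': "C' \<ge> 0" "\<And>w. (\<Prod>i<N. \<bar>c i - b i * w\<^sup>2\<bar> / (1 + w\<^sup>2)) * (1 + \<bar>w\<bar>) ^ N \<le> C' * \<bar>poly \<delta> w\<bar>" by blast
  \<comment> \<open>1 / E becomes \<kappa>; the summand 1 keeps E positive if C' = 0.\<close>
  define E where "E = C'\<^sup>2 * C + 1"
  have E: "E > 0" unfolding E_def using C by (intro add_nonneg_pos) auto
  have "1 / E * (\<Prod>i<N. \<bar>c i - b i * \<omega>\<^sup>2\<bar> / (1 + \<omega>\<^sup>2))\<^sup>2 * ((norm u1)\<^sup>2 + (norm u2)\<^sup>2) \<le> energy u1 u2 x1 x2"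
    if hm: "harmonic \<omega> u1 u2 x1 x2" for \<omega> u1 u2 x1 x2
  proof -
    define \<rho> where "\<rho> = (\<Prod>i<N. \<bar>c i - b i * \<omega>\<^sup>2\<bar> / (1 + \<omega>\<^sup>2))"
    define n where "n = (norm u1)\<^sup>2 + (norm u2)\<^sup>2"
    define k where "k = (1 + \<bar>\<omega>\<bar>) ^ N"
    have k: "k > 0" by (simp add: k_def)
    have \<rho>0: "\<rho> \<ge> 0" unfolding \<rho>_def by (intro prod_nonneg) auto
    have e0: "energy u1 u2 x1 x2 \<ge> 0" using fdi hm unfolding energy_def harmonic_def by blast
    have "(\<rho> * k)\<^sup>2 \<le> (C' * \<bar>poly \<delta> \<omega>\<bar>)\<^sup>2" using C'(2)[of \<omega>] \<rho>0 k by (intro power_mono) (auto simp: \<rho>_def k_def)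
    hence "(\<rho> * k)\<^sup>2 * n \<le> (C' * \<bar>poly \<delta> \<omega>\<bar>)\<^sup>2 * n" by (rule mult_right_mono) (simp add: n_def)
    also have "\<dots> = C'\<^sup>2 * ((poly \<delta> \<omega>)\<^sup>2 * n)" by (simp add: power_mult_distrib)
    also have "\<dots> \<le> C'\<^sup>2 * (C * ((1 + \<bar>\<omega>\<bar>) ^ D)\<^sup>2 * energy u1 u2 x1 x2)"
      using h[OF hm] by (intro mult_left_mono) (auto simp: n_def)
    also have "\<dots> \<le> C'\<^sup>2 * (C * k\<^sup>2 * energy u1 u2 x1 x2)"
      using e0 C N unfolding k_def by (intro mult_left_mono mult_right_mono power_mono power_increasing) (auto simp: D_def)
    also have "\<dots> \<le> E * (k\<^sup>2 * energy u1 u2 x1 x2)" using e0 by (simp add: E_def algebra_simps)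
    finally have "k\<^sup>2 * (\<rho>\<^sup>2 * n) \<le> k\<^sup>2 * (E * energy u1 u2 x1 x2)" by (simp add: power_mult_distrib mult_ac)
    hence "\<rho>\<^sup>2 * n \<le> E * energy u1 u2 x1 x2" using k by simp
    thus ?thesis using E by (simp add: \<rho>_def n_def field_simps)
  qed
  moreover have "1 / E > 0" using E by simp
  ultimately show ?thesis using bc by blast
qed

text \<open>The inequality at infinite frequency. Along \<omega> = 1, 2, 3, ... with a fixed real
  input the states are of order 1/\<omega>, so the energy tends to its value at state 0, and the
  i-th gain tends to |b i|.\<close>

lemma input_energy_bound:
  assumes bnd: "\<And>\<omega> u1 u2 x1 x2. harmonic \<omega> u1 u2 x1 x2 \<Longrightarrow>
      \<kappa> * (\<Prod>i<N. \<bar>c i - b i * \<omega>\<^sup>2\<bar> / (1 + \<omega>\<^sup>2))\<^sup>2 * ((norm u1)\<^sup>2 + (norm u2)\<^sup>2) \<le> energy u1 u2 x1 x2"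
  shows "\<kappa> * (norm ((\<Prod>j<N. b j) *\<^sub>R u))\<^sup>2 \<le> S (0, u) \<bullet> (0, u)"
proof -
  have "\<forall>n. \<exists>x1 x2. harmonic (real (Suc n)) u 0 x1 x2" using harmonic_exists by blast
  then obtain x1 x2 where h: "\<And>n. harmonic (real (Suc n)) u 0 (x1 n) (x2 n)" by metis
  obtain C where C: "C > 0" "\<And>\<omega> u1 u2 x1 x2. harmonic \<omega> u1 u2 x1 x2 \<Longrightarrow>
      (norm x1)\<^sup>2 + (norm x2)\<^sup>2 \<le> C * ((norm u1)\<^sup>2 + (norm u2)\<^sup>2)" using harmonic_bound by blast
  define k where "k = sqrt (C * (norm u)\<^sup>2)"
  have k: "norm (x1 n) \<le> k" "norm (x2 n) \<le> k" for n
  proof -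
    have "(norm (x1 n))\<^sup>2 + (norm (x2 n))\<^sup>2 \<le> C * (norm u)\<^sup>2" using C(2)[OF h[of n]] by simp
    moreover have "(norm (x1 n))\<^sup>2 \<ge> 0" "(norm (x2 n))\<^sup>2 \<ge> 0" by simp_all
    ultimately have "(norm (x1 n))\<^sup>2 \<le> C * (norm u)\<^sup>2" "(norm (x2 n))\<^sup>2 \<le> C * (norm u)\<^sup>2" by linarith+
    thus "norm (x1 n) \<le> k" "norm (x2 n) \<le> k" unfolding k_def by (auto intro!: real_le_rsqrt)
  qed
  obtain a where a: "a > 0" "\<And>x. norm (A x) \<le> a * norm x" using linear_bounded_pos[OF A] by blast
  define m where "m = a * k + norm (B u)"
  have ax: "norm (A (x1 n)) \<le> a * k" "norm (A (x2 n)) \<le> a * k" for n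
    using a k[of n] by (meson mult_left_mono less_imp_le order_trans)+
  have l2: "norm (x2 n) \<le> m / real (Suc n)" for n
  proof -
    have "A (x1 n) + B u = - (real (Suc n) *\<^sub>R x2 n)" using h[of n] by (simp only: harmonic_def scaleR_minus_left)
    hence "norm (real (Suc n) *\<^sub>R x2 n) = norm (A (x1 n) + B u)" by (simp only: norm_minus_cancel)
    hence "norm (real (Suc n) *\<^sub>R x2 n) \<le> m" using norm_triangle_ineq[of "A (x1 n)" "B u"] ax[of n] unfolding m_def by linarith
    thus ?thesis unfolding norm_scaleR by (simp add: pos_le_divide_eq mult.commute del: of_nat_Suc)
  qed
  have l1: "norm (x1 n) \<le> m / real (Suc n)" for n
  proof -
    have "real (Suc n) *\<^sub>R x1 n = A (x2 n)" using h[of n] by (simp add: harmonic_def linear_0[OF B])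
    hence "norm (real (Suc n) *\<^sub>R x1 n) = norm (A (x2 n))" by (simp only:)
    hence "norm (real (Suc n) *\<^sub>R x1 n) \<le> m" using ax[of n] norm_ge_zero[of "B u"] unfolding m_def by linarith
    thus ?thesis unfolding norm_scaleR by (simp add: pos_le_divide_eq mult.commute del: of_nat_Suc)
  qed
  have m0: "(\<lambda>n. m / real (Suc n)) \<longlonglongrightarrow> 0" by (intro real_tendsto_divide_at_top[OF tendsto_const] filterlim_compose[OF filterlim_real_sequentially filterlim_Suc])
  have x1: "x1 \<longlonglongrightarrow> 0" by (rule Lim_null_comparison[OF always_eventually[OF allI[OF l1]] m0])
  have x2: "x2 \<longlonglongrightarrow> 0" by (rule Lim_null_comparison[OF always_eventually[OF allI[OF l2]] m0])
  have cS: "isCont S z" for z using S by (simp add: linear_continuous_at linear_conv_bounded_linear)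
  have S1: "(\<lambda>n. S (x1 n, u)) \<longlonglongrightarrow> S (0, u)" by (rule isCont_tendsto_compose[OF cS tendsto_Pair[OF x1 tendsto_const]])
  have S2: "(\<lambda>n. S (x2 n, 0)) \<longlonglongrightarrow> S (0, 0)" by (rule isCont_tendsto_compose[OF cS tendsto_Pair[OF x2 tendsto_const]])
  have "(\<lambda>n. energy u 0 (x1 n) (x2 n)) \<longlonglongrightarrow> S (0, u) \<bullet> (0, u) + S (0, 0) \<bullet> (0, 0)"
    unfolding energy_def by (intro tendsto_add tendsto_inner S1 S2 tendsto_Pair x1 x2 tendsto_const)
  hence lim1: "(\<lambda>n. energy u 0 (x1 n) (x2 n)) \<longlonglongrightarrow> S (0, u) \<bullet> (0, u)" by (simp add: zero_prod_def[symmetric])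
  have fac: "(\<lambda>n. \<bar>c i - b i * (real (Suc n))\<^sup>2\<bar> / (1 + (real (Suc n))\<^sup>2)) \<longlonglongrightarrow> \<bar>b i\<bar>" for i
  proof -
    have s: "filterlim (\<lambda>n. (real (Suc n))\<^sup>2) at_top sequentially"
      by (intro filterlim_pow_at_top filterlim_compose[OF filterlim_real_sequentially filterlim_Suc]) simp
    have "filterlim (\<lambda>n. 1 + (real (Suc n))\<^sup>2) at_top sequentially" by (rule filterlim_tendsto_add_at_top[OF tendsto_const s])
    from real_tendsto_divide_at_top[OF tendsto_const[of "c i + b i"] this]
    have "(\<lambda>n. (c i + b i) / (1 + (real (Suc n))\<^sup>2) - b i) \<longlonglongrightarrow> 0 - b i" by (intro tendsto_diff tendsto_const)
    from tendsto_rabs[OF this] have "(\<lambda>n. \<bar>(c i + b i) / (1 + (real (Suc n))\<^sup>2) - b i\<bar>) \<longlonglongrightarrow> \<bar>b i\<bar>" by simp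
    moreover have "\<bar>(c i + b i) / (1 + w\<^sup>2) - b i\<bar> = \<bar>c i - b i * w\<^sup>2\<bar> / (1 + w\<^sup>2)" for w :: real
    proof -
      have pos: "1 + w\<^sup>2 > 0" by (simp add: add_pos_nonneg)
      hence "(c i + b i) / (1 + w\<^sup>2) - b i = (c i - b i * w\<^sup>2) / (1 + w\<^sup>2)" by (simp add: field_simps)
      thus ?thesis using pos by simp
    qed
    ultimately show ?thesis by simp
  qed
  have "(\<lambda>n. \<kappa> * (\<Prod>i<N. \<bar>c i - b i * (real (Suc n))\<^sup>2\<bar> / (1 + (real (Suc n))\<^sup>2))\<^sup>2 * ((norm u)\<^sup>2 + (norm (0::'u))\<^sup>2))
     \<longlonglongrightarrow> \<kappa> * (\<Prod>i<N. \<bar>b i\<bar>)\<^sup>2 * ((norm u)\<^sup>2 + (norm (0::'u))\<^sup>2)"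
    by (intro tendsto_mult tendsto_power tendsto_prod fac tendsto_const)
  from tendsto_le[OF sequentially_bot lim1 this]
  have "\<kappa> * (\<Prod>i<N. \<bar>b i\<bar>)\<^sup>2 * ((norm u)\<^sup>2 + (norm (0::'u))\<^sup>2) \<le> S (0, u) \<bullet> (0, u)" using bnd[OF h] by simp
  thus ?thesis by (simp add: power_mult_distrib abs_prod[symmetric] mult_ac)
qed

text \<open>The low-pass states of all filters are adjoined to the state, and \<kappa> times the
  squared cascade output is subtracted from the cost. The modified cost satisfies the frequency
  inequality by \<open>filter_bound\<close> and its limit at infinity by
  \<open>input_energy_bound\<close>, so \<open>quadratic_integral_nonneg\<close> applies. The type
  'e numbers the filters, which makes their states vectors.\<close>

lemma filtered_energy_bound:
  assumes "DIM(('x, 'u) pencil) * DIM(('x, 'u) pencil) \<le> CARD('e::finite)"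
  shows "\<exists>b c \<kappa>. (\<forall>i. b i = 0 \<and> c i = 1 \<or> b i = 1 \<and> (\<exists>a. c i = a\<^sup>2)) \<and> \<kappa> > 0 \<and>
    (\<forall>x v. primitive x (\<lambda>t. A (x t) + B (v t)) 0 \<longrightarrow> square_integrable v \<longrightarrow>
       \<kappa> * (\<integral>t. (norm (filtered b c v CARD('e) t))\<^sup>2 \<partial>half_line) \<le> (\<integral>t. S (x t, v t) \<bullet> (x t, v t) \<partial>half_line))"
proof -
  define N where "N = CARD('e)"
  obtain b c \<kappa> where bc: "\<And>i. b i = 0 \<and> c i = 1 \<or> b i = 1 \<and> (\<exists>a. c i = a\<^sup>2)" and \<kappa>: "\<kappa> > 0"
    and bnd: "\<And>\<omega> u1 u2 x1 x2. harmonic \<omega> u1 u2 x1 x2 \<Longrightarrow>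
      \<kappa> * (\<Prod>i<N. \<bar>c i - b i * \<omega>\<^sup>2\<bar> / (1 + \<omega>\<^sup>2))\<^sup>2 * ((norm u1)\<^sup>2 + (norm u2)\<^sup>2) \<le> energy u1 u2 x1 x2"
    using filter_bound[OF assms] unfolding N_def by blast
  obtain idx :: "nat \<Rightarrow> 'e" where idx: "bij_betw idx {0..<N} UNIV"
    using ex_bij_betw_nat_finite[of "UNIV :: 'e set"] by (auto simp: N_def)
  define jdx where "jdx = inv_into {0..<N} idx"
  have ij: "idx (jdx j) = j" "jdx j < N" for j
    using idx bij_betw_inv_into_right[OF idx] bij_betwE[OF bij_betw_inv_into[OF idx]] by (auto simp: jdx_def)
  have ji: "jdx (idx i) = i" if "i < N" for i
    using bij_betw_inv_into_left[OF idx] that by (auto simp: jdx_def)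
  define Y where "Y z = cascade b c idx N (snd (fst z)) (snd z)" for z :: "('x \<times> ('u^'e) \<times> ('u^'e)) \<times> 'u"
  define F where "F z = (A (fst (fst z)) + B (snd z),
      (\<chi> j. cascade b c idx (jdx j) (snd (fst z)) (snd z) - fst (snd (fst z)) $ j),
      (\<chi> j. fst (snd (fst z)) $ j - snd (snd (fst z)) $ j))" for z :: "('x \<times> ('u^'e) \<times> ('u^'e)) \<times> 'u"
  define pr where "pr z = (fst (fst z), snd z)" for z :: "('x \<times> ('u^'e) \<times> ('u^'e)) \<times> 'u"
  have lY: "linear Y" unfolding Y_def by (rule linearI) (simp_all add: cascade_add cascade_scale)
  have lF: "linear F" unfolding F_def
    by (rule linearI) (simp_all add: cascade_add cascade_scale linear_add[OF A] linear_add[OF B] linear_scale[OF A]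
       linear_scale[OF B] vec_eq_iff algebra_simps)
  have lpr: "linear pr" unfolding pr_def by (rule linearI) simp_all
  define T where "T z = adjoint pr (S (pr z)) - \<kappa> *\<^sub>R adjoint Y (Y z)" for z
  have T: "T z \<bullet> z' = S (pr z) \<bullet> pr z' - \<kappa> * (Y z \<bullet> Y z')" for z z'
    using adjoint_works[OF lpr, of z' "S (pr z)"] adjoint_works[OF lY, of z' "Y z"]
    unfolding T_def inner_diff_left inner_scaleR_left by (simp add: inner_commute)
  have lT: "linear T" unfolding T_def
    by (intro linear_compose_sub linear_compose_scale_right linear_compose[OF linear_compose[OF lpr S] adjoint_linear[OF lpr], unfolded o_def]
       linear_compose[OF lY adjoint_linear[OF lY], unfolded o_def])
  have sT: "T z \<bullet> z' = z \<bullet> T z'" for z z'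
    using T[of z z'] T[of z' z] S_sym[of "pr z" "pr z'"] by (simp add: inner_commute)
  have fin: "T z1 \<bullet> z1 + T z2 \<bullet> z2 \<ge> 0" if z: "F z1 = - \<omega> *\<^sub>R fst z2" "F z2 = \<omega> *\<^sub>R fst z1" for \<omega> z1 z2
  proof -
    have h: "harmonic \<omega> (snd z1) (snd z2) (fst (fst z1)) (fst (fst z2))"
      using arg_cong[OF z(1), of fst] arg_cong[OF z(2), of fst] by (simp add: F_def harmonic_def)
    have "cascade b c idx i (snd (fst z1)) (snd z1) - fst (snd (fst z1)) $ idx i = - \<omega> *\<^sub>R (fst (snd (fst z2)) $ idx i)"
      "cascade b c idx i (snd (fst z2)) (snd z2) - fst (snd (fst z2)) $ idx i = \<omega> *\<^sub>R (fst (snd (fst z1)) $ idx i)"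
      "fst (snd (fst z1)) $ idx i - snd (snd (fst z1)) $ idx i = - \<omega> *\<^sub>R (snd (snd (fst z2)) $ idx i)"
      "fst (snd (fst z2)) $ idx i - snd (snd (fst z2)) $ idx i = \<omega> *\<^sub>R (snd (snd (fst z1)) $ idx i)" if "i < N" for i
      using arg_cong[OF z(1), of "\<lambda>s. fst (snd s) $ idx i"] arg_cong[OF z(2), of "\<lambda>s. fst (snd s) $ idx i"]
        arg_cong[OF z(1), of "\<lambda>s. snd (snd s) $ idx i"] arg_cong[OF z(2), of "\<lambda>s. snd (snd s) $ idx i"] ji[OF that]
      by (simp_all add: F_def)
    from cascade_gain[OF this order_refl] have "(norm (Y z1))\<^sup>2 + (norm (Y z2))\<^sup>2
       = (\<Prod>j<N. \<bar>c j - b j * \<omega>\<^sup>2\<bar> / (1 + \<omega>\<^sup>2))\<^sup>2 * ((norm (snd z1))\<^sup>2 + (norm (snd z2))\<^sup>2)" by (simp add: Y_def)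
    with bnd[OF h] have "\<kappa> * ((norm (Y z1))\<^sup>2 + (norm (Y z2))\<^sup>2) \<le> energy (snd z1) (snd z2) (fst (fst z1)) (fst (fst z2))"
      by (simp add: mult.assoc)
    thus ?thesis by (simp add: T pr_def energy_def power2_norm_eq_inner distrib_left)
  qed
  have inf: "T (0, u) \<bullet> (0, u) \<ge> 0" for u
  proof -
    have Yu: "(\<Prod>j<N. b j) *\<^sub>R u = Y (0, u)" using cascade_zero_state[of b c idx N u] by (simp add: Y_def)
    from input_energy_bound[OF bnd, of u] show ?thesis unfolding Yu by (simp add: T pr_def power2_norm_eq_inner)
  qed
  have "\<kappa> * (\<integral>t. (norm (filtered b c v N t))\<^sup>2 \<partial>half_line) \<le> (\<integral>t. S (x t, v t) \<bullet> (x t, v t) \<partial>half_line)"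
    if x: "primitive x (\<lambda>t. A (x t) + B (v t)) 0" and v: "square_integrable v" for x v
  proof -
    note sBv = square_integrable_linear[OF v B]
    note sx = solution_square_integrable(1)[OF x sBv]
    define p where "p j = lowpass (filtered b c v (jdx j))" for j
    define q where "q j = lowpass (p j)" for j
    note sf = square_integrable_filtered[OF v, of b c]
    have sp: "square_integrable (p j)" and sq: "square_integrable (q j)" for j
      unfolding p_def q_def by (intro lowpass(2) sf)+
    define X where "X t = (x t, (\<chi> j. p j t), (\<chi> j. q j t))" for t
    have casc: "cascade b c idx i (snd (X t)) (v t) = filtered b c v i t" if "i \<le> N" for i t
      using that
    proof (induction i)
      case (Suc i)
      thus ?case using ji[of i] by (simp add: X_def bandstop_def p_def q_def)
    qed simp
    have pp: "primitive (p j) (\<lambda>t. filtered b c v (jdx j) t - p j t) 0" and pq: "primitive (q j) (\<lambda>t. p j t - q j t) 0" for j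
      unfolding q_def using lowpass(1)[OF sf] lowpass(1)[OF sp] by (simp_all add: p_def)
    have "primitive X (\<lambda>t. (A (x t) + B (v t), (\<chi> j. filtered b c v (jdx j) t - p j t), (\<chi> j. p j t - q j t))) (0, (\<chi> j. 0), (\<chi> j. 0))"
      unfolding X_def by (intro primitive_Pair primitive_vec x pp pq)
    moreover have "(A (x t) + B (v t), (\<chi> j. filtered b c v (jdx j) t - p j t), (\<chi> j. p j t - q j t)) = F (X t, v t)" for t
      using casc[of "jdx _" t] ij(2) by (simp add: F_def X_def less_imp_le)
    moreover have "(0, (\<chi> j. 0), (\<chi> j. 0)) = (0 :: 'x \<times> ('u^'e) \<times> ('u^'e))" by (simp add: zero_prod_def vec_eq_iff)
    ultimately have X: "primitive X (\<lambda>t. F (X t, v t)) 0" by simp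
    have sX: "square_integrable X" unfolding X_def by (intro square_integrable_Pair square_integrable_vec sx sp sq)
    have "(\<integral>t. T (X t, v t) \<bullet> (X t, v t) \<partial>half_line) \<ge> 0"
      by (rule quadratic_integral_nonneg[OF lF lT sT fin inf X sX v])
    also have "(\<integral>t. T (X t, v t) \<bullet> (X t, v t) \<partial>half_line) =
        (\<integral>t. S (x t, v t) \<bullet> (x t, v t) - \<kappa> * (filtered b c v N t \<bullet> filtered b c v N t) \<partial>half_line)"
      using casc[of N] by (simp add: T Y_def pr_def X_def)
    also have "\<dots> = (\<integral>t. S (x t, v t) \<bullet> (x t, v t) \<partial>half_line) - \<kappa> * (\<integral>t. filtered b c v N t \<bullet> filtered b c v N t \<partial>half_line)"
      using square_integrable_inner[OF square_integrable_linear[OF square_integrable_Pair[OF sx v] S] square_integrable_Pair[OF sx v]]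
        square_integrable_inner[OF sf sf] by simp
    finally show ?thesis by (simp add: power2_norm_eq_inner)
  qed
  thus ?thesis using bc \<kappa> unfolding N_def by blast
qed

corollary energy_nonneg:
  assumes card: "DIM(('x, 'u) pencil) * DIM(('x, 'u) pencil) \<le> CARD('e::finite)"
    and "primitive x (\<lambda>t. A (x t) + B (v t)) 0" "square_integrable v"
  shows "0 \<le> (\<integral>t. S (x t, v t) \<bullet> (x t, v t) \<partial>half_line)"
proof -
  obtain b c \<kappa> where "\<kappa> > 0"
    "\<kappa> * (\<integral>t. (norm (filtered b c v CARD('e) t))\<^sup>2 \<partial>half_line) \<le> (\<integral>t. S (x t, v t) \<bullet> (x t, v t) \<partial>half_line)"
    using filtered_energy_bound[OF card] assms(2,3) by blast
  moreover have "0 \<le> (\<integral>t. (norm (filtered b c v CARD('e) t))\<^sup>2 \<partial>half_line)"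
    by (rule Bochner_Integration.integral_nonneg) simp
  ultimately show ?thesis by (meson less_imp_le mult_nonneg_nonneg order_trans)
qed

section \<open>The term linear in the input for nonzero initial state\<close>

lemma flow_square_integrable:
  "primitive (\<lambda>t. flow A t c) (\<lambda>t. A (flow A t c)) c" "square_integrable (\<lambda>t. flow A t c)" "((\<lambda>t. flow A t c) \<longlongrightarrow> 0) at_top"
proof -
  have d: "((\<lambda>t. flow A t c) has_vector_derivative A (flow A t c)) (at t within T)" for t T
    by (rule flow_derivative[OF A])
  have "continuous_on {0..} (\<lambda>t. flow A t c)"
    unfolding continuous_on_eq_continuous_within by (intro ballI has_vector_derivative_continuous[OF d])
  hence "continuous_on {0..} (\<lambda>t. A (flow A t c))" by (rule linear_continuous_on_compose[OF _ A])
  from primitive_of_derivative[OF d this] show p: "primitive (\<lambda>t. flow A t c) (\<lambda>t. A (flow A t c)) c" by simp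
  hence p': "primitive (\<lambda>t. flow A t c) (\<lambda>t. A (flow A t c) + 0) c" by simp
  show "square_integrable (\<lambda>t. flow A t c)" "((\<lambda>t. flow A t c) \<longlongrightarrow> 0) at_top"
    by (rule solution_square_integrable(1)[OF p' square_integrable_zero], rule solution_square_integrable(3)[OF p' square_integrable_zero])
qed

text \<open>Pairing with an exponential solution: the adjoint of a filter acts on such functionals by
  replacing s with -A, which is invertible at imaginary zeros of the filter.\<close>

definition pairing :: "('x \<Rightarrow> 'u) \<Rightarrow> 'x \<Rightarrow> (real \<Rightarrow> 'u) \<Rightarrow> real" where
  "pairing L c f = (\<integral>t. L (flow A t c) \<bullet> f t \<partial>half_line)"

lemma pairing_integrable:
  "linear L \<Longrightarrow> square_integrable f \<Longrightarrow> integrable half_line (\<lambda>t. L (flow A t c) \<bullet> f t)"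
  by (intro square_integrable_inner square_integrable_linear[OF flow_square_integrable(2)])

lemma pairing_linear:
  assumes L: "linear L" and f: "square_integrable f" and g: "square_integrable g"
  shows "pairing L (c + d) f = pairing L c f + pairing L d f" "pairing L (r *\<^sub>R c) f = r * pairing L c f"
    "pairing L c (\<lambda>t. f t + g t) = pairing L c f + pairing L c g" "pairing L c (\<lambda>t. r *\<^sub>R f t) = r * pairing L c f"
  using pairing_integrable[OF L f] pairing_integrable[OF L g]
  by (simp_all add: pairing_def linear_add[OF flow_linear] linear_scale[OF flow_linear] linear_add[OF L] linear_scale[OF L]
      inner_add_left inner_add_right)

text \<open>Insert y = p' + p for p = \<open>lowpass y\<close> and integrate by parts: the
  derivative moves to the exponential and becomes - A. The boundary terms vanish because p(0) = 0
  and both factors decay.\<close>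

lemma pairing_lowpass:
  assumes L: "linear L" and y: "square_integrable y"
  shows "pairing L c y = pairing L (c - A c) (lowpass y)"
proof -
  note p = lowpass[OF y]
  note fl = flow_square_integrable[of c]
  have sd: "square_integrable (\<lambda>t. y t - lowpass y t)" by (intro square_integrable_diff y p(2))
  note sLf = square_integrable_linear[OF fl(2) L]
  note sLAf = square_integrable_linear[OF square_integrable_linear[OF fl(2) A] L]
  note pL = primitive_linear[OF fl(1) L]
  have "(\<integral>t. L (A (flow A t c)) \<bullet> lowpass y t \<partial>half_line) + (\<integral>t. L (flow A t c) \<bullet> (y t - lowpass y t) \<partial>half_line) = - (L c \<bullet> 0)"
    by (rule ibp_half_line[OF pL p(1) sLf sLAf p(2) sd square_integrable_vanishing[OF pL sLf sLAf] square_integrable_vanishing[OF p sd]])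
  moreover have "(\<integral>t. L (flow A t c) \<bullet> (y t - lowpass y t) \<partial>half_line) = pairing L c y - pairing L c (lowpass y)"
    using pairing_integrable[OF L y] pairing_integrable[OF L p(2)] by (simp add: pairing_def inner_diff_right)
  moreover have "(\<integral>t. L (A (flow A t c)) \<bullet> lowpass y t \<partial>half_line) = pairing L (A c) (lowpass y)"
    by (simp add: pairing_def flow_commute[OF A])
  moreover have "pairing L (c - A c) (lowpass y) = pairing L c (lowpass y) - pairing L (A c) (lowpass y)"
    using pairing_linear(1)[OF L p(2) p(2), of "c - A c" "A c"] by simp
  ultimately show ?thesis by simp
qed

text \<open>A kernel vector of A^2 + a^2 I would produce an eigenvalue i a or - i a of A, which
  \<open>harmonic_zero\<close> excludes. This is what makes filters with zeros on the imaginary axis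
  admissible.\<close>

lemma bandstop_adjoint_surj:
  assumes bc: "b = 0 \<and> c = 1 \<or> b = 1 \<and> (\<exists>a. c = a\<^sup>2)"
  obtains d where "b *\<^sub>R A (A d) + c *\<^sub>R d = e"
proof -
  define f where "f d = b *\<^sub>R A (A d) + c *\<^sub>R d" for d
  have lf: "linear f" unfolding f_def
    by (rule linearI) (simp_all add: linear_add[OF A] linear_scale[OF A] algebra_simps)
  have "inj f"
  proof (subst linear_injective_0[OF lf], intro allI impI)
    fix d assume f0: "f d = 0"
    show "d = 0"
    proof (cases "b = 0")
      case True
      thus ?thesis using f0 bc by (auto simp: f_def)
    next
      case False
      then obtain a where a: "b = 1" "c = a\<^sup>2" using bc by auto
      have AA: "A (A d) = - (a\<^sup>2) *\<^sub>R d" using f0 by (simp add: f_def a eq_neg_iff_add_eq_0)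
      show ?thesis
      proof (cases "a = 0")
        case True
        hence "A d = 0" using harmonic_zero(1)[of "A d" 0 0] AA by (simp add: linear_0[OF A])
        thus ?thesis using harmonic_zero(1)[of d 0 0] by (simp add: linear_0[OF A])
      next
        case False
        \<comment> \<open>d and - A d / a are real and imaginary part of an eigenvector for i
          a.\<close>
        have "A d = - a *\<^sub>R (- (1 / a) *\<^sub>R A d)" "A (- (1 / a) *\<^sub>R A d) = a *\<^sub>R d"
          using False by (simp_all only: linear_scale[OF A] AA) (simp_all add: power2_eq_square)
        thus ?thesis by (rule harmonic_zero(1))
      qed
    qed
  qed
  hence "surj f" by (rule eucl.linear_inj_imp_surj[OF lf])
  then obtain d where "f d = e" by (metis surjD)
  thus thesis using that by (simp add: f_def)
qed

text \<open>On initial vectors the adjoint of the filter acts as (b A^2 + c I)(I - A)^(-2). So if (b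
  A^2 + c I) d = e, then (I - A)^2 d pairs with the filtered signal as e pairs with the
  signal.\<close>

lemma pairing_bandstop:
  assumes L: "linear L" and bc: "b = 0 \<and> c = 1 \<or> b = 1 \<and> (\<exists>a. c = a\<^sup>2)"
  shows "\<exists>e'. \<forall>y. square_integrable y \<longrightarrow> pairing L e y = pairing L e' (bandstop b c y)"
proof -
  obtain d where d: "b *\<^sub>R A (A d) + c *\<^sub>R d = e" using bandstop_adjoint_surj[OF bc] by blast
  define d1 where "d1 = d - A d"
  define d2 where "d2 = d1 - A d1"
  have "pairing L e y = pairing L d2 (bandstop b c y)" if y: "square_integrable y" for y
  proof -
    define p q where "p = lowpass y" and "q = lowpass p"
    have sp: "square_integrable p" and sq: "square_integrable q" unfolding p_def q_def using y by (auto intro: lowpass(2))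
    have two: "(b * 2) *\<^sub>R z = b *\<^sub>R z + b *\<^sub>R z" for z :: 'u by (simp only: mult_2_right scaleR_left_distrib)
    have two': "(b * 2) *\<^sub>R z = b *\<^sub>R z + b *\<^sub>R z" for z :: 'x by (simp only: mult_2_right scaleR_left_distrib)
    have 1: "pairing L d2 q = pairing L d y" "pairing L d2 p = pairing L d1 y"
      using pairing_lowpass[OF L sp, of d1] pairing_lowpass[OF L y] by (simp_all add: d1_def d2_def p_def q_def)
    have "bandstop b c y = (\<lambda>t. (b *\<^sub>R y t + (- b - b) *\<^sub>R p t) + (b + c) *\<^sub>R q t)"
      by (simp add: fun_eq_iff bandstop_def p_def q_def algebra_simps two)
    hence "pairing L d2 (bandstop b c y) = b * pairing L d2 y + (- b - b) * pairing L d2 p + (b + c) * pairing L d2 q"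
      using pairing_integrable[OF L y, of d2] pairing_integrable[OF L sp, of d2] pairing_integrable[OF L sq, of d2]
      by (simp add: pairing_def inner_add_right inner_diff_right)
    also have "\<dots> = pairing L (b *\<^sub>R d2 + (- b - b) *\<^sub>R d1 + (b + c) *\<^sub>R d) y"
      unfolding 1 by (simp only: pairing_linear(1,2)[OF L y y])
    also have "b *\<^sub>R d2 + (- b - b) *\<^sub>R d1 + (b + c) *\<^sub>R d = e"
      unfolding d[symmetric] d2_def d1_def by (simp add: linear_diff[OF A] algebra_simps two')
    finally show ?thesis by simp
  qed
  thus ?thesis by blast
qed

lemma pairing_filtered:
  assumes L: "linear L" and bc: "\<And>i. b i = 0 \<and> c i = 1 \<or> b i = 1 \<and> (\<exists>a. c i = a\<^sup>2)"
  shows "\<exists>e'. \<forall>v. square_integrable v \<longrightarrow> pairing L e v = pairing L e' (filtered b c v n)"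
proof (induction n)
  case (Suc n)
  then obtain e1 where e1: "\<And>v. square_integrable v \<Longrightarrow> pairing L e v = pairing L e1 (filtered b c v n)" by blast
  obtain e2 where "\<And>y. square_integrable y \<Longrightarrow> pairing L e1 y = pairing L e2 (bandstop (b n) (c n) y)"
    using pairing_bandstop[OF L bc] by blast
  hence "pairing L e v = pairing L e2 (filtered b c v (Suc n))" if "square_integrable v" for v
    using e1[OF that] square_integrable_filtered[OF that] by simp
  thus ?case by blast
qed auto

text \<open>Split off the free response f. What remains is a zero-state cost, at least \<kappa>
  |w|^2 for the filtered input w, and a term linear in v. The latter pairs v with an exponential,
  hence equals 2 (h, w) for a fixed h. Completing the square bounds the sum from below by - |h|^2 /
  \<kappa>, independently of v.\<close>

theorem energy_bounded_below:
  assumes card: "DIM(('x, 'u) pencil) * DIM(('x, 'u) pencil) \<le> CARD('e::finite)"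
  shows "\<exists>C. \<forall>x v. primitive x (\<lambda>t. A (x t) + B (v t)) a \<longrightarrow> square_integrable v \<longrightarrow>
     C \<le> (\<integral>t. S (x t, v t) \<bullet> (x t, v t) \<partial>half_line)"
proof -
  obtain b c \<kappa> where bc: "\<And>i. b i = 0 \<and> c i = 1 \<or> b i = 1 \<and> (\<exists>a. c i = a\<^sup>2)" and \<kappa>: "\<kappa> > 0"
    and bnd: "\<And>x v. primitive x (\<lambda>t. A (x t) + B (v t)) 0 \<Longrightarrow> square_integrable v \<Longrightarrow>
       \<kappa> * (\<integral>t. (norm (filtered b c v CARD('e) t))\<^sup>2 \<partial>half_line) \<le> (\<integral>t. S (x t, v t) \<bullet> (x t, v t) \<partial>half_line)"
    using filtered_energy_bound[OF card] by blast
  \<comment> \<open>For the zero-state response x0 the derivative of f . M x0 is L f . v - S (f, 0)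
    . (x0, v). It integrates to 0, so the cross term is a functional of v alone.\<close>
  define L where "L y = B' (adjoint M y) + snd (S (y, 0))" for y
  have lS0: "linear (\<lambda>y. S (y, 0))" using linear_compose[OF _ S, of "\<lambda>y. (y, 0)"] by (simp add: o_def linear_iff)
  have lL: "linear L" unfolding L_def
    by (intro linear_compose_add linear_compose[OF adjoint_linear[OF M] adj(2), unfolded o_def]
        linear_compose[OF lS0 linear_snd, unfolded o_def])
  obtain a' where a': "\<And>v. square_integrable v \<Longrightarrow> pairing L a v = pairing L a' (filtered b c v CARD('e))"
    using pairing_filtered[where b = b and c = c and n = "CARD('e)", OF lL bc, of a] by blast
  define f where "f t = flow A t a" for t
  define h where "h t = L (flow A t a')" for t
  note fl = flow_square_integrable[of a, folded f_def]
  have sh: "square_integrable h" unfolding h_def by (rule square_integrable_linear[OF flow_square_integrable(2) lL])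
  define C where "C = (\<integral>t. S (f t, 0) \<bullet> (f t, 0) \<partial>half_line) - 1 / \<kappa> * (\<integral>t. h t \<bullet> h t \<partial>half_line)"
  have "C \<le> (\<integral>t. S (x t, v t) \<bullet> (x t, v t) \<partial>half_line)"
    if x: "primitive x (\<lambda>t. A (x t) + B (v t)) a" and v: "square_integrable v" for x v
  proof -
    define x0 where "x0 t = x t - f t" for t
    have "linear (\<lambda>y::'x. - y)" by (simp add: linear_iff)
    from primitive_add[OF x primitive_linear[OF fl(1) this]]
    have x0: "primitive x0 (\<lambda>t. A (x0 t) + B (v t)) 0"
      by (simp add: x0_def[abs_def] linear_diff[OF A] algebra_simps)
    note sBv = square_integrable_linear[OF v B]
    note s0 = solution_square_integrable[OF x0 sBv]
    define w where "w = filtered b c v CARD('e)"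
    have sw: "square_integrable w" unfolding w_def by (rule square_integrable_filtered[OF v])
    have sS0: "square_integrable (\<lambda>t. S (f t, 0))" by (rule square_integrable_linear[OF fl(2) lS0])
    have sz: "square_integrable (\<lambda>t. (x0 t, v t))" by (rule square_integrable_Pair[OF s0(1) v])
    have sf0: "square_integrable (\<lambda>t. (f t, 0::'u))" by (rule square_integrable_Pair[OF fl(2) square_integrable_zero])
    have cross: "(\<integral>t. S (f t, 0) \<bullet> (x0 t, v t) \<partial>half_line) = pairing L a v"
    proof -
      note pM = primitive_linear[OF x0 M]
      note sM = square_integrable_linear[OF s0(1) M] square_integrable_linear[OF s0(2) M]
      have "(\<integral>t. A (f t) \<bullet> M (x0 t) \<partial>half_line) + (\<integral>t. f t \<bullet> M (A (x0 t) + B (v t)) \<partial>half_line) = - (a \<bullet> M 0)"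
        by (rule ibp_half_line[OF fl(1) pM fl(2) square_integrable_linear[OF fl(2) A] sM fl(3) square_integrable_vanishing[OF pM sM]])
      hence "(\<integral>t. A (f t) \<bullet> M (x0 t) + f t \<bullet> M (A (x0 t) + B (v t)) \<partial>half_line) = 0"
        using square_integrable_inner[OF square_integrable_linear[OF fl(2) A] sM(1)] square_integrable_inner[OF fl(2) sM(2)]
        by (simp add: linear_0[OF M])
      moreover have "A (f t) \<bullet> M (x0 t) + f t \<bullet> M (A (x0 t) + B (v t)) = L (f t) \<bullet> v t - S (f t, 0) \<bullet> (x0 t, v t)" for t
        using sylvester[of "f t" "x0 t"] adjoint_works[OF M, of "B (v t)" "f t"] adj(4)[of "v t" "adjoint M (f t)"]
        by (simp add: linear_add[OF M] L_def inner_prod_def inner_add_left inner_add_right inner_commute)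
      ultimately have "(\<integral>t. L (f t) \<bullet> v t - S (f t, 0) \<bullet> (x0 t, v t) \<partial>half_line) = 0" by simp
      thus ?thesis using pairing_integrable[OF lL v, of a] square_integrable_inner[OF sS0 sz]
        by (simp add: pairing_def f_def)
    qed
    have expand: "S (x t, v t) \<bullet> (x t, v t) = S (x0 t, v t) \<bullet> (x0 t, v t) + (2 * (S (f t, 0) \<bullet> (x0 t, v t)) + S (f t, 0) \<bullet> (f t, 0))" for t
    proof -
      have e: "(x t, v t) = (x0 t, v t) + (f t, 0)" by (simp add: x0_def)
      show ?thesis unfolding e linear_add[OF S] inner_add_left inner_add_right using S_sym[of "(x0 t, v t)" "(f t, 0)"]
        by (simp add: inner_commute)
    qed
    have i: "integrable half_line (\<lambda>t. S (x0 t, v t) \<bullet> (x0 t, v t))" "integrable half_line (\<lambda>t. S (f t, 0) \<bullet> (x0 t, v t))"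
      "integrable half_line (\<lambda>t. S (f t, 0) \<bullet> (f t, 0))"
      by (intro square_integrable_inner square_integrable_linear[OF sz S] sz sS0 sf0)+
    have "(\<integral>t. S (x t, v t) \<bullet> (x t, v t) \<partial>half_line) = (\<integral>t. S (x0 t, v t) \<bullet> (x0 t, v t) \<partial>half_line)
       + (2 * (\<integral>t. S (f t, 0) \<bullet> (x0 t, v t) \<partial>half_line) + (\<integral>t. S (f t, 0) \<bullet> (f t, 0) \<partial>half_line))"
      unfolding expand using i by simp
    also have "(\<integral>t. S (f t, 0) \<bullet> (x0 t, v t) \<partial>half_line) = (\<integral>t. h t \<bullet> w t \<partial>half_line)"
      unfolding cross a'[OF v] by (simp add: pairing_def h_def w_def)
    finally have total: "(\<integral>t. S (x t, v t) \<bullet> (x t, v t) \<partial>half_line) = (\<integral>t. S (x0 t, v t) \<bullet> (x0 t, v t) \<partial>half_line)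
       + (2 * (\<integral>t. h t \<bullet> w t \<partial>half_line) + (\<integral>t. S (f t, 0) \<bullet> (f t, 0) \<partial>half_line))" .
    have b0: "\<kappa> * (\<integral>t. w t \<bullet> w t \<partial>half_line) \<le> (\<integral>t. S (x0 t, v t) \<bullet> (x0 t, v t) \<partial>half_line)"
      using bnd[OF x0 v] by (simp add: w_def power2_norm_eq_inner)
    have j: "integrable half_line (\<lambda>t. w t \<bullet> w t)" "integrable half_line (\<lambda>t. h t \<bullet> w t)" "integrable half_line (\<lambda>t. h t \<bullet> h t)"
      by (intro square_integrable_inner sw sh)+
    have "0 \<le> (\<integral>t. \<kappa> * (w t \<bullet> w t) + (2 * (h t \<bullet> w t) + 1 / \<kappa> * (h t \<bullet> h t)) \<partial>half_line)"
    proof (rule Bochner_Integration.integral_nonneg)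
      fix t
      have "0 \<le> 1 / \<kappa> * ((\<kappa> *\<^sub>R w t + h t) \<bullet> (\<kappa> *\<^sub>R w t + h t))" using \<kappa> by simp
      also have "\<dots> = \<kappa> * (w t \<bullet> w t) + (2 * (h t \<bullet> w t) + 1 / \<kappa> * (h t \<bullet> h t))"
        using \<kappa> by (simp add: inner_add_left inner_add_right inner_commute field_simps)
      finally show "0 \<le> \<kappa> * (w t \<bullet> w t) + (2 * (h t \<bullet> w t) + 1 / \<kappa> * (h t \<bullet> h t))" .
    qed
    also have "\<dots> = \<kappa> * (\<integral>t. w t \<bullet> w t \<partial>half_line) + (2 * (\<integral>t. h t \<bullet> w t \<partial>half_line) + 1 / \<kappa> * (\<integral>t. h t \<bullet> h t \<partial>half_line))"
      using j by simp
    finally show ?thesis using total b0 unfolding C_def by linarith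
  qed
  thus ?thesis by blast
qed

end

section \<open>Hurwitz matrices\<close>

definition decaying :: "(real \<Rightarrow> complex) \<Rightarrow> bool" where
  "decaying y \<longleftrightarrow> (\<exists>C m. m > 0 \<and> (\<forall>t\<ge>0. norm (y t) \<le> C * exp (- m * t)))"

text \<open>Comparison for z = exp(- l t) y, whose derivative exp(- l t) b has an exponential
  majorant.\<close>

lemma decaying_integrate:
  assumes y: "\<And>t. (y has_vector_derivative (l * y t + b t)) (at t)" and l: "Re l < 0" and b: "decaying b"
  shows "decaying y"
proof -
  obtain C m where m: "m > 0" and C: "\<And>t. t \<ge> 0 \<Longrightarrow> norm (b t) \<le> C * exp (- m * t)"
    using b by (auto simp: decaying_def)
  have C0: "C \<ge> 0" using order_trans[OF norm_ge_zero C[of 0]] by simp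
  define r where "r = - Re l"
  \<comment> \<open>Strictly below both m and r, so that no polynomial factor appears if m = r; the
    majorant C exp ((r - k) t) then has the growing antiderivative \<phi>.\<close>
  define k where "k = min m r / 2"
  have k: "k > 0" "k < m" "k < r" using m l by (auto simp: k_def r_def min_def)
  define z where "z t = exp (- l * of_real t) * y t" for t
  define \<phi> where "\<phi> t = C / (r - k) * exp ((r - k) * t)" for t
  have dz: "(z has_vector_derivative exp (- l * of_real t) * b t) (at t)" for t
  proof -
    have "((\<lambda>t. exp (- l * of_real t)) has_vector_derivative (- l) * exp (- l * of_real t)) (at t)"
      by (rule has_vector_derivative_real_field) (auto intro!: derivative_eq_intros)
    from has_vector_derivative_mult[OF this y[of t]] show ?thesis
      unfolding z_def[abs_def] by (simp add: algebra_simps)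
  qed
  have d\<phi>: "(\<phi> has_vector_derivative C * exp ((r - k) * t)) (at t)" for t
    unfolding \<phi>_def[abs_def] has_real_derivative_iff_has_vector_derivative[symmetric]
    using k by (auto intro!: derivative_eq_intros)
  have bound: "norm (exp (- l * of_real t) * b t) \<le> C * exp ((r - k) * t)" if t: "t \<ge> 0" for t
  proof -
    have "norm (exp (- l * of_real t) * b t) = exp (r * t) * norm (b t)" by (simp add: norm_mult r_def)
    also have "\<dots> \<le> exp (r * t) * (C * exp (- m * t))" using C[OF t] by (intro mult_left_mono) auto
    also have "\<dots> = C * exp ((r - m) * t)" by (simp add: exp_add[symmetric] algebra_simps)
    also have "\<dots> \<le> C * exp ((r - k) * t)" using C0 k t by (intro mult_left_mono) (auto intro!: mult_right_mono)
    finally show ?thesis .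
  qed
  have "norm (y t) \<le> (norm (y 0) + C / (r - k)) * exp (- k * t)" if t: "t \<ge> 0" for t
  proof -
    have z\<phi>: "norm (z t - z 0) \<le> \<phi> t - \<phi> 0"
    proof (cases "t = 0")
      case False
      show ?thesis
      proof (rule differentiable_bound_general[where f = z and \<phi> = \<phi> and a = 0 and b = t])
        show "0 < t" using False t by simp
        show "continuous_on {0..t} z" "continuous_on {0..t} \<phi>"
          by (intro continuous_at_imp_continuous_on ballI has_vector_derivative_continuous[OF dz]
            has_vector_derivative_continuous[OF d\<phi>])+
        show "(z has_vector_derivative exp (- l * of_real s) * b s) (at s)"
          "(\<phi> has_vector_derivative C * exp ((r - k) * s)) (at s)" for s by (rule dz d\<phi>)+
        show "norm (exp (- l * of_real s) * b s) \<le> C * exp ((r - k) * s)" if "0 < s" for s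
          using bound[of s] that by simp
      qed
    qed simp
    have "\<phi> 0 \<ge> 0" using C0 k by (simp add: \<phi>_def)
    moreover have z0: "z 0 = y 0" by (simp add: z_def)
    ultimately have "norm (z t) \<le> norm (y 0) + \<phi> t"
      using z\<phi> norm_triangle_ineq2[of "z t" "z 0"] unfolding z0 by linarith
    moreover have "norm (z t) = exp (r * t) * norm (y t)" unfolding z_def norm_mult by (simp add: r_def)
    ultimately have le: "exp (- r * t) * (exp (r * t) * norm (y t)) \<le> exp (- r * t) * (norm (y 0) + \<phi> t)"
      by (intro mult_left_mono) auto
    have "exp (- r * t) * exp (r * t) = 1" by (simp add: exp_add[symmetric])
    hence 1: "exp (- r * t) * (exp (r * t) * norm (y t)) = norm (y t)" by (simp only: mult.assoc[symmetric] mult_1_left)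
    have 2: "exp (- k * t) = exp (- r * t) * exp ((r - k) * t)" by (simp only: exp_add[symmetric]) (simp add: algebra_simps)
    have "exp (- r * t) * (norm (y 0) + \<phi> t) = exp (- r * t) * norm (y 0) + C / (r - k) * exp (- k * t)"
      unfolding 2 \<phi>_def by (simp only: distrib_left mult.left_commute mult.assoc)
    with le 1 have "norm (y t) \<le> exp (- r * t) * norm (y 0) + C / (r - k) * exp (- k * t)" by linarith
    also have "exp (- r * t) * norm (y 0) \<le> exp (- k * t) * norm (y 0)"
      using k t mult_right_mono[of k r t] by (intro mult_right_mono) auto
    finally show ?thesis by (simp add: algebra_simps)
  qed
  thus ?thesis using k unfolding decaying_def by blast
qed

text \<open>The i-th coordinate of q(A) z, with q complex and A, z real: a polynomial can be
  factored over the complex numbers while the solution stays real.\<close>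

definition coord_poly :: "real^'n^'n \<Rightarrow> complex poly \<Rightarrow> 'n::finite \<Rightarrow> real^'n \<Rightarrow> complex" where
  "coord_poly A q i z = (\<Sum>k\<le>degree q. coeff q k * of_real ((((*v) A ^^ k) z) $ i))"

lemma coord_poly_bound:
  "degree q \<le> N \<Longrightarrow> coord_poly A q i z = (\<Sum>k\<le>N. coeff q k * of_real ((((*v) A ^^ k) z) $ i))"
  unfolding coord_poly_def by (rule sum.mono_neutral_left) (auto simp: coeff_eq_0)

lemma coord_poly_pCons: "coord_poly A (pCons c q) i z = c * of_real (z $ i) + coord_poly A q i (A *v z)"
proof -
  have "coord_poly A (pCons c q) i z = (\<Sum>k\<le>Suc (degree q). coeff (pCons c q) k * of_real ((((*v) A ^^ k) z) $ i))"
    by (rule coord_poly_bound) (rule degree_pCons_le)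
  thus ?thesis by (simp add: sum.atMost_Suc_shift coord_poly_def funpow_swap1 del: sum.atMost_Suc)
qed

lemma coord_poly_add: "coord_poly A (p + q) i z = coord_poly A p i z + coord_poly A q i z"
  using coord_poly_bound[of p "max (degree p) (degree q)" A i z] coord_poly_bound[of q "max (degree p) (degree q)" A i z]
    coord_poly_bound[OF degree_add_le_max[of p q], of A i z]
  by (simp add: sum.distrib algebra_simps)

lemma coord_poly_smult: "coord_poly A (smult c p) i z = c * coord_poly A p i z"
  using coord_poly_bound[OF degree_smult_le[of c p], of A i z]
  by (simp add: coord_poly_def sum_distrib_left mult.assoc)

lemma coord_poly_linear_factor:
  "coord_poly A ([:- l, 1:] * q) i z = coord_poly A q i (A *v z) - l * coord_poly A q i z"
proof -
  have "[:- l, 1:] * q = smult (- l) q + pCons 0 q" by simp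
  thus ?thesis by (simp only: coord_poly_add coord_poly_smult coord_poly_pCons) simp
qed

lemma coord_poly_matrix:
  "coord_poly A q i (A *v z) = (\<Sum>j\<in>UNIV. of_real (A $ i $ j) * coord_poly A q j z)"
proof -
  have "(((*v) A ^^ k) (A *v z)) $ i = (\<Sum>j\<in>UNIV. A $ i $ j * (((*v) A ^^ k) z) $ j)" for k
    by (simp add: funpow_swap1[symmetric]) (simp add: matrix_vector_mult_def)
  hence "coord_poly A q i (A *v z) = (\<Sum>k\<le>degree q. \<Sum>j\<in>UNIV. of_real (A $ i $ j) * (coeff q k * of_real ((((*v) A ^^ k) z) $ j)))"
    by (simp add: coord_poly_def sum_distrib_left mult_ac)
  also have "\<dots> = (\<Sum>j\<in>UNIV. of_real (A $ i $ j) * coord_poly A q j z)"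
    by (subst sum.swap) (simp add: coord_poly_def sum_distrib_left)
  finally show ?thesis .
qed

lemma coord_poly_derivative:
  assumes "\<And>t. (y has_vector_derivative (A *v y t)) (at t)"
  shows "((\<lambda>t. coord_poly A q i (y t)) has_vector_derivative coord_poly A q i (A *v y t)) (at t)"
  unfolding coord_poly_def
proof (rule has_vector_derivative_sum)
  fix k
  have "linear (((*v) A) ^^ k)" by (rule linear_funpow) (rule matrix_vector_mul_linear)
  hence "linear (\<lambda>z. (((*v) A ^^ k) z) $ i)"
    by (simp add: linear_iff)
  hence "bounded_linear (\<lambda>z. (((*v) A ^^ k) z) $ i)" by (simp add: linear_conv_bounded_linear)
  from bounded_linear.has_vector_derivative[OF this assms[of t]]
  have "((\<lambda>t. (((*v) A ^^ k) (y t)) $ i) has_vector_derivative (((*v) A ^^ k) (A *v y t)) $ i) (at t)" .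
  from bounded_linear.has_vector_derivative[OF bounded_linear_of_real this]
  show "((\<lambda>t. coeff q k * of_real ((((*v) A ^^ k) (y t)) $ i)) has_vector_derivative
      coeff q k * of_real ((((*v) A ^^ k) (A *v y t)) $ i)) (at t)"
    by (rule has_vector_derivative_mult_right)
qed

text \<open>The roots of an annihilating polynomial p of least degree are eigenvalues of A and so
  have negative real part. Whenever r q = p, the function q(A) y decays, by induction on the degree
  of r: it solves z' = l z + b with l a root of r and b = ((s - l) q)(A) y, which decays already.
  The case q = 1 is the claim.\<close>

lemma hurwitz_decaying_solution:
  assumes A: "hurwitz A" and y: "\<And>t. (y has_vector_derivative (A *v y t)) (at t)"
  shows "decaying (\<lambda>t. of_real (y t $ i))"
proof -
  define ann where "ann p \<longleftrightarrow> p \<noteq> 0 \<and> (\<forall>i z. coord_poly A p i z = 0)" for p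
  obtain p0 where p0: "p0 \<noteq> 0" "\<And>z. polymap ((*v) A) p0 z = 0"
    using annihilating_poly_exists[OF matrix_vector_mul_linear[of A]] by metis
  have "coord_poly A (map_poly of_real p0) i z = of_real (polymap ((*v) A) p0 z $ i)" for i z
    by (simp add: coord_poly_def polymap_def coeff_map_poly degree_map_poly)
  hence "ann (map_poly of_real p0)" using p0 by (simp add: ann_def map_poly_eq_0_iff)
  then obtain p where p: "ann p" and least: "\<And>q. ann q \<Longrightarrow> degree p \<le> degree q"
    using ex_has_least_nat[of ann _ degree] by blast
  have root: "Re l < 0" if l: "poly p l = 0" for l
  proof -
    obtain q where q: "p = [:- l, 1:] * q" using l by (auto simp: poly_eq_0_iff_dvd dvd_def)
    have q0: "q \<noteq> 0" using p q by (auto simp: ann_def)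
    hence "degree p = Suc (degree q)" unfolding q by (subst degree_mult_eq) auto
    hence "\<not> ann q" using least[of q] by auto
    \<comment> \<open>By minimality q does not annihilate A, so q(A) z is nonzero for some z, and it
      is an eigenvector for l.\<close>
    then obtain i0 z where nz: "coord_poly A q i0 z \<noteq> 0" using q0 by (auto simp: ann_def)
    define v where "v = (\<chi> i. coord_poly A q i z)"
    have "(cmat A *v v) $ i = l * v $ i" for i
    proof -
      have "coord_poly A q i (A *v z) = l * coord_poly A q i z"
        using p coord_poly_linear_factor[of A l q i z] by (simp add: ann_def q)
      hence "(\<Sum>j\<in>UNIV. of_real (A $ i $ j) * coord_poly A q j z) = l * coord_poly A q i z"
        by (simp only: coord_poly_matrix)
      thus ?thesis by (simp add: v_def cmat_def matrix_vector_mult_def)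
    qed
    hence "(mat l - cmat A) *v v = 0"
      by (simp add: vec_eq_iff matrix_vector_mult_diff_rdistrib)
         (simp add: mat_def matrix_vector_mult_def if_distrib[of "\<lambda>x. x * _"] cong: if_cong)
    moreover have "v \<noteq> 0" using nz by (auto simp: v_def vec_eq_iff)
    ultimately have "\<not> invertible (mat l - cmat A)"
      by (metis invertible_def matrix_left_invertible_ker)
    thus ?thesis using A by (auto simp: hurwitz_def not_le)
  qed
  have "decaying (\<lambda>t. coord_poly A q i (y t))" if "r * q = p" for r q
    using that
  proof (induction "degree r" arbitrary: r q)
    case 0
    then obtain a where "r = [:a:]" by (metis degree_eq_zeroE)
    hence "p = smult a q" "a \<noteq> 0" using 0 p by (auto simp: ann_def)
    hence "coord_poly A q i z = 0" for z using p by (auto simp: ann_def coord_poly_smult)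
    thus ?case by (auto simp: decaying_def intro!: exI[of _ 0] exI[of _ 1])
  next
    case (Suc n)
    hence "\<not> constant (poly r)" by (simp add: constant_degree)
    then obtain l where l: "poly r l = 0" using fundamental_theorem_of_algebra by blast
    then obtain r' where r': "r = [:- l, 1:] * r'" by (auto simp: poly_eq_0_iff_dvd dvd_def)
    have "r' \<noteq> 0" using Suc.hyps r' by auto
    hence "degree r = Suc (degree r')" unfolding r' by (subst degree_mult_eq) auto
    hence n: "n = degree r'" using Suc.hyps by simp
    have rq: "r' * ([:- l, 1:] * q) = p" using Suc.prems unfolding r' by (metis mult.assoc mult.commute)
    have d: "decaying (\<lambda>t. coord_poly A ([:- l, 1:] * q) i (y t))" by (rule Suc.hyps(1)[OF n rq])
    have "poly p l = 0" unfolding Suc.prems[symmetric] using l by simp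
    hence rl: "Re l < 0" by (rule root)
    have dq: "((\<lambda>t. coord_poly A q i (y t)) has_vector_derivative
        (l * coord_poly A q i (y t) + coord_poly A ([:- l, 1:] * q) i (y t))) (at t)" for t
      using coord_poly_derivative[OF y, of q i t] by (simp only: coord_poly_linear_factor) simp
    show ?case by (rule decaying_integrate[OF dq rl d])
  qed
  hence "decaying (\<lambda>t. coord_poly A 1 i (y t))" by (metis mult.right_neutral)
  thus ?thesis by (simp add: coord_poly_def)
qed

lemma hurwitz_flow_vanishes:
  assumes A: "hurwitz A"
  shows "((\<lambda>t. flow ((*v) A) t a) \<longlongrightarrow> 0) at_top"
proof (rule vec_tendstoI)
  fix i
  have "decaying (\<lambda>t. of_real (flow ((*v) A) t a $ i))"
    by (intro hurwitz_decaying_solution[OF A] flow_derivative matrix_vector_mul_linear)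
  then obtain C m where m: "m > 0" and C: "\<And>t. t \<ge> 0 \<Longrightarrow> \<bar>flow ((*v) A) t a $ i\<bar> \<le> C * exp (- m * t)"
    by (auto simp: decaying_def)
  have "filterlim (\<lambda>t. - (m * t)) at_bot at_top"
    using m by (simp add: filterlim_uminus_at_bot filterlim_tendsto_pos_mult_at_top[OF tendsto_const _ filterlim_ident])
  hence "((\<lambda>t. C * exp (- (m * t))) \<longlongrightarrow> C * 0) at_top"
    by (intro tendsto_mult tendsto_const filterlim_compose[OF exp_at_bot])
  hence lim: "((\<lambda>t. C * exp (- m * t)) \<longlongrightarrow> 0) at_top" by simp
  show "((\<lambda>t. flow ((*v) A) t a $ i) \<longlongrightarrow> 0 $ i) at_top"
    unfolding zero_index
    by (rule Lim_null_comparison[OF _ lim]) (use C in \<open>auto simp: eventually_at_top_linorder\<close>)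
qed

section \<open>Sylvester and Lyapunov equations\<close>

definition sylvester :: "real^'n^'n \<Rightarrow> real^'n^'n \<Rightarrow> real^'n^'n" where
  "sylvester A X = transpose A ** X + X ** A"

lemma linear_sylvester: "linear (sylvester A)"
  by (rule linearI) (simp_all add: sylvester_def vec_eq_iff matrix_matrix_mult_def sum.distrib distrib_left
    distrib_right sum_distrib_left mult_ac)

lemma sylvester_inner: "(A *v y) \<bullet> (X *v x) + y \<bullet> (X *v (A *v x)) = y \<bullet> (sylvester A X *v x)"
proof -
  have "y \<bullet> (transpose A *v (X *v x)) = (A *v y) \<bullet> (X *v x)"
    using dot_lmul_matrix[of "X *v x" A y] by (simp only: transpose_matrix_vector inner_commute)
  thus ?thesis by (simp add: sylvester_def matrix_vector_mult_add_rdistrib inner_add_right matrix_vector_mul_assoc)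
qed

lemma matrix_eq_inner: "(\<And>y x. y \<bullet> (X *v x) = y \<bullet> (Y *v x)) \<Longrightarrow> X = Y" for X Y :: "real^'n^'m"
  unfolding matrix_eq using vector_eq_ldot by blast

lemma sylvester_flow_derivative:
  "((\<lambda>t. flow ((*v) A) t y \<bullet> (X *v flow ((*v) A) t x)) has_real_derivative
     flow ((*v) A) t y \<bullet> (sylvester A X *v flow ((*v) A) t x)) (at t)"
proof -
  note fd = flow_derivative[OF matrix_vector_mul_linear[of A]]
  have "((\<lambda>t. X *v flow ((*v) A) t x) has_vector_derivative X *v (A *v flow ((*v) A) t x)) (at t)"
    by (rule bounded_linear.has_vector_derivative[OF matrix_vector_mul_bounded_linear fd])
  from bounded_bilinear.has_vector_derivative[OF bounded_bilinear_inner fd this, of y]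
  show ?thesis unfolding has_real_derivative_iff_has_vector_derivative
    by (simp add: sylvester_inner[symmetric] add.commute)
qed

lemma flow_form_vanishes:
  assumes A: "hurwitz A"
  shows "((\<lambda>t. flow ((*v) A) t y \<bullet> (X *v flow ((*v) A) t x)) \<longlongrightarrow> 0) at_top"
proof -
  have "((\<lambda>t. X *v flow ((*v) A) t x) \<longlongrightarrow> X *v 0) at_top"
    by (intro bounded_linear.tendsto[OF matrix_vector_mul_bounded_linear] hurwitz_flow_vanishes[OF A])
  from tendsto_inner[OF hurwitz_flow_vanishes[OF A] this] show ?thesis by simp
qed

text \<open>The bilinear form y . X x is constant along pairs of solutions, and it tends to 0 with
  them.\<close>

lemma sylvester_injective:
  assumes A: "hurwitz A" and X: "sylvester A X = 0"
  shows "X = 0"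
proof (rule matrix_eq_inner)
  fix y x :: "real^'a"
  define f where "f t = flow ((*v) A) t y \<bullet> (X *v flow ((*v) A) t x)" for t
  have "(f has_real_derivative 0) (at t)" for t
    unfolding f_def[abs_def] using sylvester_flow_derivative[of A y X x t] by (simp add: X)
  hence "f t = f 0" for t using DERIV_isconst_all[of f t 0] by blast
  hence "(f \<longlongrightarrow> f 0) at_top" by (simp add: tendsto_cong[of f "\<lambda>_. f 0"])
  moreover have "(f \<longlongrightarrow> 0) at_top" unfolding f_def[abs_def] by (rule flow_form_vanishes[OF A])
  ultimately have "f 0 = 0" using tendsto_unique[OF trivial_limit_at_top_linorder] by blast
  thus "y \<bullet> (X *v x) = y \<bullet> (0 *v x)" by (simp add: f_def)
qed

lemma sylvester_surjective:
  assumes A: "hurwitz A" obtains X where "sylvester A X = Y"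
proof -
  note l = linear_sylvester[of A]
  have "inj (sylvester A)" using sylvester_injective[OF A] by (subst linear_injective_0[OF l]) blast
  hence "surj (sylvester A)" by (rule eucl.linear_inj_imp_surj[OF l])
  thus thesis using that by (metis surjD)
qed

text \<open>Symmetry of P comes from uniqueness, since the transpose solves the same equation.
  Nonnegativity comes from monotonicity: x . P x decreases to 0 along the flow.\<close>

lemma hurwitz_lyapunov:
  assumes A: "hurwitz A" obtains P where "lyapunov ((*v) A) ((*v) P)"
proof -
  obtain P where P: "sylvester A P = - mat 1" using sylvester_surjective[OF A] by blast
  have "sylvester A (transpose P) = transpose (sylvester A P)"
    by (simp add: sylvester_def matrix_transpose_mul vec_eq_iff transpose_def matrix_matrix_mult_def mult.commute)
  hence "sylvester A (transpose P) = - mat 1" unfolding P by (simp add: transpose_def mat_def vec_eq_iff)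
  hence "sylvester A (transpose P - P) = 0" using P by (simp add: linear_diff[OF linear_sylvester])
  hence sym: "transpose P = P" using sylvester_injective[OF A] by fastforce
  have symP: "(P *v x) \<bullet> y = x \<bullet> (P *v y)" for x y
    using dot_lmul_matrix[of x P y] sym by (simp add: transpose_matrix_vector[symmetric])
  have m1: "(- mat 1) *v x = - x" for x :: "real^'a"
    by (simp add: vec_eq_iff matrix_vector_mult_def mat_def if_distrib[of uminus] if_distrib[of "\<lambda>c. c * _"] cong: if_cong)
  show thesis
  proof (rule that[of P], rule lyapunov.intro)
    show "linear ((*v) A)" "linear ((*v) P)" by simp_all
    show "(P *v x) \<bullet> y = x \<bullet> (P *v y)" for x y by (rule symP)
    show "2 * ((P *v x) \<bullet> (A *v x)) = - (x \<bullet> x)" for x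
      using sylvester_inner[of A x P x] symP[of x "A *v x"] unfolding P m1 by (simp add: inner_commute)
    show "(P *v x) \<bullet> x \<ge> 0" for x
    proof -
      define f where "f t = flow ((*v) A) t x \<bullet> (P *v flow ((*v) A) t x)" for t
      have d: "(f has_real_derivative - (flow ((*v) A) t x \<bullet> flow ((*v) A) t x)) (at t)" for t
        unfolding f_def[abs_def] using sylvester_flow_derivative[of A x P x t] by (simp add: P m1)
      have "f t \<le> f 0" if "t \<ge> 0" for t
        by (rule DERIV_nonpos_imp_nonincreasing[OF that]) (use d in \<open>auto intro!: exI\<close>)
      moreover have "(f \<longlongrightarrow> 0) at_top" unfolding f_def[abs_def] by (rule flow_form_vanishes[OF A])
      ultimately have "0 \<le> f 0"
        by (intro tendsto_upperbound[of f 0 at_top "f 0"]) (auto simp: eventually_at_top_linorder)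
      thus ?thesis by (simp add: f_def inner_commute)
    qed
  qed
qed

section \<open>The system with doubled state\<close>

lemma sum_UNIV_sum:
  "(\<Sum>i\<in>(UNIV :: ('a::finite + 'b::finite) set). f i) = (\<Sum>a\<in>UNIV. f (Inl a)) + (\<Sum>b\<in>UNIV. f (Inr b))"
  by (simp add: UNIV_Plus_UNIV[symmetric] sum.Plus del: UNIV_Plus_UNIV)

lemma stack3_add: "stack3 (x + x') (v + v') (w + w') = stack3 x v w + stack3 x' v' w'"
  by (simp add: stack3_def vec_eq_iff split: sum.split)

lemma stack3_scaleR: "stack3 (r *\<^sub>R x) (r *\<^sub>R v) (r *\<^sub>R w) = r *\<^sub>R stack3 x v w"
  by (simp add: stack3_def vec_eq_iff split: sum.split)

lemma stack3_0 [simp]: "stack3 0 0 0 = 0"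
  by (simp add: stack3_def vec_eq_iff split: sum.split)

lemma inner_stack3: "stack3 x v w \<bullet> stack3 x' v' w' = x \<bullet> x' + (v \<bullet> v' + w \<bullet> w')"
  by (simp add: inner_vec_def sum_UNIV_sum) (simp add: stack3_def)

section \<open>Complex vectors as real pairs and the frequency response matrix\<close>

definition cvec :: "real^'n \<Rightarrow> real^'n \<Rightarrow> complex^'n" where
  "cvec a b = (\<chi> i. Complex (a $ i) (b $ i))"

definition cinput :: "complex^'k \<Rightarrow> complex^'q \<Rightarrow> complex^('k + 'q)" where
  "cinput v w = (\<chi> i. case i of Inl a \<Rightarrow> v $ a | Inr b \<Rightarrow> w $ b)"

definition sesq :: "complex^'m^'m \<Rightarrow> complex^'m \<Rightarrow> complex^'m \<Rightarrow> complex" where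
  "sesq M a b = (\<Sum>i\<in>UNIV. cnj (a $ i) * (M *v b) $ i)"

lemma cquad_sesq: "cquad M z = sesq M z z"
  by (simp add: cquad_def sesq_def)

lemma cmat_cvec: "cmat M *v cvec a b = cvec (M *v a) (M *v b)"
  by (simp add: cmat_def cvec_def vec_eq_iff matrix_vector_mult_def complex_eq_iff)

lemma cvec_eq_0: "cvec a b = 0 \<longleftrightarrow> a = 0 \<and> b = 0"
  by (auto simp: cvec_def vec_eq_iff complex_eq_iff)

lemma cvec_0 [simp]: "cvec 0 0 = 0"
  by (simp add: cvec_eq_0)

lemma Re_sesq_cmat: "Re (sesq (cmat M) (cvec a b) (cvec c d)) = a \<bullet> (M *v c) + b \<bullet> (M *v d)"
  by (simp add: sesq_def cmat_cvec) (simp add: cvec_def inner_vec_def sum.distrib)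

lemma ctrans_adjoint:
  "(\<Sum>i\<in>UNIV. cnj (a $ i) * (ctrans M *v y) $ i) = (\<Sum>j\<in>UNIV. cnj ((M *v a) $ j) * y $ j)"
proof -
  have "(\<Sum>i\<in>UNIV. cnj (a $ i) * (ctrans M *v y) $ i) = (\<Sum>i\<in>UNIV. \<Sum>j\<in>UNIV. cnj (a $ i) * cnj (M $ j $ i) * y $ j)"
    by (simp add: ctrans_def matrix_vector_mult_def sum_distrib_left mult.assoc)
  also have "\<dots> = (\<Sum>j\<in>UNIV. \<Sum>i\<in>UNIV. cnj (a $ i) * cnj (M $ j $ i) * y $ j)" by (rule sum.swap)
  also have "\<dots> = (\<Sum>j\<in>UNIV. cnj ((M *v a) $ j) * y $ j)"
    by (simp add: matrix_vector_mult_def sum_distrib_left mult_ac)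
  finally show ?thesis .
qed

lemma sesq_Pi_mat: "sesq (Pi_mat A B1 B2 Q s) a b = sesq (cmat Q) (Mstack A B1 B2 s *v a) (Mstack A B1 B2 s *v b)"
  by (simp add: sesq_def Pi_mat_def matrix_vector_mul_assoc[symmetric] ctrans_adjoint)

lemma sesq_expand: "sesq M a b = (\<Sum>i\<in>UNIV. \<Sum>j\<in>UNIV. cnj (a $ i) * (M $ i $ j * b $ j))"
  by (simp add: sesq_def matrix_vector_mult_def sum_distrib_left)

lemma cquad_Pi_mod: "cquad (Pi_mod e M) (cinput v w) = sesq M (cinput v 0) (cinput v 0)
   + of_real e * (sesq M (cinput v 0) (cinput 0 w) + sesq M (cinput 0 w) (cinput v 0)) - sesq M (cinput 0 w) (cinput 0 w)"
  unfolding cquad_sesq sesq_expand sum_UNIV_sum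
  by (simp add: cinput_def Pi_mod_def sum_distrib_left sum.distrib sum_negf sum_subtractf mult_ac distrib_left)

lemma cquad_Pi11: "cquad (Pi11 M) v = sesq M (cinput v 0) (cinput v 0)"
  unfolding cquad_sesq sesq_expand sum_UNIV_sum by (simp add: cinput_def Pi11_def)

lemma cquad_Pi22: "cquad (- Pi22 M) w = - sesq M (cinput 0 w) (cinput 0 w)"
  unfolding cquad_sesq sesq_expand sum_UNIV_sum by (simp add: cinput_def Pi22_def sum_negf)

text \<open>The real relations say (s I - A)(x1 + i x2) = B u with s = i \<omega>, so x1 + i x2 is
  the resolvent applied to B u. From here on harmonic pairs take the place of the inverse
  matrix.\<close>

lemma Mstack_response:
  assumes A: "hurwitz A"
    and x: "A *v x1 + (B1 *v v1 + B2 *v w1) = - \<omega> *\<^sub>R x2" "A *v x2 + (B1 *v v2 + B2 *v w2) = \<omega> *\<^sub>R x1"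
  shows "Mstack A B1 B2 (\<i> * complex_of_real \<omega>) *v cinput (cvec v1 v2) (cvec w1 w2) = cvec (stack3 x1 v1 w1) (stack3 x2 v2 w2)"
proof -
  define s where "s = \<i> * complex_of_real \<omega>"
  define u where "u = cinput (cvec v1 v2) (cvec w1 w2)"
  define N where "N = mat s - cmat A"
  have inv: "invertible N" using A by (simp add: hurwitz_def N_def s_def)
  have Bu: "Bcat B1 B2 *v u = cvec (B1 *v v1 + B2 *v w1) (B1 *v v2 + B2 *v w2)"
    by (simp add: vec_eq_iff matrix_vector_mult_def sum_UNIV_sum Bcat_def u_def cinput_def cvec_def complex_eq_iff sum.distrib)
  have ms: "mat s *v z = (\<chi> i. s * z $ i)" for z :: "complex^'a"
    by (simp add: vec_eq_iff matrix_vector_mult_def mat_def if_distrib[of "\<lambda>c. c * _"] cong: if_cong)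
  have "N *v cvec x1 x2 = (\<chi> i. s * cvec x1 x2 $ i) - cvec (A *v x1) (A *v x2)"
    by (simp add: N_def matrix_vector_mult_diff_rdistrib ms cmat_cvec)
  also have "\<dots> = cvec (- \<omega> *\<^sub>R x2 - A *v x1) (\<omega> *\<^sub>R x1 - A *v x2)"
    by (simp add: vec_eq_iff cvec_def s_def complex_eq_iff)
  also have "\<dots> = Bcat B1 B2 *v u" unfolding Bu x[symmetric] by simp
  finally have Nx: "N *v cvec x1 x2 = Bcat B1 B2 *v u" .
  have "(matrix_inv N ** Bcat B1 B2) *v u = matrix_inv N *v (N *v cvec x1 x2)"
    by (simp add: Nx matrix_vector_mul_assoc)
  also have "\<dots> = (matrix_inv N ** N) *v cvec x1 x2" by (simp add: matrix_vector_mul_assoc)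
  also have "matrix_inv N ** N = mat 1"
    using someI_ex[OF inv[unfolded invertible_def]] unfolding matrix_inv_def by blast
  also have "mat 1 *v cvec x1 x2 = cvec x1 x2" by simp
  finally have R: "(matrix_inv N ** Bcat B1 B2) *v u = cvec x1 x2" .
  show ?thesis
  proof (rule vec_eq_iff[THEN iffD2], rule allI)
    fix i :: "'a + ('b + 'c)"
    show "(Mstack A B1 B2 (\<i> * complex_of_real \<omega>) *v cinput (cvec v1 v2) (cvec w1 w2)) $ i
       = cvec (stack3 x1 v1 w1) (stack3 x2 v2 w2) $ i"
    proof (cases i)
      case (Inl a)
      have "(Mstack A B1 B2 s *v u) $ i = ((matrix_inv N ** Bcat B1 B2) *v u) $ a"
        by (simp add: Mstack_def Let_def Inl matrix_vector_mult_def N_def)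
      thus ?thesis unfolding R by (simp add: Inl cvec_def stack3_def s_def u_def)
    next
      case (Inr b)
      have "(Mstack A B1 B2 s *v u) $ i = u $ b"
        by (simp add: Mstack_def Let_def Inr matrix_vector_mult_def if_distrib[of "\<lambda>c. c * _"] cong: if_cong)
      thus ?thesis by (cases b) (simp_all add: Inr cvec_def stack3_def s_def u_def cinput_def)
    qed
  qed
qed

text \<open>Splitting the state into the responses to v and to w turns the hypothesis on the scaled matrix
  into a frequency domain inequality for a system with doubled state.\<close>

definition ext1 :: "((real^'n) \<times> (real^'n)) \<times> ((real^'k) \<times> (real^'q)) \<Rightarrow> real^('n + ('k + 'q))" where
  "ext1 z = stack3 (fst (fst z)) (fst (snd z)) 0"

definition ext2 :: "((real^'n) \<times> (real^'n)) \<times> ((real^'k) \<times> (real^'q)) \<Rightarrow> real^('n + ('k + 'q))" where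
  "ext2 z = stack3 (snd (fst z)) 0 (snd (snd z))"

lemma linear_ext: "linear ext1" "linear ext2"
  using stack3_add[of _ _ _ _ 0 0] stack3_add[of _ _ 0 0 _ _] stack3_scaleR[of _ _ _ 0] stack3_scaleR[of _ _ 0 _]
  by (auto intro!: linearI simp: ext1_def ext2_def)

text \<open>The operator of the cost of the v-response minus that of the w-response plus cross
  terms. The factor e stands in both off-diagonal blocks, so for symmetric Q the cross product
  enters with 2 e.\<close>

definition doubled_form :: "real \<Rightarrow> real^('n + ('k + 'q))^('n + ('k + 'q)) \<Rightarrow>
    ((real^'n) \<times> (real^'n)) \<times> ((real^'k) \<times> (real^'q)) \<Rightarrow> ((real^'n) \<times> (real^'n)) \<times> ((real^'k) \<times> (real^'q))" where
  "doubled_form e Q z = adjoint ext1 (Q *v (ext1 z + e *\<^sub>R ext2 z)) + adjoint ext2 (Q *v (e *\<^sub>R ext1 z - ext2 z))"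

lemma doubled_form_inner:
  "doubled_form e Q z \<bullet> z' = ext1 z' \<bullet> (Q *v ext1 z) + e * (ext1 z' \<bullet> (Q *v ext2 z) + ext2 z' \<bullet> (Q *v ext1 z)) - ext2 z' \<bullet> (Q *v ext2 z)"
proof -
  have "doubled_form e Q z \<bullet> z' = ext1 z' \<bullet> (Q *v (ext1 z + e *\<^sub>R ext2 z)) + ext2 z' \<bullet> (Q *v (e *\<^sub>R ext1 z - ext2 z))"
    using adjoint_works[OF linear_ext(1), of z' "Q *v (ext1 z + e *\<^sub>R ext2 z)"]
      adjoint_works[OF linear_ext(2), of z' "Q *v (e *\<^sub>R ext1 z - ext2 z)"]
    unfolding doubled_form_def inner_add_left by (simp only: inner_commute)
  also have "\<dots> = ext1 z' \<bullet> (Q *v ext1 z) + e * (ext1 z' \<bullet> (Q *v ext2 z) + ext2 z' \<bullet> (Q *v ext1 z)) - ext2 z' \<bullet> (Q *v ext2 z)"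
    by (simp add: matrix_vector_right_distrib matrix_vector_mult_diff_distrib matrix_vector_mult_scaleR inner_add_right inner_diff_right distrib_left)
  finally show ?thesis .
qed

lemma symmetric_matrix_inner:
  fixes Q :: "real^'m^'m" assumes "transpose Q = Q" shows "a \<bullet> (Q *v b) = b \<bullet> (Q *v a)"
  using dot_lmul_matrix[of a Q b] assms by (simp add: transpose_matrix_vector[symmetric] inner_commute)

lemma linear_doubled_form: "linear (doubled_form e Q)"
  unfolding doubled_form_def
  by (intro linear_compose_add linear_compose[OF _ adjoint_linear[OF linear_ext(1)], unfolded o_def]
    linear_compose[OF _ adjoint_linear[OF linear_ext(2)], unfolded o_def]
    linear_compose[OF _ matrix_vector_mul_linear, unfolded o_def] linear_compose_sub linear_compose_scale_right linear_ext)

section \<open>The hypothesis as a frequency inequality for the doubled system\<close>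

context
  fixes A :: "real^'n^'n" and B1 :: "real^'k^'n" and B2 :: "real^'q^'n"
    and Q :: "real^('n + ('k + 'q))^('n + ('k + 'q))" and \<epsilon> \<omega>0 :: real
  assumes hur: "hurwitz A" and symQ: "transpose Q = Q"
    and fdi: "\<forall>\<omega>::real. psd_c (Pi_mod \<epsilon> (Pi_mat A B1 B2 Q (\<i> * complex_of_real \<omega>)))"
    and pd: "pd_c (Pi11 (Pi_mat A B1 B2 Q (\<i> * complex_of_real \<omega>0)))"
    and nd: "nd_c (Pi22 (Pi_mat A B1 B2 Q (\<i> * complex_of_real \<omega>0)))"
begin

abbreviation (input) "form1 \<equiv> \<lambda>x1 x2 v1 v2. stack3 x1 v1 0 \<bullet> (Q *v stack3 x1 v1 0) + stack3 x2 v2 0 \<bullet> (Q *v stack3 x2 v2 0)"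
abbreviation (input) "form2 \<equiv> \<lambda>y1 y2 w1 w2. stack3 y1 0 w1 \<bullet> (Q *v stack3 y1 0 w1) + stack3 y2 0 w2 \<bullet> (Q *v stack3 y2 0 w2)"
abbreviation (input) "form12 \<equiv> \<lambda>x1 x2 v1 v2 y1 y2 w1 w2. stack3 x1 v1 0 \<bullet> (Q *v stack3 y1 0 w1) + stack3 x2 v2 0 \<bullet> (Q *v stack3 y2 0 w2)"

lemma scaled_fdi:
  assumes x: "A *v x1 + B1 *v v1 = - \<omega> *\<^sub>R x2" "A *v x2 + B1 *v v2 = \<omega> *\<^sub>R x1"
    and y: "A *v y1 + B2 *v w1 = - \<omega> *\<^sub>R y2" "A *v y2 + B2 *v w2 = \<omega> *\<^sub>R y1"
  shows "form1 x1 x2 v1 v2 + 2 * \<epsilon> * form12 x1 x2 v1 v2 y1 y2 w1 w2 - form2 y1 y2 w1 w2 \<ge> 0"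
    "\<omega> = \<omega>0 \<Longrightarrow> v1 \<noteq> 0 \<or> v2 \<noteq> 0 \<Longrightarrow> form1 x1 x2 v1 v2 > 0"
    "\<omega> = \<omega>0 \<Longrightarrow> w1 \<noteq> 0 \<or> w2 \<noteq> 0 \<Longrightarrow> form2 y1 y2 w1 w2 < 0"
proof -
  define M where "M = Pi_mat A B1 B2 Q (\<i> * complex_of_real \<omega>)"
  have X: "Mstack A B1 B2 (\<i> * complex_of_real \<omega>) *v cinput (cvec v1 v2) 0 = cvec (stack3 x1 v1 0) (stack3 x2 v2 0)"
    using Mstack_response[OF hur, of x1 B1 v1 B2 0 \<omega> x2 v2 0] x by simp
  have Y: "Mstack A B1 B2 (\<i> * complex_of_real \<omega>) *v cinput 0 (cvec w1 w2) = cvec (stack3 y1 0 w1) (stack3 y2 0 w2)"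
    using Mstack_response[OF hur, of y1 B1 0 B2 w1 \<omega> y2 0 w2] y by simp
  have r: "Re (sesq M (cinput (cvec v1 v2) 0) (cinput (cvec v1 v2) 0)) = form1 x1 x2 v1 v2"
    "Re (sesq M (cinput 0 (cvec w1 w2)) (cinput 0 (cvec w1 w2))) = form2 y1 y2 w1 w2"
    "Re (sesq M (cinput (cvec v1 v2) 0) (cinput 0 (cvec w1 w2))) = form12 x1 x2 v1 v2 y1 y2 w1 w2"
    "Re (sesq M (cinput 0 (cvec w1 w2)) (cinput (cvec v1 v2) 0)) = form12 x1 x2 v1 v2 y1 y2 w1 w2"
    unfolding M_def sesq_Pi_mat X Y Re_sesq_cmat
    using symmetric_matrix_inner[OF symQ, of "stack3 y1 0 w1" "stack3 x1 v1 0"]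
      symmetric_matrix_inner[OF symQ, of "stack3 y2 0 w2" "stack3 x2 v2 0"] by simp_all
  have "Re (cquad (Pi_mod \<epsilon> M) (cinput (cvec v1 v2) (cvec w1 w2))) \<ge> 0"
    using fdi unfolding psd_c_def M_def by blast
  thus "form1 x1 x2 v1 v2 + 2 * \<epsilon> * form12 x1 x2 v1 v2 y1 y2 w1 w2 - form2 y1 y2 w1 w2 \<ge> 0"
    unfolding cquad_Pi_mod by (simp add: r algebra_simps)
  show "form1 x1 x2 v1 v2 > 0" if "\<omega> = \<omega>0" "v1 \<noteq> 0 \<or> v2 \<noteq> 0"
  proof -
    have "cvec v1 v2 \<noteq> 0" using that by (auto simp: cvec_eq_0)
    hence "Re (cquad (Pi11 M) (cvec v1 v2)) > 0" using pd that(1) unfolding pd_c_def M_def by blast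
    thus ?thesis by (simp add: cquad_Pi11 r)
  qed
  show "form2 y1 y2 w1 w2 < 0" if "\<omega> = \<omega>0" "w1 \<noteq> 0 \<or> w2 \<noteq> 0"
  proof -
    have "cvec w1 w2 \<noteq> 0" using that by (auto simp: cvec_eq_0)
    hence "Re (cquad (- Pi22 M) (cvec w1 w2)) > 0" using nd that(1) unfolding nd_c_def pd_c_def M_def by blast
    thus ?thesis by (simp add: cquad_Pi22 r)
  qed
qed

text \<open>Let \<alpha> and \<gamma> be the diagonal terms and \<beta> the cross term. The
  hypothesis for w and for - w gives |2 \<epsilon> \<beta>| \<le> \<alpha> - \<gamma>. With the
  coupling \<epsilon>/2 the form is \<alpha> + \<epsilon> \<beta> - \<gamma> \<ge> (\<alpha> -
  \<gamma>)/2, which at \<omega>0 is positive as soon as one of the inputs is nonzero.\<close>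

lemma doubled_kyp:
  obtains P M where "kyp (\<lambda>x. (A *v fst x, A *v snd x)) P (\<lambda>u. (B1 *v fst u, B2 *v snd u)) (doubled_form (\<epsilon> / 2) Q) M \<omega>0"
proof -
  obtain P0 where P0: "lyapunov ((*v) A) ((*v) P0)" using hurwitz_lyapunov[OF hur] by blast
  interpret L: lyapunov "(*v) A" "(*v) P0" by (rule P0)
  define R where "R x = stack3 x (0::real^'k) (0::real^'q)" for x :: "real^'n"
  have lR: "linear R" using stack3_add[of _ _ 0 0 0 0] stack3_scaleR[of _ _ 0 0] by (auto intro!: linearI simp: R_def)
  define q where "q = matrix (\<lambda>x. adjoint R (Q *v R x))"
  have q: "y \<bullet> (q *v x) = R y \<bullet> (Q *v R x)" for x y
  proof -
    have "linear (\<lambda>x. adjoint R (Q *v R x))"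
      by (intro linear_compose[OF _ adjoint_linear[OF lR], unfolded o_def] linear_compose[OF lR matrix_vector_mul_linear, unfolded o_def])
    hence "q *v x = adjoint R (Q *v R x)" by (simp add: q_def matrix_works)
    thus ?thesis by (simp add: adjoint_works[OF lR])
  qed
  obtain X where X: "sylvester A X = - q" using sylvester_surjective[OF hur] by blast
  have X': "(A *v y) \<bullet> (X *v x) + y \<bullet> (X *v (A *v x)) = - (R y \<bullet> (Q *v R x))" for x y
  proof -
    have "(- q) *v x = - (q *v x)" by (metis diff_0 matrix_vector_mult_0 matrix_vector_mult_diff_rdistrib)
    thus ?thesis unfolding sylvester_inner X by (simp add: q)
  qed
  define e where "e = \<epsilon> / 2"
  \<comment> \<open>The state block of the doubled form consists of four multiples of q with the
    factors 1, e, e, - 1. The Sylvester solution X for q, arranged with the same factors, solves the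
    doubled equation.\<close>
  define M where "M x = (X *v fst x + e *\<^sub>R (X *v snd x), e *\<^sub>R (X *v fst x) - X *v snd x)" for x
  have lM: "linear M" unfolding M_def
    by (rule linearI) (simp_all add: matrix_vector_right_distrib matrix_vector_mult_scaleR algebra_simps)
  have core: "doubled_form e Q (x1, u1) \<bullet> (x1, u1) + doubled_form e Q (x2, u2) \<bullet> (x2, u2) \<ge> 0 \<and>
      (\<omega> = \<omega>0 \<longrightarrow> u1 \<noteq> 0 \<or> u2 \<noteq> 0 \<longrightarrow> doubled_form e Q (x1, u1) \<bullet> (x1, u1) + doubled_form e Q (x2, u2) \<bullet> (x2, u2) > 0)"
    if h: "(A *v fst x1, A *v snd x1) + (B1 *v fst u1, B2 *v snd u1) = - \<omega> *\<^sub>R x2"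
      "(A *v fst x2, A *v snd x2) + (B1 *v fst u2, B2 *v snd u2) = \<omega> *\<^sub>R x1" for x1 u1 \<omega> x2 u2
  proof -
    have x: "A *v fst x1 + B1 *v fst u1 = - \<omega> *\<^sub>R fst x2" "A *v fst x2 + B1 *v fst u2 = \<omega> *\<^sub>R fst x1"
      and y: "A *v snd x1 + B2 *v snd u1 = - \<omega> *\<^sub>R snd x2" "A *v snd x2 + B2 *v snd u2 = \<omega> *\<^sub>R snd x1"
      using arg_cong[OF h(1), of fst] arg_cong[OF h(1), of snd] arg_cong[OF h(2), of fst] arg_cong[OF h(2), of snd] by simp_all
    define \<alpha> \<beta> \<gamma> where "\<alpha> = form1 (fst x1) (fst x2) (fst u1) (fst u2)" and "\<beta> = form12 (fst x1) (fst x2) (fst u1) (fst u2) (snd x1) (snd x2) (snd u1) (snd u2)"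
      and "\<gamma> = form2 (snd x1) (snd x2) (snd u1) (snd u2)"
    have tot: "doubled_form e Q (x1, u1) \<bullet> (x1, u1) + doubled_form e Q (x2, u2) \<bullet> (x2, u2) = \<alpha> + \<epsilon> * \<beta> - \<gamma>"
      unfolding doubled_form_inner \<alpha>_def \<beta>_def \<gamma>_def ext1_def ext2_def
      using symmetric_matrix_inner[OF symQ, of "stack3 (snd x1) 0 (snd u1)" "stack3 (fst x1) (fst u1) 0"]
        symmetric_matrix_inner[OF symQ, of "stack3 (snd x2) 0 (snd u2)" "stack3 (fst x2) (fst u2) 0"]
      by (simp add: e_def algebra_simps)
    have 1: "\<alpha> + 2 * \<epsilon> * \<beta> - \<gamma> \<ge> 0" unfolding \<alpha>_def \<beta>_def \<gamma>_def by (rule scaled_fdi(1)[OF x y])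
    have neg: "stack3 (- a) 0 (- c) = - stack3 a (0::real^'k) c" for a :: "real^'n" and c :: "real^'q"
      using stack3_scaleR[of "-1" a 0 c] by simp
    have negAB: "A *v (- a) + B2 *v (- b) = - (A *v a + B2 *v b)" for a b
      by (simp add: linear_neg[OF matrix_vector_mul_linear])
    have y': "A *v (- snd x1) + B2 *v (- snd u1) = - \<omega> *\<^sub>R (- snd x2)" "A *v (- snd x2) + B2 *v (- snd u2) = \<omega> *\<^sub>R (- snd x1)"
      unfolding negAB y by simp_all
    have 2: "\<alpha> - 2 * \<epsilon> * \<beta> - \<gamma> \<ge> 0"
      using scaled_fdi(1)[OF x y'] unfolding \<alpha>_def \<beta>_def \<gamma>_def neg
      by (simp add: linear_neg[OF matrix_vector_mul_linear] algebra_simps)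
    have nonneg: "doubled_form e Q (x1, u1) \<bullet> (x1, u1) + doubled_form e Q (x2, u2) \<bullet> (x2, u2) \<ge> 0"
      unfolding tot using 1 2 by linarith
    have pos: "doubled_form e Q (x1, u1) \<bullet> (x1, u1) + doubled_form e Q (x2, u2) \<bullet> (x2, u2) > 0" if "\<omega> = \<omega>0" "u1 \<noteq> 0 \<or> u2 \<noteq> 0"
    proof -
      have "\<alpha> > 0 \<or> fst u1 = 0 \<and> fst u2 = 0" using scaled_fdi(2)[OF x y that(1)] unfolding \<alpha>_def by blast
      moreover have "\<gamma> < 0 \<or> snd u1 = 0 \<and> snd u2 = 0" using scaled_fdi(3)[OF x y that(1)] unfolding \<gamma>_def by blast
      moreover have "\<alpha> \<ge> 0"
        using scaled_fdi(1)[of "fst x1" "fst u1" \<omega> "fst x2" "fst u2" 0 0 0 0] x unfolding \<alpha>_def by simp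
      moreover have "\<gamma> \<le> 0"
        using scaled_fdi(1)[of 0 0 \<omega> 0 0 "snd x1" "snd u1" "snd x2" "snd u2"] y unfolding \<gamma>_def by simp
      ultimately have "\<alpha> - \<gamma> > 0" using that(2) by (auto simp: prod_eq_iff)
      thus ?thesis unfolding tot using 1 by linarith
    qed
    from nonneg pos show ?thesis by blast
  qed
  have "kyp (\<lambda>x. (A *v fst x, A *v snd x)) (\<lambda>x. (P0 *v fst x, P0 *v snd x)) (\<lambda>u. (B1 *v fst u, B2 *v snd u)) (doubled_form e Q) M \<omega>0"
  proof (rule kyp.intro)
    show "lyapunov (\<lambda>x. (A *v fst x, A *v snd x)) (\<lambda>x. (P0 *v fst x, P0 *v snd x))"
      using L.P_sym L.lyapunov_eq L.P_nonneg
      by (intro lyapunov.intro linearI) (auto simp: matrix_vector_right_distrib matrix_vector_mult_scaleR inner_prod_def)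
    show "kyp_axioms (\<lambda>x. (A *v fst x, A *v snd x)) (\<lambda>u. (B1 *v fst u, B2 *v snd u)) (doubled_form e Q) M \<omega>0"
    proof (rule kyp_axioms.intro)
      show "linear (\<lambda>u. (B1 *v fst u, B2 *v snd u))"
        by (intro linearI) (auto simp: matrix_vector_right_distrib matrix_vector_mult_scaleR)
      show "linear (doubled_form e Q)" by (rule linear_doubled_form)
      show "doubled_form e Q z \<bullet> z' = z \<bullet> doubled_form e Q z'" for z z'
        unfolding inner_commute[of z] doubled_form_inner
        using symmetric_matrix_inner[OF symQ, of "ext1 z" "ext1 z'"] symmetric_matrix_inner[OF symQ, of "ext1 z" "ext2 z'"]
          symmetric_matrix_inner[OF symQ, of "ext2 z" "ext1 z'"] symmetric_matrix_inner[OF symQ, of "ext2 z" "ext2 z'"] by simp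
      show "linear M" by (rule lM)
      show "(A *v fst y, A *v snd y) \<bullet> M x + y \<bullet> M (A *v fst x, A *v snd x) = - (fst (doubled_form e Q (y, 0)) \<bullet> x)" for x y
      proof -
        have "fst (doubled_form e Q (y, 0)) \<bullet> x = doubled_form e Q (y, 0) \<bullet> (x, 0)" by (simp add: inner_prod_def)
        also have "\<dots> = R (fst y) \<bullet> (Q *v R (fst x)) + e * (R (snd y) \<bullet> (Q *v R (fst x)) + R (fst y) \<bullet> (Q *v R (snd x)))
           - R (snd y) \<bullet> (Q *v R (snd x))"
          unfolding doubled_form_inner
          using symmetric_matrix_inner[OF symQ, of "R (fst x)" "R (fst y)"] symmetric_matrix_inner[OF symQ, of "R (fst x)" "R (snd y)"]
           symmetric_matrix_inner[OF symQ, of "R (snd x)" "R (fst y)"] symmetric_matrix_inner[OF symQ, of "R (snd x)" "R (snd y)"]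
          by (simp add: ext1_def ext2_def R_def)
        finally have rhs: "fst (doubled_form e Q (y, 0)) \<bullet> x = R (fst y) \<bullet> (Q *v R (fst x)) + e * (R (snd y) \<bullet> (Q *v R (fst x)) + R (fst y) \<bullet> (Q *v R (snd x)))
           - R (snd y) \<bullet> (Q *v R (snd x))" .
        define a where "a y x = (A *v y) \<bullet> (X *v x) + y \<bullet> (X *v (A *v x))" for y x
        have "(A *v fst y, A *v snd y) \<bullet> M x + y \<bullet> M (A *v fst x, A *v snd x)
          = a (fst y) (fst x) + e * (a (snd y) (fst x) + a (fst y) (snd x)) - a (snd y) (snd x)"
          by (simp add: M_def a_def inner_prod_def inner_add_right inner_diff_right algebra_simps)
        also have "\<dots> = - (fst (doubled_form e Q (y, 0)) \<bullet> x)"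
          unfolding rhs a_def X' by (simp add: algebra_simps)
        finally show ?thesis .
      qed
    qed (use core in blast)+
  qed
  thus thesis using that unfolding e_def by blast
qed

end

section \<open>Responses and their energy forms\<close>

lemma L2_eq: "L2 = {u. square_integrable u}"
  by (simp add: L2_def square_integrable_def integral_half_line)

lemma L2norm_eq: "L2norm u = sqrt (\<integral>t. (norm (u t))\<^sup>2 \<partial>half_line)"
  by (simp add: L2norm_def integral_half_line)

lemma L2norm_nonneg: "0 \<le> L2norm u"
  unfolding L2norm_eq by (intro real_sqrt_ge_zero Bochner_Integration.integral_nonneg) simp

lemma L2norm_power2: "(L2norm u)\<^sup>2 = (\<integral>t. (norm (u t))\<^sup>2 \<partial>half_line)"
  unfolding L2norm_eq by (intro real_sqrt_pow2 Bochner_Integration.integral_nonneg) simp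

lemma quadratic_discriminant:
  fixes a b c :: real
  assumes "\<And>t. a + 2 * b * t + c * t\<^sup>2 \<ge> 0"
  shows "a \<ge> 0" "c \<ge> 0" "b\<^sup>2 \<le> a * c"
proof -
  show a: "a \<ge> 0" using assms[of 0] by simp
  show c: "c \<ge> 0"
  proof (rule ccontr)
    assume "\<not> c \<ge> 0"
    hence c: "c < 0" by simp
    \<comment> \<open>Far enough out for the negative leading term to outweigh a + 2 |b| t.\<close>
    define t where "t = 1 + (a + 2 * \<bar>b\<bar>) / (- c)"
    have "(a + 2 * \<bar>b\<bar>) / (- c) \<ge> 0" by (rule divide_nonneg_pos) (use a c in auto)
    hence t1: "t \<ge> 1" unfolding t_def by linarith
    have "- c * t = - c + (a + 2 * \<bar>b\<bar>)" using c by (simp add: t_def field_simps)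
    hence "c * t < - (a + 2 * \<bar>b\<bar>)" using c by linarith
    hence "c * t * t < - (a + 2 * \<bar>b\<bar>) * t" using t1 by (intro mult_strict_right_mono) auto
    moreover have "a \<le> a * t" using a t1 by (simp add: mult_le_cancel_left1)
    moreover have "2 * b * t \<le> 2 * \<bar>b\<bar> * t" using t1 by (intro mult_right_mono) auto
    ultimately have "a + 2 * b * t + c * t\<^sup>2 < 0" by (simp add: power2_eq_square algebra_simps)
    thus False using assms[of t] by linarith
  qed
  show "b\<^sup>2 \<le> a * c"
  proof (cases "c = 0")
    case True
    have "b = 0"
    proof (rule ccontr)
      assume "b \<noteq> 0"
      thus False using assms[of "- (a + 1) / (2 * b)"] True by (simp add: field_simps)
    qed
    thus ?thesis using True by simp
  next
    case False
    hence "c > 0" using c by simp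
    thus ?thesis using assms[of "- b / c"] by (simp add: field_simps power2_eq_square)
  qed
qed

lemma square_integrable_Cauchy_Schwarz:
  assumes f: "square_integrable f" and h: "square_integrable h"
  shows "(\<integral>t. f t \<bullet> h t \<partial>half_line)\<^sup>2 \<le> (\<integral>t. (norm (f t))\<^sup>2 \<partial>half_line) * (\<integral>t. (norm (h t))\<^sup>2 \<partial>half_line)"
proof (rule quadratic_discriminant(3))
  fix r :: real
  have i: "integrable half_line (\<lambda>t. f t \<bullet> f t)" "integrable half_line (\<lambda>t. f t \<bullet> h t)" "integrable half_line (\<lambda>t. h t \<bullet> h t)"
    by (intro square_integrable_inner f h)+
  have "0 \<le> (\<integral>t. (f t + r *\<^sub>R h t) \<bullet> (f t + r *\<^sub>R h t) \<partial>half_line)" by (rule Bochner_Integration.integral_nonneg) simp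
  also have "\<dots> = (\<integral>t. f t \<bullet> f t + (2 * r * (f t \<bullet> h t) + r\<^sup>2 * (h t \<bullet> h t)) \<partial>half_line)"
    by (simp add: inner_add_left inner_add_right inner_commute power2_eq_square algebra_simps)
  also have "\<dots> = (\<integral>t. f t \<bullet> f t \<partial>half_line) + (2 * r * (\<integral>t. f t \<bullet> h t \<partial>half_line) + r\<^sup>2 * (\<integral>t. h t \<bullet> h t \<partial>half_line))"
    using i by simp
  finally show "0 \<le> (\<integral>t. (norm (f t))\<^sup>2 \<partial>half_line) + 2 * (\<integral>t. f t \<bullet> h t \<partial>half_line) * r + (\<integral>t. (norm (h t))\<^sup>2 \<partial>half_line) * r\<^sup>2"
    by (simp add: power2_norm_eq_inner mult_ac)
qed

context
  fixes A :: "real^'n^'n" and B1 :: "real^'k^'n" and B2 :: "real^'q^'n"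
begin

definition response where "response a v w t = stack3 (traj A B1 B2 a v w t) (v t) (w t)"

text \<open>The definite description in \<open>traj\<close> denotes: a solution exists, and two
  candidates differ by a solution of the homogeneous equation with initial value zero.\<close>

lemma primitive_traj:
  assumes v: "square_integrable v" and w: "square_integrable w"
  shows "primitive (traj A B1 B2 a v w) (\<lambda>t. A *v traj A B1 B2 a v w t + (B1 *v v t + B2 *v w t)) a"
proof -
  define b where "b t = B1 *v v t + B2 *v w t" for t
  have sb: "square_integrable b"
    unfolding b_def by (intro square_integrable_add square_integrable_linear[OF v] square_integrable_linear[OF w] matrix_vector_mul_linear)
  obtain x0 where x0: "primitive x0 (\<lambda>t. A *v x0 t + b t) a"
    using ode_solution_exists[OF matrix_vector_mul_linear primitive_exists[OF sb]] by blast
  \<comment> \<open>The description prescribes the value a at negative times; without this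
    normalization it would not be unique.\<close>
  define x where "x t = (if t < 0 then a else x0 t)" for t
  have px: "primitive x (\<lambda>t. A *v x t + b t) a" by (rule primitive_cong[OF x0]) (simp_all add: x_def)
  have "traj A B1 B2 a v w = x" unfolding traj_def
  proof (rule the_equality)
    show "(\<forall>t<0. x t = a) \<and> (\<forall>t\<ge>0. (\<lambda>\<tau>. A *v x \<tau> + B1 *v v \<tau> + B2 *v w \<tau>) integrable_on {0..t} \<and>
              x t = a + integral {0..t} (\<lambda>\<tau>. A *v x \<tau> + B1 *v v \<tau> + B2 *v w \<tau>))"
      using primitive_HK[OF px] by (auto simp: b_def add.assoc) (simp add: x_def)
  next
    fix y assume y: "(\<forall>t<0. y t = a) \<and> (\<forall>t\<ge>0. (\<lambda>\<tau>. A *v y \<tau> + B1 *v v \<tau> + B2 *v w \<tau>) integrable_on {0..t} \<and>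
              y t = a + integral {0..t} (\<lambda>\<tau>. A *v y \<tau> + B1 *v v \<tau> + B2 *v w \<tau>))"
    have yb: "(\<lambda>\<tau>. A *v y \<tau> + b \<tau>) integrable_on {0..t}" "y t = a + integral {0..t} (\<lambda>\<tau>. A *v y \<tau> + b \<tau>)" if "t \<ge> 0" for t
      using y that by (simp_all add: b_def add.assoc)
    have "(\<lambda>s. A *v (y s - x s)) integrable_on {0..t} \<and> y t - x t = integral {0..t} (\<lambda>s. A *v (y s - x s))" if t: "t \<ge> 0" for t
    proof -
      have e: "(\<lambda>s. A *v (y s - x s)) = (\<lambda>s. (A *v y s + b s) - (A *v x s + b s))"
        by (simp add: matrix_vector_mult_diff_distrib)
      show ?thesis unfolding e
        using integrable_diff[OF yb(1)[OF t] primitive_HK(1)[OF px t]] integral_diff[OF yb(1)[OF t] primitive_HK(1)[OF px t]]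
          arg_cong2[OF yb(2)[OF t] primitive_HK(2)[OF px t], of minus] by simp
    qed
    hence "y t - x t = 0" if "t \<ge> 0" for t
      by (rule ode_zero_unique[OF matrix_vector_mul_linear _ that])
    moreover have "y t = x t" if "t < 0" for t using y that by (simp add: x_def)
    ultimately show "y = x" by (intro ext) (metis eq_iff_diff_eq_0 not_le)
  qed
  thus ?thesis using px by (simp add: b_def)
qed

lemma traj_combination:
  assumes "square_integrable v" "square_integrable w" "square_integrable v'" "square_integrable w'" and t: "t \<ge> 0"
  shows "traj A B1 B2 (r *\<^sub>R a + s *\<^sub>R a') (\<lambda>t. r *\<^sub>R v t + s *\<^sub>R v' t) (\<lambda>t. r *\<^sub>R w t + s *\<^sub>R w' t) t
    = r *\<^sub>R traj A B1 B2 a v w t + s *\<^sub>R traj A B1 B2 a' v' w' t"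
proof -
  define x where "x = traj A B1 B2 a v w"
  define x' where "x' = traj A B1 B2 a' v' w'"
  define y where "y = traj A B1 B2 (r *\<^sub>R a + s *\<^sub>R a') (\<lambda>t. r *\<^sub>R v t + s *\<^sub>R v' t) (\<lambda>t. r *\<^sub>R w t + s *\<^sub>R w' t)"
  have lin: "linear (\<lambda>z::real^'n. r *\<^sub>R z)" for r by (simp add: linear_iff algebra_simps)
  note px = primitive_traj[OF assms(1,2), of a, folded x_def]
  note px' = primitive_traj[OF assms(3,4), of a', folded x'_def]
  have py: "primitive y (\<lambda>t. A *v y t + (B1 *v (r *\<^sub>R v t + s *\<^sub>R v' t) + B2 *v (r *\<^sub>R w t + s *\<^sub>R w' t))) (r *\<^sub>R a + s *\<^sub>R a')"
    unfolding y_def by (intro primitive_traj square_integrable_add square_integrable_scaleR assms)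
  define d where "d t = y t - (r *\<^sub>R x t + s *\<^sub>R x' t)" for t
  note pd = primitive_add[OF py primitive_linear[OF primitive_add[OF primitive_linear[OF px lin[of r]] primitive_linear[OF px' lin[of s]]] lin[of "-1"]]]
  have "primitive d (\<lambda>t. A *v d t) (r *\<^sub>R a + s *\<^sub>R a' + - 1 *\<^sub>R (r *\<^sub>R a + s *\<^sub>R a'))"
    by (rule primitive_cong[OF pd])
      (simp_all add: d_def matrix_vector_right_distrib matrix_vector_mult_scaleR matrix_vector_mult_diff_distrib algebra_simps)
  hence pd0: "primitive d (\<lambda>t. A *v d t) 0" by simp
  have "(\<lambda>s. A *v d s) integrable_on {0..t} \<and> d t = integral {0..t} (\<lambda>s. A *v d s)" if "t \<ge> 0" for t
    using primitive_HK[OF pd0 that] by simp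
  from ode_zero_unique[OF matrix_vector_mul_linear this t] have "d t = 0" .
  thus ?thesis unfolding d_def right_minus_eq x_def x'_def y_def .
qed

lemma response_combination:
  assumes "square_integrable v" "square_integrable w" "square_integrable v'" "square_integrable w'" "t \<ge> 0"
  shows "response (r *\<^sub>R a + s *\<^sub>R a') (\<lambda>t. r *\<^sub>R v t + s *\<^sub>R v' t) (\<lambda>t. r *\<^sub>R w t + s *\<^sub>R w' t) t
    = r *\<^sub>R response a v w t + s *\<^sub>R response a' v' w' t"
  unfolding response_def traj_combination[OF assms] by (simp add: stack3_add stack3_scaleR)

lemma response_bound:
  assumes "hurwitz A"
  shows "\<exists>C\<ge>0. \<forall>a v w. square_integrable v \<longrightarrow> square_integrable w \<longrightarrow> square_integrable (response a v w) \<and>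
    (\<integral>t. (norm (response a v w t))\<^sup>2 \<partial>half_line) \<le> C * ((norm a)\<^sup>2 + (L2norm v)\<^sup>2 + (L2norm w)\<^sup>2)"
proof -
  obtain P where "lyapunov ((*v) A) ((*v) P)" using hurwitz_lyapunov[OF assms] by blast
  then interpret lyapunov "(*v) A" "(*v) P" .
  obtain C where C: "C \<ge> 0" "\<And>x b a. primitive x (\<lambda>t. A *v x t + b t) a \<Longrightarrow> square_integrable b \<Longrightarrow>
     square_integrable x \<and> (\<integral>t. (norm (x t))\<^sup>2 \<partial>half_line) \<le> C * ((norm a)\<^sup>2 + (\<integral>t. (norm (b t))\<^sup>2 \<partial>half_line))"
    using state_bound by blast
  define F where "F u = B1 *v fst u + B2 *v snd u" for u
  have lF: "linear F" unfolding F_def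
    by (rule linearI) (simp_all add: matrix_vector_right_distrib matrix_vector_mult_scaleR algebra_simps)
  obtain m where m: "m > 0" "\<And>u. norm (F u) \<le> m * norm u" using linear_bounded_pos[OF lF] by blast
  have "square_integrable (response a v w) \<and>
    (\<integral>t. (norm (response a v w t))\<^sup>2 \<partial>half_line) \<le> (C * (1 + m\<^sup>2) + 1) * ((norm a)\<^sup>2 + (L2norm v)\<^sup>2 + (L2norm w)\<^sup>2)"
    if v: "square_integrable v" and w: "square_integrable w" for a v w
  proof -
    define x where "x = traj A B1 B2 a v w"
    have sb: "square_integrable (\<lambda>t. F (v t, w t))"
      by (rule square_integrable_linear[OF square_integrable_Pair[OF v w] lF])
    have "primitive x (\<lambda>t. A *v x t + F (v t, w t)) a" using primitive_traj[OF v w, of a] by (simp add: x_def F_def)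
    from C(2)[OF this sb] have sx: "square_integrable x"
      and bx: "(\<integral>t. (norm (x t))\<^sup>2 \<partial>half_line) \<le> C * ((norm a)\<^sup>2 + (\<integral>t. (norm (F (v t, w t)))\<^sup>2 \<partial>half_line))" by auto
    have i: "integrable half_line (\<lambda>t. (norm (v t))\<^sup>2)" "integrable half_line (\<lambda>t. (norm (w t))\<^sup>2)" "integrable half_line (\<lambda>t. (norm (x t))\<^sup>2)"
      "integrable half_line (\<lambda>t. (norm (F (v t, w t)))\<^sup>2)"
      using v w sx sb by (simp_all add: square_integrable_def)
    have "(\<integral>t. (norm (F (v t, w t)))\<^sup>2 \<partial>half_line) \<le> (\<integral>t. m\<^sup>2 * ((norm (v t))\<^sup>2 + (norm (w t))\<^sup>2) \<partial>half_line)"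
    proof (rule integral_mono)
      show "(norm (F (v t, w t)))\<^sup>2 \<le> m\<^sup>2 * ((norm (v t))\<^sup>2 + (norm (w t))\<^sup>2)" for t
        using power_mono[OF m(2)[of "(v t, w t)"], of 2] by (simp add: power_mult_distrib norm_Pair)
    qed (use i in simp_all)
    also have "\<dots> = m\<^sup>2 * ((L2norm v)\<^sup>2 + (L2norm w)\<^sup>2)" using i by (simp add: L2norm_power2)
    finally have bF: "(\<integral>t. (norm (F (v t, w t)))\<^sup>2 \<partial>half_line) \<le> m\<^sup>2 * ((L2norm v)\<^sup>2 + (L2norm w)\<^sup>2)" .
    have lst: "linear (\<lambda>z. stack3 (fst z) (fst (snd z)) (snd (snd z)) :: real^('n + ('k + 'q)))"
      by (rule linearI) (simp_all add: stack3_add stack3_scaleR)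
    have sr: "square_integrable (response a v w)"
      using square_integrable_linear[OF square_integrable_Pair[OF sx square_integrable_Pair[OF v w]] lst]
      by (simp add: response_def[abs_def] x_def)
    have "(norm (response a v w t))\<^sup>2 = (norm (x t))\<^sup>2 + ((norm (v t))\<^sup>2 + (norm (w t))\<^sup>2)" for t
      by (simp add: power2_norm_eq_inner response_def inner_stack3 x_def)
    hence "(\<integral>t. (norm (response a v w t))\<^sup>2 \<partial>half_line) = (\<integral>t. (norm (x t))\<^sup>2 \<partial>half_line) + ((L2norm v)\<^sup>2 + (L2norm w)\<^sup>2)"
      using i by (simp add: L2norm_power2)
    also have "\<dots> \<le> C * ((norm a)\<^sup>2 + m\<^sup>2 * ((L2norm v)\<^sup>2 + (L2norm w)\<^sup>2)) + ((L2norm v)\<^sup>2 + (L2norm w)\<^sup>2)"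
      using bx mult_left_mono[OF add_left_mono[OF bF] C(1), of "(norm a)\<^sup>2"] by linarith
    also have "\<dots> \<le> C * ((1 + m\<^sup>2) * (norm a)\<^sup>2 + (1 + m\<^sup>2) * ((L2norm v)\<^sup>2 + (L2norm w)\<^sup>2)) + ((norm a)\<^sup>2 + (L2norm v)\<^sup>2 + (L2norm w)\<^sup>2)"
      using C(1) by (intro add_mono mult_left_mono) (auto simp: algebra_simps)
    also have "\<dots> = (C * (1 + m\<^sup>2) + 1) * ((norm a)\<^sup>2 + (L2norm v)\<^sup>2 + (L2norm w)\<^sup>2)" by (simp add: algebra_simps)
    finally show ?thesis using sr by blast
  qed
  moreover have "C * (1 + m\<^sup>2) + 1 \<ge> 0" using C(1) by simp
  ultimately show ?thesis by blast
qed

end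

section \<open>Integrals of quadratic forms over the half line\<close>

definition qform :: "real^'m^'m \<Rightarrow> (real \<Rightarrow> real^'m) \<Rightarrow> (real \<Rightarrow> real^'m) \<Rightarrow> real" where
  "qform Q f h = (\<integral>t. f t \<bullet> (Q *v h t) \<partial>half_line)"

lemma qform_integrable:
  fixes Q :: "real^'m^'m" and f h :: "real \<Rightarrow> real^'m"
  assumes f: "square_integrable f" and h: "square_integrable h"
  shows "integrable half_line (\<lambda>t. f t \<bullet> (Q *v h t))"
  by (rule square_integrable_inner[OF f square_integrable_linear[OF h matrix_vector_mul_linear]])

lemma qform_cong:
  "(\<And>t. t \<ge> 0 \<Longrightarrow> f t = f' t) \<Longrightarrow> (\<And>t. t \<ge> 0 \<Longrightarrow> h t = h' t) \<Longrightarrow> qform Q f h = qform Q f' h'"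
  unfolding qform_def by (intro Bochner_Integration.integral_cong) auto

lemma qform_combination:
  assumes Q: "transpose Q = Q" and f: "square_integrable f" and h: "square_integrable h"
  shows "qform Q (\<lambda>t. r *\<^sub>R f t + s *\<^sub>R h t) (\<lambda>t. r *\<^sub>R f t + s *\<^sub>R h t)
    = r\<^sup>2 * qform Q f f + 2 * r * s * qform Q f h + s\<^sup>2 * qform Q h h"
proof -
  have "qform Q (\<lambda>t. r *\<^sub>R f t + s *\<^sub>R h t) (\<lambda>t. r *\<^sub>R f t + s *\<^sub>R h t)
    = (\<integral>t. r\<^sup>2 * (f t \<bullet> (Q *v f t)) + (2 * r * s * (f t \<bullet> (Q *v h t)) + s\<^sup>2 * (h t \<bullet> (Q *v h t))) \<partial>half_line)"
    unfolding qform_def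
  proof (intro Bochner_Integration.integral_cong refl)
    fix t
    show "(r *\<^sub>R f t + s *\<^sub>R h t) \<bullet> (Q *v (r *\<^sub>R f t + s *\<^sub>R h t)) =
         r\<^sup>2 * (f t \<bullet> (Q *v f t)) + (2 * r * s * (f t \<bullet> (Q *v h t)) + s\<^sup>2 * (h t \<bullet> (Q *v h t)))"
      using symmetric_matrix_inner[OF Q, of "h t" "f t"]
      by (simp add: matrix_vector_right_distrib matrix_vector_mult_scaleR inner_add_left inner_add_right power2_eq_square algebra_simps)
  qed
  thus ?thesis using qform_integrable[OF f f] qform_integrable[OF f h] qform_integrable[OF h h] by (simp add: qform_def)
qed

lemma qform_bound:
  "\<exists>c\<ge>0. \<forall>f h. square_integrable f \<longrightarrow> square_integrable h \<longrightarrow> \<bar>qform Q f h\<bar> \<le> c * L2norm f * L2norm h"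
proof -
  obtain c where c: "c > 0" "\<And>z. norm (Q *v z) \<le> c * norm z" using linear_bounded_pos[OF matrix_vector_mul_linear[of Q]] by blast
  have "\<bar>qform Q f h\<bar> \<le> c * L2norm f * L2norm h" if f: "square_integrable f" and h: "square_integrable h" for f h
  proof -
    have Qh: "square_integrable (\<lambda>t. Q *v h t)" by (rule square_integrable_linear[OF h matrix_vector_mul_linear])
    have "(\<integral>t. (norm (Q *v h t))\<^sup>2 \<partial>half_line) \<le> (\<integral>t. c\<^sup>2 * (norm (h t))\<^sup>2 \<partial>half_line)"
    proof (rule integral_mono)
      show "(norm (Q *v h t))\<^sup>2 \<le> c\<^sup>2 * (norm (h t))\<^sup>2" for t
        using power_mono[OF c(2)[of "h t"], of 2] by (simp add: power_mult_distrib)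
    qed (use Qh h in \<open>simp_all add: square_integrable_def\<close>)
    hence "(\<integral>t. (norm (Q *v h t))\<^sup>2 \<partial>half_line) \<le> (c * L2norm h)\<^sup>2" by (simp add: power_mult_distrib L2norm_power2)
    hence "(L2norm f)\<^sup>2 * (\<integral>t. (norm (Q *v h t))\<^sup>2 \<partial>half_line) \<le> (L2norm f)\<^sup>2 * (c * L2norm h)\<^sup>2" by (rule mult_left_mono) simp
    hence "(qform Q f h)\<^sup>2 \<le> (L2norm f * (c * L2norm h))\<^sup>2"
      using square_integrable_Cauchy_Schwarz[OF f Qh] by (simp add: qform_def L2norm_power2 power_mult_distrib)
    hence "\<bar>qform Q f h\<bar>\<^sup>2 \<le> (L2norm f * (c * L2norm h))\<^sup>2" by simp
    hence "\<bar>qform Q f h\<bar> \<le> L2norm f * (c * L2norm h)"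
      by (rule power2_le_imp_le) (intro mult_nonneg_nonneg L2norm_nonneg less_imp_le[OF c(1)])
    thus ?thesis by (simp add: mult_ac)
  qed
  thus ?thesis using c(1) by (intro exI[of _ c]) auto
qed

section \<open>Minimax for strongly convex-concave functions\<close>

text \<open>V and W carry no topology; convexity and concavity are exact second-order identities
  along segments. \<open>(d v v0)\<^sup>2\<close> is the quadratic part of g in v, the same for all
  w, and \<open>(e w w0)\<^sup>2\<close> the one in w. Since d and e may be much weaker than a norm,
  compactness and completeness are replaced by the bound of the coupling through d and e.\<close>

locale convex_concave =
  fixes V :: "'v set" and W :: "'w set" and g :: "'v \<Rightarrow> 'w \<Rightarrow> real"
    and d :: "'v \<Rightarrow> 'v \<Rightarrow> real" and e :: "'w \<Rightarrow> 'w \<Rightarrow> real" and K :: real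
  assumes ne: "V \<noteq> {}" "W \<noteq> {}"
    and nonneg: "0 \<le> d v v0" "0 \<le> e w w0" "0 \<le> K"
    and convex: "v0 \<in> V \<Longrightarrow> v \<in> V \<Longrightarrow> 0 \<le> t \<Longrightarrow> t \<le> 1 \<Longrightarrow> \<exists>vt\<in>V. d vt v0 = t * d v v0 \<and>
        (\<forall>w\<in>W. g vt w = (1 - t) * g v0 w + t * g v w - t * (1 - t) * (d v v0)\<^sup>2)"
    and concave: "w0 \<in> W \<Longrightarrow> w \<in> W \<Longrightarrow> 0 \<le> t \<Longrightarrow> t \<le> 1 \<Longrightarrow> \<exists>wt\<in>W. e wt w0 = t * e w w0 \<and>
        (\<forall>v\<in>V. g v wt = (1 - t) * g v w0 + t * g v w + t * (1 - t) * (e w w0)\<^sup>2)"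
    and coupling: "v0 \<in> V \<Longrightarrow> v \<in> V \<Longrightarrow> w0 \<in> W \<Longrightarrow> w \<in> W \<Longrightarrow>
        \<bar>g v w - g v0 w - g v w0 + g v0 w0\<bar> \<le> K * d v v0 * e w w0"
    and bounded_below: "w \<in> W \<Longrightarrow> \<exists>c. \<forall>v\<in>V. c \<le> g v w"
    and bounded_above: "v \<in> V \<Longrightarrow> \<exists>c. \<forall>w\<in>W. g v w \<le> c"
begin

lemma swap: "convex_concave W V (\<lambda>w v. - g v w) e d K"
proof
  show "\<exists>wt\<in>W. e wt w0 = t * e w w0 \<and>
      (\<forall>v\<in>V. - g v wt = (1 - t) * - g v w0 + t * - g v w - t * (1 - t) * (e w w0)\<^sup>2)"
    if "w0 \<in> W" "w \<in> W" "0 \<le> t" "t \<le> 1" for w0 w t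
    using concave[OF that] by (auto simp: algebra_simps)
  show "\<exists>vt\<in>V. d vt v0 = t * d v v0 \<and>
      (\<forall>w\<in>W. - g vt w = (1 - t) * - g v0 w + t * - g v w + t * (1 - t) * (d v v0)\<^sup>2)"
    if "v0 \<in> V" "v \<in> V" "0 \<le> t" "t \<le> 1" for v0 v t
    using convex[OF that] by (auto simp: algebra_simps)
  show "\<bar>- g v w - - g v w0 - - g v0 w + - g v0 w0\<bar> \<le> K * e w w0 * d v v0"
    if "w0 \<in> W" "w \<in> W" "v0 \<in> V" "v \<in> V" for w0 w v0 v
    using coupling[OF that(3,4,1,2)] by (simp add: mult_ac abs_if split: if_splits)
  show "\<exists>c. \<forall>w\<in>W. c \<le> - g v w" if "v \<in> V" for v
  proof -
    from bounded_above[OF that] obtain c where "\<forall>w\<in>W. g v w \<le> c" by blast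
    thus ?thesis by (intro exI[of _ "-c"]) auto
  qed
  show "\<exists>c. \<forall>v\<in>V. - g v w \<le> c" if "w \<in> W" for w
  proof -
    from bounded_below[OF that] obtain c where "\<forall>v\<in>V. c \<le> g v w" by blast
    thus ?thesis by (intro exI[of _ "-c"]) auto
  qed
qed (use ne nonneg in auto)

definition lower :: "'w \<Rightarrow> real" where "lower w = (INF v\<in>V. g v w)"

lemma bdd_below_image: "w \<in> W \<Longrightarrow> bdd_below ((\<lambda>v. g v w) ` V)"
  using bounded_below[of w] by (auto simp: bdd_below_def)

lemma lower_le: "w \<in> W \<Longrightarrow> v \<in> V \<Longrightarrow> lower w \<le> g v w"
  unfolding lower_def by (rule cINF_lower[OF bdd_below_image])

lemma lower_greatest: "(\<And>v. v \<in> V \<Longrightarrow> c \<le> g v w) \<Longrightarrow> c \<le> lower w"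
  unfolding lower_def using ne by (intro cINF_greatest) auto

lemma ereal_lower: "w \<in> W \<Longrightarrow> (INF v\<in>V. ereal (g v w)) = ereal (lower w)"
  unfolding lower_def using ereal_Inf'[OF bdd_below_image] ne by (simp add: image_image)

lemma near_minimizer:
  assumes "w0 \<in> W" "\<eta> > 0"
  obtains v0 where "v0 \<in> V" "g v0 w0 \<le> lower w0 + \<eta>"
proof -
  have "lower w0 < lower w0 + \<eta>" using assms by simp
  hence "\<exists>v\<in>V. g v w0 < lower w0 + \<eta>"
    using cINF_less_iff[OF ne(1) bdd_below_image[OF assms(1)]] unfolding lower_def by blast
  thus thesis using that by (meson less_imp_le)
qed

text \<open>Compare with the midpoint between v0 and v, whose value is at least g v0 w - \<eta>.
  Doubling the convexity identity at 1/2 gives the loss 2 \<eta> and the gain d^2/2.\<close>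

lemma near_minimizer_growth:
  assumes "v0 \<in> V" "v \<in> V" "w \<in> W" "g v0 w \<le> lower w + \<eta>"
  shows "g v w \<ge> g v0 w - 2 * \<eta> + (d v v0)\<^sup>2 / 2"
proof -
  obtain vt where "vt \<in> V" "g vt w = (1 - 1/2) * g v0 w + 1/2 * g v w - 1/2 * (1 - 1/2) * (d v v0)\<^sup>2"
    using convex[OF assms(1,2), of "1/2"] assms(3) by auto
  moreover have "g vt w \<ge> g v0 w - \<eta>" using lower_le[OF assms(3) \<open>vt \<in> V\<close>] assms(4) by simp
  ultimately show ?thesis by (simp add: field_simps)
qed

text \<open>A near-minimizer for w0 stays nearly optimal for w: its quadratic growth in d absorbs
  the coupling K d e at the price of (K e)^2/2.\<close>

lemma lower_approx:
  assumes "v0 \<in> V" "w0 \<in> W" "w \<in> W" "g v0 w0 \<le> lower w0 + \<eta>"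
  shows "lower w \<ge> g v0 w - 2 * \<eta> - (K * e w w0)\<^sup>2 / 2"
proof (rule lower_greatest)
  fix v assume v: "v \<in> V"
  have "g v w \<ge> g v w0 + g v0 w - g v0 w0 - K * d v v0 * e w w0"
    using coupling[OF assms(1) v assms(2,3)] by linarith
  moreover have "g v w0 \<ge> g v0 w0 - 2 * \<eta> + (d v v0)\<^sup>2 / 2"
    by (rule near_minimizer_growth[OF assms(1) v assms(2,4)])
  moreover have "(d v v0 - K * e w w0)\<^sup>2 \<ge> 0" by simp
  hence "(d v v0)\<^sup>2 / 2 - K * d v v0 * e w w0 \<ge> - ((K * e w w0)\<^sup>2 / 2)"
    by (simp add: power2_eq_square algebra_simps)
  ultimately show "g v0 w - 2 * \<eta> - (K * e w w0)\<^sup>2 / 2 \<le> g v w" by linarith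
qed

lemma lower_continuous:
  assumes w0: "w0 \<in> W" and r: "r > 0"
    and N: "\<And>w. w \<in> W \<Longrightarrow> 0 \<le> N w"
    and dom: "\<And>w. w \<in> W \<Longrightarrow> e w w0 \<le> C * N w"
    and cont: "\<And>v s. v \<in> V \<Longrightarrow> s > 0 \<Longrightarrow> \<exists>\<delta>>0. \<forall>w\<in>W. N w < \<delta> \<longrightarrow> \<bar>g v w - g v w0\<bar> < s"
  shows "\<exists>\<delta>>0. \<forall>w\<in>W. N w < \<delta> \<longrightarrow> \<bar>lower w - lower w0\<bar> < r"
proof -
  \<comment> \<open>The budget: twice r/8 from v0, r/4 from the variation of g v0, and half of r/4
    from (K e)^2 make at most 5r/8 in either direction.\<close>
  obtain v0 where v0: "v0 \<in> V" "g v0 w0 \<le> lower w0 + r/8" using near_minimizer[OF w0, of "r/8"] r by auto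
  obtain \<delta>1 where \<delta>1: "\<delta>1 > 0" "\<And>w. w \<in> W \<Longrightarrow> N w < \<delta>1 \<Longrightarrow> \<bar>g v0 w - g v0 w0\<bar> < r/4"
    using cont[OF v0(1), of "r/4"] r by auto
  \<comment> \<open>Dominates K * C whatever the sign of C; the summand 1 makes it a valid
    divisor.\<close>
  define D where "D = 1 + K * \<bar>C\<bar>"
  have D: "D > 0" using nonneg(3) by (simp add: D_def add_pos_nonneg)
  define \<delta> where "\<delta> = min \<delta>1 (sqrt (r/4) / D)"
  have "\<bar>lower w - lower w0\<bar> < r" if w: "w \<in> W" "N w < \<delta>" for w
  proof -
    have "K * C \<le> D" using nonneg(3) abs_ge_self[of C] mult_left_mono[of C "\<bar>C\<bar>" K] by (simp add: D_def)
    hence "K * C * N w \<le> D * N w" using N[OF w(1)] by (rule mult_right_mono)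
    hence Ke: "K * e w w0 \<le> D * N w"
      using mult_left_mono[OF dom[OF w(1)] nonneg(3)] by (simp add: mult.assoc)
    have "N w < sqrt (r/4) / D" using w(2) by (simp add: \<delta>_def)
    hence "D * N w < sqrt (r/4)" using D by (simp add: field_simps)
    hence "K * e w w0 < sqrt (r/4)" using Ke by linarith
    hence "(K * e w w0)\<^sup>2 < (sqrt (r/4))\<^sup>2" using nonneg by (intro power_strict_mono) auto
    hence K2: "(K * e w w0)\<^sup>2 < r/4" using r by simp
    have a: "\<bar>g v0 w - g v0 w0\<bar> < r/4" using w \<delta>1(2) by (simp add: \<delta>_def)
    have "lower w \<ge> g v0 w - 2 * (r/8) - (K * e w w0)\<^sup>2 / 2" by (rule lower_approx[OF v0(1) w0 w(1) v0(2)])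
    moreover have "lower w \<le> g v0 w" "lower w0 \<le> g v0 w0" using lower_le v0(1) w(1) w0 by auto
    ultimately show ?thesis using a K2 v0(2) by linarith
  qed
  moreover have "\<delta> > 0" using \<delta>1 D r by (simp add: \<delta>_def)
  ultimately show ?thesis by blast
qed

end

section \<open>The upper value and the minimax equality\<close>

context convex_concave begin

interpretation sw: convex_concave W V "\<lambda>w v. - g v w" e d K by (rule swap)

definition upper :: "'v \<Rightarrow> real" where "upper v = (SUP w\<in>W. g v w)"

lemma upper_conv: "v \<in> V \<Longrightarrow> upper v = - sw.lower v"
  unfolding upper_def sw.lower_def Inf_real_def by (simp add: image_image)

lemma upper_ge: "v \<in> V \<Longrightarrow> w \<in> W \<Longrightarrow> g v w \<le> upper v"
  using sw.lower_le[of v w] by (simp add: upper_conv)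

lemma ereal_upper: "v \<in> V \<Longrightarrow> (SUP w\<in>W. ereal (g v w)) = ereal (upper v)"
proof -
  assume v: "v \<in> V"
  obtain w where w: "w \<in> W" using ne by blast
  have "(SUP w\<in>W. ereal (g v w)) \<le> ereal (upper v)" using upper_ge[OF v] by (intro SUP_least) simp
  moreover have "ereal (g v w) \<le> (SUP w\<in>W. ereal (g v w))" using w by (rule SUP_upper)
  ultimately show ?thesis unfolding upper_def by (intro ereal_SUP[symmetric]) auto
qed

lemma near_maximizer:
  assumes "v0 \<in> V" "\<eta> > 0"
  obtains w0 where "w0 \<in> W" "upper v0 \<le> g v0 w0 + \<eta>"
proof -
  obtain w0 where "w0 \<in> W" "- g v0 w0 \<le> sw.lower v0 + \<eta>" using sw.near_minimizer[OF assms] by blast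
  thus thesis using that upper_conv[OF assms(1)] by simp
qed

lemma upper_continuous:
  assumes v0: "v0 \<in> V" and r: "r > 0"
    and N: "\<And>v. v \<in> V \<Longrightarrow> 0 \<le> N v"
    and dom: "\<And>v. v \<in> V \<Longrightarrow> d v v0 \<le> C * N v"
    and cont: "\<And>w s. w \<in> W \<Longrightarrow> s > 0 \<Longrightarrow> \<exists>\<delta>>0. \<forall>v\<in>V. N v < \<delta> \<longrightarrow> \<bar>g v w - g v0 w\<bar> < s"
  shows "\<exists>\<delta>>0. \<forall>v\<in>V. N v < \<delta> \<longrightarrow> \<bar>upper v - upper v0\<bar> < r"
proof -
  have "\<exists>\<delta>>0. \<forall>v\<in>V. N v < \<delta> \<longrightarrow> \<bar>- g v w - - g v0 w\<bar> < s" if "w \<in> W" "s > 0" for w s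
    using cont[OF that] by (simp add: abs_minus_commute)
  from sw.lower_continuous[OF v0 r N dom this] show ?thesis
    using upper_conv v0 by (simp add: abs_minus_commute)
qed

text \<open>Adding the growth inequalities at v0 and v1 bounds x^2 - 4 \<eta>, for x = e w1 w0, by a
  mixed difference of g, hence by K d x. So near-maximizers are Lipschitz in v up to an error of
  order sqrt \<eta>.\<close>

lemma near_maximizers_close:
  assumes v: "v1 \<in> V" "v0 \<in> V" and w: "w1 \<in> W" "w0 \<in> W" and \<eta>: "\<eta> > 0"
    and m1: "upper v1 \<le> g v1 w1 + \<eta>" and m0: "upper v0 \<le> g v0 w0 + \<eta>"
  shows "e w1 w0 \<le> K * d v1 v0 + 2 * sqrt \<eta>"
proof -
  define x where "x = e w1 w0"
  have "- g v0 w0 \<le> sw.lower v0 + \<eta>" using m0 v by (simp add: upper_conv)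
  from sw.near_minimizer_growth[OF w(2,1) v(2) this]
  have 1: "g v0 w1 \<le> g v0 w0 + 2 * \<eta> - x\<^sup>2 / 2" by (simp add: x_def)
  obtain wt where wt: "wt \<in> W" "g v1 wt = (1 - 1/2) * g v1 w0 + 1/2 * g v1 w1 + 1/2 * (1 - 1/2) * x\<^sup>2"
    using concave[OF w(2,1), of "1/2"] v(1) by (auto simp: x_def)
  have "g v1 wt \<le> g v1 w1 + \<eta>" using upper_ge[OF v(1) wt(1)] m1 by simp
  hence 2: "g v1 w0 \<le> g v1 w1 + 2 * \<eta> - x\<^sup>2 / 2" using wt(2) by (simp add: field_simps)
  have "x\<^sup>2 - 4 * \<eta> \<le> g v1 w1 - g v0 w1 - g v1 w0 + g v0 w0" using 1 2 by (simp add: field_simps)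
  also have "\<dots> \<le> K * d v1 v0 * x" using coupling[OF v(2,1) w(2,1)] by (simp add: x_def)
  finally have q: "x\<^sup>2 \<le> 4 * \<eta> + K * d v1 v0 * x" by simp
  show ?thesis
  proof (rule ccontr)
    assume "\<not> ?thesis"
    hence c: "x > K * d v1 v0 + 2 * sqrt \<eta>" by (simp add: x_def)
    have k: "K * d v1 v0 \<ge> 0" using nonneg by simp
    have "x > 0" using c k real_sqrt_gt_zero[OF \<eta>] by linarith
    have "x * (x - K * d v1 v0) > (2 * sqrt \<eta>) * (2 * sqrt \<eta>)"
      using c k \<eta> \<open>x > 0\<close> by (intro mult_strict_mono) auto
    moreover have "(2 * sqrt \<eta>) * (2 * sqrt \<eta>) = 4 * \<eta>" using \<eta> by simp
    ultimately have "x * (x - K * d v1 v0) > 4 * \<eta>" by linarith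
    thus False using q by (simp add: right_diff_distrib power2_eq_square mult_ac)
  qed
qed

text \<open>Take a near-minimizer v0 of the upper value and a near-maximizer w0 of g v0. Moving v0 a
  little towards an arbitrary v moves the near-maximizer only a little, so that the first-order
  optimality of v0 says that g v w0 is almost the upper value.\<close>

lemma near_saddle:
  assumes v: "v0 \<in> V" "v \<in> V" and w: "w0 \<in> W"
    and m: "\<And>v. v \<in> V \<Longrightarrow> m \<le> upper v"
    and \<eta>: "\<eta> > 0" and t: "0 < t" "t \<le> 1" "t * (1 + K\<^sup>2) \<le> 1/2"
    and v0: "upper v0 \<le> m + \<eta>" and w0: "upper v0 \<le> g v0 w0 + \<eta>"
  shows "g v w0 \<ge> m - 2 * \<eta> / t - \<eta> - 2 * K\<^sup>2 * \<eta>"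
proof -
  obtain vt where vt: "vt \<in> V" "d vt v0 = t * d v v0"
      "\<And>w. w \<in> W \<Longrightarrow> g vt w = (1 - t) * g v0 w + t * g v w - t * (1 - t) * (d v v0)\<^sup>2"
    using convex[OF v, of t] t by auto
  obtain wt where wt: "wt \<in> W" "upper vt \<le> g vt wt + \<eta>" using near_maximizer[OF vt(1) \<eta>] by blast
  define x y where "x = d v v0" and "y = e wt w0"
  have x0: "x \<ge> 0" and y0: "y \<ge> 0" using nonneg by (simp_all add: x_def y_def)
  have y: "y \<le> K * (t * x) + 2 * sqrt \<eta>"
    unfolding y_def x_def using near_maximizers_close[OF vt(1) v(1) wt(1) w \<eta> wt(2) w0] vt(2) by simp
  have "m - \<eta> \<le> g vt wt" using m[OF vt(1)] wt(2) by simp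
  also have "\<dots> = (1 - t) * g v0 wt + t * g v wt - t * (1 - t) * x\<^sup>2" using vt(3)[OF wt(1)] by (simp add: x_def)
  also have "(1 - t) * g v0 wt \<le> (1 - t) * (m + \<eta>)"
    using upper_ge[OF v(1) wt(1)] v0 t by (intro mult_left_mono) auto
  finally have "t * g v wt \<ge> t * m - 2 * \<eta> + t * \<eta> + t * (1 - t) * x\<^sup>2" by (simp add: algebra_simps)
  moreover have "t * \<eta> \<ge> 0" using t \<eta> by simp
  ultimately have "t * (g v wt - m - (1 - t) * x\<^sup>2) \<ge> - 2 * \<eta>" by (simp add: algebra_simps)
  hence 1: "g v wt \<ge> m - 2 * \<eta> / t + (1 - t) * x\<^sup>2" using t by (simp add: field_simps)
  have 2: "g v w0 \<ge> g v wt + g v0 w0 - g v0 wt - K * x * y"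
    using coupling[OF v w wt(1)] unfolding x_def y_def by linarith
  have 3: "g v0 wt \<le> g v0 w0 + \<eta>" using upper_ge[OF v(1) wt(1)] w0 by simp
  have "K * x * y \<le> K * x * (K * (t * x) + 2 * sqrt \<eta>)" using y x0 nonneg by (intro mult_left_mono) auto
  also have "\<dots> = t * K\<^sup>2 * x\<^sup>2 + 2 * K * sqrt \<eta> * x" by (simp add: algebra_simps power2_eq_square)
  finally have 4: "K * x * y \<le> t * K\<^sup>2 * x\<^sup>2 + 2 * K * sqrt \<eta> * x" .
  have 5: "2 * K * sqrt \<eta> * x \<le> x\<^sup>2 / 2 + 2 * K\<^sup>2 * \<eta>"
  proof -
    have "(x - 2 * K * sqrt \<eta>)\<^sup>2 = x\<^sup>2 - 4 * K * sqrt \<eta> * x + 4 * K\<^sup>2 * \<eta>"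
      using \<eta> by (simp add: power2_diff power_mult_distrib)
    thus ?thesis using zero_le_power2[of "x - 2 * K * sqrt \<eta>"] by linarith
  qed
  \<comment> \<open>Here t must be small: the convexity gain (1 - t) x^2 pays for t K^2 x^2 and
    leaves x^2/2 for the term 2 K sqrt \<eta> x.\<close>
  have "(t * (1 + K\<^sup>2)) * x\<^sup>2 \<le> 1/2 * x\<^sup>2" using t by (intro mult_right_mono) auto
  hence 6: "(1 - t) * x\<^sup>2 - t * K\<^sup>2 * x\<^sup>2 \<ge> x\<^sup>2 / 2" by (simp add: algebra_simps)
  show ?thesis using 1 2 3 4 5 6 by linarith
qed

text \<open>One inequality holds for every function. For the other, \<open>near_saddle\<close>
  provides for each r > 0 some w0 with g v w0 \<ge> m - r for all v, where m is the infimum of the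
  upper values; no exact saddle point is involved.\<close>

theorem minimax: "(INF v\<in>V. SUP w\<in>W. ereal (g v w)) = (SUP w\<in>W. INF v\<in>V. ereal (g v w))"
proof (rule antisym)
  have eqL: "(INF v\<in>V. SUP w\<in>W. ereal (g v w)) = (INF v\<in>V. ereal (upper v))"
    by (intro INF_cong refl ereal_upper)
  have eqR: "(SUP w\<in>W. INF v\<in>V. ereal (g v w)) = (SUP w\<in>W. ereal (lower w))"
    by (intro SUP_cong refl ereal_lower)
  show "(SUP w\<in>W. INF v\<in>V. ereal (g v w)) \<le> (INF v\<in>V. SUP w\<in>W. ereal (g v w))"
    by (intro SUP_least INF_greatest order_trans[OF INF_lower SUP_upper])
  obtain w1 where w1: "w1 \<in> W" using ne by blast
  define m where "m = (INF v\<in>V. upper v)"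
  have bdd: "bdd_below (upper ` V)"
    using lower_le[OF w1] upper_ge[OF _ w1] by (intro bdd_belowI[of _ "lower w1"]) (auto intro: order_trans)
  have m: "m \<le> upper v" if "v \<in> V" for v unfolding m_def by (rule cINF_lower[OF bdd that])
  have mr: "ereal (m - r) \<le> (SUP w\<in>W. ereal (lower w))" if r: "r > 0" for r
  proof -
    define t where "t = 1 / (2 * (1 + K\<^sup>2))"
    have K: "1 + K\<^sup>2 > 0" by (simp add: add_pos_nonneg)
    have t: "0 < t" "t \<le> 1" "t * (1 + K\<^sup>2) \<le> 1/2" using K by (simp_all add: t_def field_simps)
    \<comment> \<open>The total coefficient of \<eta> in \<open>near_saddle\<close>. As t depends on
      K alone, it is fixed before \<eta>.\<close>
    define c where "c = 2 / t + 1 + 2 * K\<^sup>2"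
    have c: "c > 0" using t by (simp add: c_def add_pos_nonneg)
    define \<eta> where "\<eta> = r / c"
    have \<eta>: "\<eta> > 0" using r c by (simp add: \<eta>_def)
    obtain v0 where v0: "v0 \<in> V" "upper v0 < m + \<eta>"
      using cINF_less_iff[OF ne(1) bdd, of "m + \<eta>"] \<eta> by (auto simp: m_def)
    obtain w0 where w0: "w0 \<in> W" "upper v0 \<le> g v0 w0 + \<eta>" using near_maximizer[OF v0(1) \<eta>] by blast
    have "c * \<eta> = r" using c by (simp add: \<eta>_def)
    hence ce: "2 * \<eta> / t + \<eta> + 2 * K\<^sup>2 * \<eta> = r" by (simp add: c_def algebra_simps)
    have "m - r \<le> lower w0"
    proof (rule lower_greatest)
      fix v assume "v \<in> V"
      from near_saddle[OF v0(1) this w0(1) m \<eta> t less_imp_le[OF v0(2)] w0(2)] ce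
      show "m - r \<le> g v w0" by linarith
    qed
    thus ?thesis using w0(1) by (intro SUP_upper2[of w0]) auto
  qed
  have "ereal m \<le> (SUP w\<in>W. ereal (lower w))"
  proof (rule ereal_le_epsilon2)
    fix r :: real assume "0 < r"
    from add_right_mono[OF mr[OF this], of "ereal r"]
    show "ereal m \<le> (SUP w\<in>W. ereal (lower w)) + ereal r" by simp
  qed
  moreover have "(INF v\<in>V. ereal (upper v)) = ereal m"
    unfolding m_def using ereal_Inf'[OF bdd] ne by (simp add: image_image)
  ultimately show "(INF v\<in>V. SUP w\<in>W. ereal (g v w)) \<le> (SUP w\<in>W. INF v\<in>V. ereal (g v w))"
    unfolding eqL eqR by simp
qed

end

section \<open>The differential game\<close>

lemma qform_add_left:
  assumes "square_integrable f" "square_integrable g" "square_integrable h"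
  shows "qform Q (\<lambda>t. r *\<^sub>R f t + s *\<^sub>R g t) h = r * qform Q f h + s * qform Q g h"
  using qform_integrable[OF assms(1,3), of Q] qform_integrable[OF assms(2,3), of Q]
  by (simp add: qform_def inner_add_left)

lemma linear_quadratic_small:
  fixes \<alpha> \<beta> s :: real
  assumes "\<alpha> \<ge> 0" "\<beta> \<ge> 0" "s > 0"
  shows "\<exists>\<delta>>0. \<forall>N\<ge>0. N < \<delta> \<longrightarrow> \<alpha> * N + \<beta> * N\<^sup>2 < s"
proof -
  define \<delta> where "\<delta> = min 1 (s / (\<alpha> + \<beta> + 1))"
  have pos: "\<alpha> + \<beta> + 1 > 0" using assms by simp
  have "\<alpha> * N + \<beta> * N\<^sup>2 < s" if N: "N \<ge> 0" "N < \<delta>" for N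
  proof -
    have "N * N \<le> N * 1" using N by (intro mult_left_mono) (auto simp: \<delta>_def)
    hence "\<beta> * N\<^sup>2 \<le> \<beta> * N" using assms by (intro mult_left_mono) (auto simp: power2_eq_square)
    hence "\<alpha> * N + \<beta> * N\<^sup>2 \<le> (\<alpha> + \<beta> + 1) * N" using N by (simp add: algebra_simps)
    also have "\<dots> < s" using N(2) pos by (simp add: \<delta>_def field_simps)
    finally show ?thesis .
  qed
  moreover have "\<delta> > 0" using assms pos by (simp add: \<delta>_def)
  ultimately show ?thesis by blast
qed

lemma gfun_qform: "gfun A B1 B2 Q a v w = qform Q (response A B1 B2 a v w) (response A B1 B2 a v w)"
  by (simp add: gfun_def qform_def integral_half_line sigma_def response_def)

lemma response_shift:
  assumes "square_integrable v" "square_integrable w" "square_integrable p" "square_integrable u" and t: "t \<ge> 0"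
  shows "response A B1 B2 a (\<lambda>t. v t + r *\<^sub>R p t) (\<lambda>t. w t + s *\<^sub>R u t) t
    = response A B1 B2 a v w t + (r *\<^sub>R response A B1 B2 0 p (\<lambda>_. 0) t + s *\<^sub>R response A B1 B2 0 (\<lambda>_. 0) u t)"
  using response_combination[OF assms(1,2) square_integrable_scaleR[OF assms(3)] square_integrable_scaleR[OF assms(4)] t, of A B1 B2 1 a 1 0 r s]
    response_combination[OF assms(3) square_integrable_zero square_integrable_zero assms(4) t, of A B1 B2 r 0 s 0]
  by simp

text \<open>Only the cardinality matters: one index for every filter of the cascade.\<close>

type_synonym ('n, 'k, 'q) cascade_index = "(bool \<times> ((bool \<times> bool) \<times> 'n + ('k + 'q))) \<times> (bool \<times> ((bool \<times> bool) \<times> 'n + ('k + 'q)))"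

lemma cascade_index_card:
  "DIM(((real^'n::finite) \<times> (real^'n), (real^'k::finite) \<times> (real^'q::finite)) pencil) * DIM(((real^'n) \<times> (real^'n), (real^'k) \<times> (real^'q)) pencil)
    \<le> CARD(('n, 'k, 'q) cascade_index)"
proof -
  have dim: "DIM(((real^'n) \<times> (real^'n), (real^'k) \<times> (real^'q)) pencil)
      = CARD(bool \<times> ((bool \<times> bool) \<times> 'n + ('k + 'q)))"
    by (simp add: card_cartesian_product card_Plus UNIV_Plus_UNIV[symmetric] UNIV_Times_UNIV[symmetric] del: UNIV_Plus_UNIV UNIV_Times_UNIV)
  show ?thesis unfolding dim by (subst UNIV_Times_UNIV[symmetric], subst card_cartesian_product, rule order_refl)
qed

locale minimax_problem =
  fixes A :: "real^'n^'n" and B1 :: "real^'k^'n" and B2 :: "real^'q^'n"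
    and Q :: "real^('n + ('k + 'q))^('n + ('k + 'q))" and \<epsilon> \<omega>0 :: real
  assumes hur: "hurwitz A" and symQ: "transpose Q = Q" and eps: "\<epsilon> > 0"
    and fdi: "\<forall>\<omega>::real. psd_c (Pi_mod \<epsilon> (Pi_mat A B1 B2 Q (\<i> * complex_of_real \<omega>)))"
    and pd: "pd_c (Pi11 (Pi_mat A B1 B2 Q (\<i> * complex_of_real \<omega>0)))"
    and nd: "nd_c (Pi22 (Pi_mat A B1 B2 Q (\<i> * complex_of_real \<omega>0)))"
begin

abbreviation "resp \<equiv> response A B1 B2"
abbreviation "respv p \<equiv> response A B1 B2 0 p (\<lambda>_. 0)"
abbreviation "respw u \<equiv> response A B1 B2 0 (\<lambda>_. 0) u"

lemma sq_resp: "square_integrable v \<Longrightarrow> square_integrable w \<Longrightarrow> square_integrable (resp a v w)"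
  using response_bound[OF hur, of B1 B2] by blast

text \<open>The initial state can be assigned to either response. The choice (a, 0) will bound g
  from below in v, and (0, a) will bound it from above in w.\<close>

lemma split_energy:
  shows split_energy_bounded: "\<exists>C. \<forall>v w. square_integrable v \<longrightarrow> square_integrable w \<longrightarrow>
      C \<le> qform Q (resp a v (\<lambda>_. 0)) (resp a v (\<lambda>_. 0)) + \<epsilon> * qform Q (resp a v (\<lambda>_. 0)) (resp a' (\<lambda>_. 0) w)
        - qform Q (resp a' (\<lambda>_. 0) w) (resp a' (\<lambda>_. 0) w)"
    and split_energy_nonneg: "square_integrable p \<Longrightarrow> square_integrable u \<Longrightarrow>
      0 \<le> qform Q (respv p) (respv p) + \<epsilon> * qform Q (respv p) (respw u) - qform Q (respw u) (respw u)"
proof -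
  obtain P M where "kyp (\<lambda>x. (A *v fst x, A *v snd x)) P (\<lambda>u. (B1 *v fst u, B2 *v snd u)) (doubled_form (\<epsilon> / 2) Q) M \<omega>0"
    using doubled_kyp[OF hur symQ fdi pd nd] by blast
  then interpret kyp "\<lambda>x. (A *v fst x, A *v snd x)" P "\<lambda>u. (B1 *v fst u, B2 *v snd u)" "doubled_form (\<epsilon> / 2) Q" M \<omega>0 .
  have prim: "primitive (\<lambda>t. (traj A B1 B2 a v (\<lambda>_. 0) t, traj A B1 B2 a' (\<lambda>_. 0) w t))
      (\<lambda>t. (A *v fst (traj A B1 B2 a v (\<lambda>_. 0) t, traj A B1 B2 a' (\<lambda>_. 0) w t), A *v snd (traj A B1 B2 a v (\<lambda>_. 0) t, traj A B1 B2 a' (\<lambda>_. 0) w t))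
        + (B1 *v fst (v t, w t), B2 *v snd (v t, w t))) (a, a')"
    if v: "square_integrable v" and w: "square_integrable w" for a a' v w
    using primitive_Pair[OF primitive_traj[OF v square_integrable_zero, of A B1 B2 a] primitive_traj[OF square_integrable_zero w, of A B1 B2 a']]
    by simp
  have val: "(\<integral>t. doubled_form (\<epsilon> / 2) Q ((traj A B1 B2 a v (\<lambda>_. 0) t, traj A B1 B2 a' (\<lambda>_. 0) w t), (v t, w t)) \<bullet>
        ((traj A B1 B2 a v (\<lambda>_. 0) t, traj A B1 B2 a' (\<lambda>_. 0) w t), (v t, w t)) \<partial>half_line)
     = qform Q (resp a v (\<lambda>_. 0)) (resp a v (\<lambda>_. 0)) + \<epsilon> * qform Q (resp a v (\<lambda>_. 0)) (resp a' (\<lambda>_. 0) w)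
        - qform Q (resp a' (\<lambda>_. 0) w) (resp a' (\<lambda>_. 0) w)"
    if v: "square_integrable v" and w: "square_integrable w" for a a' v w
  proof -
    define f where "f = resp a v (\<lambda>_. 0)"
    define h where "h = resp a' (\<lambda>_. 0) w"
    have sf: "square_integrable f" and sh: "square_integrable h" unfolding f_def h_def by (intro sq_resp v w square_integrable_zero)+
    have "doubled_form (\<epsilon> / 2) Q ((traj A B1 B2 a v (\<lambda>_. 0) t, traj A B1 B2 a' (\<lambda>_. 0) w t), (v t, w t)) \<bullet>
        ((traj A B1 B2 a v (\<lambda>_. 0) t, traj A B1 B2 a' (\<lambda>_. 0) w t), (v t, w t))
      = f t \<bullet> (Q *v f t) + (\<epsilon> * (f t \<bullet> (Q *v h t)) - h t \<bullet> (Q *v h t))" for t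
      unfolding doubled_form_inner using symmetric_matrix_inner[OF symQ, of "h t" "f t"]
      by (simp add: ext1_def ext2_def f_def h_def response_def)
    thus ?thesis using qform_integrable[OF sf sf, of Q] qform_integrable[OF sf sh, of Q] qform_integrable[OF sh sh, of Q]
      by (simp add: qform_def f_def[symmetric] h_def[symmetric])
  qed
  show "\<exists>C. \<forall>v w. square_integrable v \<longrightarrow> square_integrable w \<longrightarrow>
      C \<le> qform Q (resp a v (\<lambda>_. 0)) (resp a v (\<lambda>_. 0)) + \<epsilon> * qform Q (resp a v (\<lambda>_. 0)) (resp a' (\<lambda>_. 0) w)
        - qform Q (resp a' (\<lambda>_. 0) w) (resp a' (\<lambda>_. 0) w)"
  proof -
    obtain C where C: "\<And>x v. primitive x (\<lambda>t. (A *v fst (x t), A *v snd (x t)) + (B1 *v fst (v t), B2 *v snd (v t))) (a, a') \<Longrightarrow>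
        square_integrable v \<Longrightarrow> C \<le> (\<integral>t. doubled_form (\<epsilon> / 2) Q (x t, v t) \<bullet> (x t, v t) \<partial>half_line)"
      using energy_bounded_below[OF cascade_index_card, of "(a, a')"] by blast
    have "C \<le> qform Q (resp a v (\<lambda>_. 0)) (resp a v (\<lambda>_. 0)) + \<epsilon> * qform Q (resp a v (\<lambda>_. 0)) (resp a' (\<lambda>_. 0) w)
        - qform Q (resp a' (\<lambda>_. 0) w) (resp a' (\<lambda>_. 0) w)" if "square_integrable v" "square_integrable w" for v w
      using C[OF prim[OF that] square_integrable_Pair[OF that]] unfolding val[OF that] .
    thus ?thesis by blast
  qed
  show "0 \<le> qform Q (respv p) (respv p) + \<epsilon> * qform Q (respv p) (respw u) - qform Q (respw u) (respw u)"
    if "square_integrable p" "square_integrable u"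
    using energy_nonneg[OF cascade_index_card prim[OF that, of 0 0, folded zero_prod_def] square_integrable_Pair[OF that]]
    unfolding val[OF that] .
qed

text \<open>The exact second-order expansion of g. The convexity, coupling and continuity statements
  below are read off from it.\<close>

lemma qform_shift:
  assumes v: "square_integrable v" and w: "square_integrable w" and p: "square_integrable p" and u: "square_integrable u"
  shows "gfun A B1 B2 Q a (\<lambda>t. v t + r *\<^sub>R p t) (\<lambda>t. w t + s *\<^sub>R u t) = gfun A B1 B2 Q a v w
     + 2 * r * qform Q (resp a v w) (respv p) + r\<^sup>2 * qform Q (respv p) (respv p)
     + 2 * s * qform Q (resp a v w) (respw u) + s\<^sup>2 * qform Q (respw u) (respw u)
     + 2 * r * s * qform Q (respv p) (respw u)"
proof -
  define f h k where "f = resp a v w" and "h = respv p" and "k = respw u"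
  have s: "square_integrable f" "square_integrable h" "square_integrable k"
    unfolding f_def h_def k_def by (intro sq_resp v w p u square_integrable_zero)+
  define m where "m = (\<lambda>t. 1 *\<^sub>R f t + r *\<^sub>R h t)"
  have sm: "square_integrable m" unfolding m_def by (intro square_integrable_add square_integrable_scaleR s)
  have e: "resp a (\<lambda>t. v t + r *\<^sub>R p t) (\<lambda>t. w t + s *\<^sub>R u t) t = 1 *\<^sub>R m t + s *\<^sub>R k t" if "t \<ge> 0" for t
    using response_shift[OF v w p u that] by (simp add: f_def h_def k_def m_def add.assoc)
  have "gfun A B1 B2 Q a (\<lambda>t. v t + r *\<^sub>R p t) (\<lambda>t. w t + s *\<^sub>R u t) = qform Q (\<lambda>t. 1 *\<^sub>R m t + s *\<^sub>R k t) (\<lambda>t. 1 *\<^sub>R m t + s *\<^sub>R k t)"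
    unfolding gfun_qform by (rule qform_cong; rule e)
  also have "\<dots> = qform Q m m + 2 * s * qform Q m k + s\<^sup>2 * qform Q k k"
    using qform_combination[OF symQ sm s(3), of 1 s] by simp
  also have "qform Q m m = qform Q f f + 2 * r * qform Q f h + r\<^sup>2 * qform Q h h"
    unfolding m_def using qform_combination[OF symQ s(1,2), of 1 r] by simp
  also have "qform Q m k = qform Q f k + r * qform Q h k"
    unfolding m_def using qform_add_left[OF s, of Q 1 r] by simp
  finally show ?thesis by (simp add: gfun_qform f_def h_def k_def algebra_simps)
qed

text \<open>The seminorm belonging to the quadratic part of g in v. \<open>max 0\<close> makes it
  nonnegative for all arguments; on \<open>L2\<close> it changes nothing by
  \<open>energy_discriminant\<close>.\<close>

definition dist_v :: "(real \<Rightarrow> real^'k) \<Rightarrow> (real \<Rightarrow> real^'k) \<Rightarrow> real" where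
  "dist_v v v0 = sqrt (max 0 (qform Q (respv (\<lambda>t. v t - v0 t)) (respv (\<lambda>t. v t - v0 t))))"

definition dist_w :: "(real \<Rightarrow> real^'q) \<Rightarrow> (real \<Rightarrow> real^'q) \<Rightarrow> real" where
  "dist_w w w0 = sqrt (max 0 (- qform Q (respw (\<lambda>t. w t - w0 t)) (respw (\<lambda>t. w t - w0 t))))"

lemma qform_respv_scaleR:
  assumes p: "square_integrable p"
  shows "qform Q (respv (\<lambda>t. r *\<^sub>R p t)) h = r * qform Q (respv p) h"
    "qform Q h (respv (\<lambda>t. r *\<^sub>R p t)) = r * qform Q h (respv p)"
proof -
  have e: "respv (\<lambda>t. r *\<^sub>R p t) t = r *\<^sub>R respv p t" if "t \<ge> 0" for t
    using response_combination[OF p square_integrable_zero square_integrable_zero square_integrable_zero that, of A B1 B2 r 0 0 0] by simp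
  have "qform Q (respv (\<lambda>t. r *\<^sub>R p t)) h = qform Q (\<lambda>t. r *\<^sub>R respv p t) h"
    "qform Q h (respv (\<lambda>t. r *\<^sub>R p t)) = qform Q h (\<lambda>t. r *\<^sub>R respv p t)"
    by (rule qform_cong; simp add: e)+
  thus "qform Q (respv (\<lambda>t. r *\<^sub>R p t)) h = r * qform Q (respv p) h"
    "qform Q h (respv (\<lambda>t. r *\<^sub>R p t)) = r * qform Q h (respv p)"
    by (simp_all add: qform_def matrix_vector_mult_scaleR)
qed

lemma qform_respw_scaleR:
  assumes u: "square_integrable u"
  shows "qform Q (respw (\<lambda>t. r *\<^sub>R u t)) h = r * qform Q (respw u) h"
    "qform Q h (respw (\<lambda>t. r *\<^sub>R u t)) = r * qform Q h (respw u)"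
proof -
  have e: "respw (\<lambda>t. r *\<^sub>R u t) t = r *\<^sub>R respw u t" if "t \<ge> 0" for t
    using response_combination[OF square_integrable_zero u square_integrable_zero square_integrable_zero that, of A B1 B2 r 0 0 0] by simp
  have "qform Q (respw (\<lambda>t. r *\<^sub>R u t)) h = qform Q (\<lambda>t. r *\<^sub>R respw u t) h"
    "qform Q h (respw (\<lambda>t. r *\<^sub>R u t)) = qform Q h (\<lambda>t. r *\<^sub>R respw u t)"
    by (rule qform_cong; simp add: e)+
  thus "qform Q (respw (\<lambda>t. r *\<^sub>R u t)) h = r * qform Q (respw u) h"
    "qform Q h (respw (\<lambda>t. r *\<^sub>R u t)) = r * qform Q h (respw u)"
    by (simp_all add: qform_def matrix_vector_mult_scaleR)
qed

text \<open>Scaling u by r in the nonnegative zero-state cost gives a nonnegative quadratic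
  polynomial in r; its discriminant inequality is the bound of the coupling.\<close>

lemma energy_discriminant:
  assumes p: "square_integrable p" and u: "square_integrable u"
  shows "qform Q (respv p) (respv p) \<ge> 0" "qform Q (respw u) (respw u) \<le> 0"
    "(\<epsilon> / 2 * qform Q (respv p) (respw u))\<^sup>2 \<le> qform Q (respv p) (respv p) * - qform Q (respw u) (respw u)"
proof -
  have "0 \<le> qform Q (respv p) (respv p) + 2 * (\<epsilon> / 2 * qform Q (respv p) (respw u)) * r + (- qform Q (respw u) (respw u)) * r\<^sup>2" for r
    using split_energy_nonneg[OF p square_integrable_scaleR[OF u], of r]
    by (simp add: qform_respw_scaleR[OF u] power2_eq_square algebra_simps)
  from quadratic_discriminant[OF this]
  show "qform Q (respv p) (respv p) \<ge> 0" "qform Q (respw u) (respw u) \<le> 0"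
    "(\<epsilon> / 2 * qform Q (respv p) (respw u))\<^sup>2 \<le> qform Q (respv p) (respv p) * - qform Q (respw u) (respw u)" by simp_all
qed

text \<open>The mixed difference of g is 2 b, with b the cross form of the two zero-state responses,
  and \<open>energy_discriminant\<close> bounds (\<epsilon>/2) |b| by the product of the seminorms.
  Hence the constant 4 / \<epsilon>.\<close>

lemma gfun_convex_concave: "convex_concave L2 L2 (gfun A B1 B2 Q a) dist_v dist_w (4 / \<epsilon>)"
proof
  note [simp] = L2_eq
  have zero: "(\<lambda>_. 0) \<in> L2" by simp
  show "L2 \<noteq> {}" "L2 \<noteq> {}" using zero by blast+
  show "0 \<le> dist_v v v0" "0 \<le> dist_w w w0" "0 \<le> 4 / \<epsilon>" for v v0 w w0 using eps by (simp_all add: dist_v_def dist_w_def)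
  show "\<exists>vt\<in>L2. dist_v vt v0 = t * dist_v v v0 \<and>
        (\<forall>w\<in>L2. gfun A B1 B2 Q a vt w = (1 - t) * gfun A B1 B2 Q a v0 w + t * gfun A B1 B2 Q a v w - t * (1 - t) * (dist_v v v0)\<^sup>2)"
    if "v0 \<in> L2" "v \<in> L2" "0 \<le> t" "t \<le> 1" for v0 v t
  proof -
    define p where "p \<tau> = v \<tau> - v0 \<tau>" for \<tau>
    have s: "square_integrable v0" "square_integrable v" using that by simp_all
    have p: "square_integrable p" unfolding p_def by (intro square_integrable_diff s)
    define vt where "vt \<tau> = v0 \<tau> + t *\<^sub>R p \<tau>" for \<tau>
    have vt: "square_integrable vt" unfolding vt_def by (intro square_integrable_add square_integrable_scaleR s p)
    define D where "D = qform Q (respv p) (respv p)"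
    have D0: "D \<ge> 0" unfolding D_def by (rule energy_discriminant(1)[OF p square_integrable_zero])
    have dv: "(dist_v v v0)\<^sup>2 = D" "dist_v v v0 = sqrt D" using D0 by (simp_all add: dist_v_def D_def p_def[abs_def])
    have "(\<lambda>\<tau>. vt \<tau> - v0 \<tau>) = (\<lambda>\<tau>. t *\<^sub>R p \<tau>)" by (simp add: vt_def)
    hence "dist_v vt v0 = sqrt (max 0 (t\<^sup>2 * D))" by (simp add: dist_v_def D_def qform_respv_scaleR[OF p] power2_eq_square mult.assoc)
    hence 1: "dist_v vt v0 = t * dist_v v v0" using that(3) D0 by (simp add: dv(2) real_sqrt_mult)
    have 2: "gfun A B1 B2 Q a vt w = (1 - t) * gfun A B1 B2 Q a v0 w + t * gfun A B1 B2 Q a v w - t * (1 - t) * (dist_v v v0)\<^sup>2"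
      if "w \<in> L2" for w
    proof -
      have w: "square_integrable w" using that by simp
      have "v = (\<lambda>\<tau>. v0 \<tau> + 1 *\<^sub>R p \<tau>)" by (simp add: p_def)
      hence "gfun A B1 B2 Q a v w = gfun A B1 B2 Q a v0 w + 2 * qform Q (resp a v0 w) (respv p) + D"
        using qform_shift[OF s(1) w p square_integrable_zero, of a 1 0] by (simp add: D_def)
      moreover have "gfun A B1 B2 Q a vt w = gfun A B1 B2 Q a v0 w + 2 * t * qform Q (resp a v0 w) (respv p) + t\<^sup>2 * D"
        using qform_shift[OF s(1) w p square_integrable_zero, of a t 0] by (simp add: D_def vt_def[abs_def])
      ultimately show ?thesis unfolding dv(1) by (simp add: algebra_simps power2_eq_square)
    qed
    show ?thesis using vt 1 2 by (intro bexI[of _ vt]) auto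
  qed
  show "\<exists>wt\<in>L2. dist_w wt w0 = t * dist_w w w0 \<and>
        (\<forall>v\<in>L2. gfun A B1 B2 Q a v wt = (1 - t) * gfun A B1 B2 Q a v w0 + t * gfun A B1 B2 Q a v w + t * (1 - t) * (dist_w w w0)\<^sup>2)"
    if "w0 \<in> L2" "w \<in> L2" "0 \<le> t" "t \<le> 1" for w0 w t
  proof -
    define p where "p \<tau> = w \<tau> - w0 \<tau>" for \<tau>
    have s: "square_integrable w0" "square_integrable w" using that by simp_all
    have p: "square_integrable p" unfolding p_def by (intro square_integrable_diff s)
    define wt where "wt \<tau> = w0 \<tau> + t *\<^sub>R p \<tau>" for \<tau>
    have wt: "square_integrable wt" unfolding wt_def by (intro square_integrable_add square_integrable_scaleR s p)
    define D where "D = - qform Q (respw p) (respw p)"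
    have D0: "D \<ge> 0" unfolding D_def using energy_discriminant(2)[OF square_integrable_zero p] by simp
    have dw: "(dist_w w w0)\<^sup>2 = D" "dist_w w w0 = sqrt D" using D0 by (simp_all add: dist_w_def D_def p_def[abs_def])
    have "(\<lambda>\<tau>. wt \<tau> - w0 \<tau>) = (\<lambda>\<tau>. t *\<^sub>R p \<tau>)" by (simp add: wt_def)
    hence "dist_w wt w0 = sqrt (max 0 (t\<^sup>2 * D))" by (simp add: dist_w_def D_def qform_respw_scaleR[OF p] power2_eq_square mult.assoc)
    hence 1: "dist_w wt w0 = t * dist_w w w0" using that(3) D0 by (simp add: dw(2) real_sqrt_mult)
    have 2: "gfun A B1 B2 Q a v wt = (1 - t) * gfun A B1 B2 Q a v w0 + t * gfun A B1 B2 Q a v w + t * (1 - t) * (dist_w w w0)\<^sup>2"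
      if "v \<in> L2" for v
    proof -
      have v: "square_integrable v" using that by simp
      have "w = (\<lambda>\<tau>. w0 \<tau> + 1 *\<^sub>R p \<tau>)" by (simp add: p_def)
      hence 3: "gfun A B1 B2 Q a v w = gfun A B1 B2 Q a v w0 + 2 * qform Q (resp a v w0) (respw p) - D"
        using qform_shift[OF v s(1) square_integrable_zero p, of a 0 1] by (simp add: D_def)
      have 4: "gfun A B1 B2 Q a v wt = gfun A B1 B2 Q a v w0 + 2 * t * qform Q (resp a v w0) (respw p) - t\<^sup>2 * D"
        using qform_shift[OF v s(1) square_integrable_zero p, of a 0 t] by (simp add: D_def wt_def[abs_def])
      show ?thesis unfolding 3 4 dw(1) by (simp add: algebra_simps power2_eq_square)
    qed
    show ?thesis using wt 1 2 by (intro bexI[of _ wt]) auto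
  qed
  show "\<bar>gfun A B1 B2 Q a v w - gfun A B1 B2 Q a v0 w - gfun A B1 B2 Q a v w0 + gfun A B1 B2 Q a v0 w0\<bar> \<le> 4 / \<epsilon> * dist_v v v0 * dist_w w w0"
    if "v0 \<in> L2" "v \<in> L2" "w0 \<in> L2" "w \<in> L2" for v0 v w0 w
  proof -
    define p where "p \<tau> = v \<tau> - v0 \<tau>" for \<tau>
    define u where "u \<tau> = w \<tau> - w0 \<tau>" for \<tau>
    have s: "square_integrable v0" "square_integrable v" "square_integrable w0" "square_integrable w" using that by simp_all
    have p: "square_integrable p" and u: "square_integrable u" unfolding p_def u_def by (intro square_integrable_diff s)+
    have vw: "v = (\<lambda>\<tau>. v0 \<tau> + 1 *\<^sub>R p \<tau>)" "w = (\<lambda>\<tau>. w0 \<tau> + 1 *\<^sub>R u \<tau>)" by (simp_all add: p_def u_def)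
    define b where "b = qform Q (respv p) (respw u)"
    note ed = energy_discriminant[OF p u]
    have "gfun A B1 B2 Q a v w - gfun A B1 B2 Q a v0 w - gfun A B1 B2 Q a v w0 + gfun A B1 B2 Q a v0 w0 = 2 * b"
      unfolding vw using qform_shift[OF s(1,3) p u, of a 1 1] qform_shift[OF s(1,3) p u, of a 1 0] qform_shift[OF s(1,3) p u, of a 0 1]
      by (simp add: b_def)
    moreover have "\<bar>\<epsilon> / 2 * b\<bar> \<le> dist_v v v0 * dist_w w w0"
    proof -
      have "\<bar>\<epsilon> / 2 * b\<bar> = sqrt ((\<epsilon> / 2 * b)\<^sup>2)" by simp
      also have "\<dots> \<le> sqrt (qform Q (respv p) (respv p) * - qform Q (respw u) (respw u))" unfolding b_def by (rule real_sqrt_le_mono[OF ed(3)])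
      also have "\<dots> = dist_v v v0 * dist_w w w0"
        using ed(1,2) unfolding dist_v_def dist_w_def p_def[symmetric] u_def[symmetric] by (simp add: real_sqrt_mult[symmetric])
      finally show ?thesis .
    qed
    ultimately show ?thesis using eps by (simp add: abs_mult field_simps)
  qed
  \<comment> \<open>Chosen so that scaling w by r turns the cross term of the doubled cost into
    \<epsilon> r b = 2 b, the cross term of g; what is left over depends on w alone.\<close>
  define r where "r = 2 / \<epsilon>"
  have er: "\<epsilon> * r = 2" using eps by (simp add: r_def)
  show "\<exists>c. \<forall>v\<in>L2. c \<le> gfun A B1 B2 Q a v w" if "w \<in> L2" for w
  proof -
    have w: "square_integrable w" using that by simp
    obtain C where C: "\<And>v w. square_integrable v \<Longrightarrow> square_integrable w \<Longrightarrow>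
      C \<le> qform Q (resp a v (\<lambda>_. 0)) (resp a v (\<lambda>_. 0)) + \<epsilon> * qform Q (resp a v (\<lambda>_. 0)) (respw w) - qform Q (respw w) (respw w)"
      using split_energy_bounded[of a 0] by blast
    have "C + (r\<^sup>2 + 1) * qform Q (respw w) (respw w) \<le> gfun A B1 B2 Q a v w" if "v \<in> L2" for v
    proof -
      have v: "square_integrable v" using that by simp
      define b where "b = qform Q (resp a v (\<lambda>_. 0)) (respw w)"
      have "C \<le> gfun A B1 B2 Q a v (\<lambda>_. 0) + (\<epsilon> * r) * b - r\<^sup>2 * qform Q (respw w) (respw w)"
        using C[OF v square_integrable_scaleR[OF w], of r]
        by (simp add: qform_respw_scaleR[OF w] gfun_qform b_def power2_eq_square mult.assoc)
      moreover have "gfun A B1 B2 Q a v w = gfun A B1 B2 Q a v (\<lambda>_. 0) + 2 * b + qform Q (respw w) (respw w)"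
        using qform_shift[OF v square_integrable_zero square_integrable_zero w, of a 0 1] by (simp add: b_def)
      ultimately show ?thesis unfolding er by (simp add: algebra_simps)
    qed
    thus ?thesis by blast
  qed
  show "\<exists>c. \<forall>w\<in>L2. gfun A B1 B2 Q a v w \<le> c" if "v \<in> L2" for v
  proof -
    have v: "square_integrable v" using that by simp
    obtain C where C: "\<And>v w. square_integrable v \<Longrightarrow> square_integrable w \<Longrightarrow>
      C \<le> qform Q (respv v) (respv v) + \<epsilon> * qform Q (respv v) (resp a (\<lambda>_. 0) w) - qform Q (resp a (\<lambda>_. 0) w) (resp a (\<lambda>_. 0) w)"
      using split_energy_bounded[of 0 a] by blast
    have "gfun A B1 B2 Q a v w \<le> - C + (r\<^sup>2 + 1) * qform Q (respv v) (respv v)" if "w \<in> L2" for w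
    proof -
      have w: "square_integrable w" using that by simp
      define b where "b = qform Q (resp a (\<lambda>_. 0) w) (respv v)"
      have sym: "qform Q (respv v) (resp a (\<lambda>_. 0) w) = b"
        unfolding b_def qform_def by (simp add: symmetric_matrix_inner[OF symQ, of "respv v _"])
      \<comment> \<open>Scaling v by - r gives the cross term the sign with which it enters -
        g.\<close>
      have "C \<le> r\<^sup>2 * qform Q (respv v) (respv v) - (\<epsilon> * r) * b - gfun A B1 B2 Q a (\<lambda>_. 0) w"
        using C[OF square_integrable_scaleR[OF v] w, of "- r"]
        by (simp only: qform_respv_scaleR[OF v] gfun_qform sym) (simp add: power2_eq_square mult.assoc)
      moreover have "gfun A B1 B2 Q a v w = gfun A B1 B2 Q a (\<lambda>_. 0) w + 2 * b + qform Q (respv v) (respv v)"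
        using qform_shift[OF square_integrable_zero w v square_integrable_zero, of a 1 0] by (simp add: b_def)
      ultimately show ?thesis unfolding er by (simp add: algebra_simps)
    qed
    thus ?thesis by blast
  qed
qed

section \<open>Continuity in the L2 norm\<close>

lemma response_norm_bound:
  "\<exists>C\<ge>0. \<forall>p. square_integrable p \<longrightarrow> L2norm (respv p) \<le> C * L2norm p"
  "\<exists>C\<ge>0. \<forall>u. square_integrable u \<longrightarrow> L2norm (respw u) \<le> C * L2norm u"
proof -
  obtain C where C: "C \<ge> 0" "\<And>a v w. square_integrable v \<Longrightarrow> square_integrable w \<Longrightarrow>
    (\<integral>t. (norm (resp a v w t))\<^sup>2 \<partial>half_line) \<le> C * ((norm a)\<^sup>2 + (L2norm v)\<^sup>2 + (L2norm w)\<^sup>2)"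
    using response_bound[OF hur, of B1 B2] by blast
  have z: "L2norm (\<lambda>_. 0) = 0" by (simp add: L2norm_eq)
  have "L2norm (respv p) \<le> sqrt C * L2norm p" if "square_integrable p" for p
    using real_sqrt_le_mono[OF C(2)[OF that square_integrable_zero, of 0]]
    by (simp add: z real_sqrt_mult L2norm_nonneg) (simp add: L2norm_eq)
  moreover have "L2norm (respw p) \<le> sqrt C * L2norm p" if "square_integrable p" for p
    using real_sqrt_le_mono[OF C(2)[OF square_integrable_zero that, of 0]]
    by (simp add: z real_sqrt_mult L2norm_nonneg) (simp add: L2norm_eq)
  ultimately show "\<exists>C\<ge>0. \<forall>p. square_integrable p \<longrightarrow> L2norm (respv p) \<le> C * L2norm p"
    "\<exists>C\<ge>0. \<forall>u. square_integrable u \<longrightarrow> L2norm (respw u) \<le> C * L2norm u"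
    using C(1) by (meson real_sqrt_ge_zero)+
qed

text \<open>The seminorms are dominated by the norm, which carries continuity over to the norm
  topology. A converse estimate would be coercivity.\<close>

lemma dist_bound:
  "\<exists>C. \<forall>v\<in>L2. \<forall>v0\<in>L2. dist_v v v0 \<le> C * L2norm (\<lambda>t. v t - v0 t)"
  "\<exists>C. \<forall>w\<in>L2. \<forall>w0\<in>L2. dist_w w w0 \<le> C * L2norm (\<lambda>t. w t - w0 t)"
proof -
  obtain c where c: "c \<ge> 0" "\<And>f h. square_integrable f \<Longrightarrow> square_integrable h \<Longrightarrow> \<bar>qform Q f h\<bar> \<le> c * L2norm f * L2norm h"
    using qform_bound by blast
  obtain C where C: "C \<ge> 0" "\<And>p. square_integrable p \<Longrightarrow> L2norm (respv p) \<le> C * L2norm p" using response_norm_bound(1) by blast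
  obtain D where D: "D \<ge> 0" "\<And>u. square_integrable u \<Longrightarrow> L2norm (respw u) \<le> D * L2norm u" using response_norm_bound(2) by blast
  have root: "sqrt (max 0 q) \<le> (sqrt c * K) * N" if q: "\<bar>q\<bar> \<le> c * L * L" and L: "0 \<le> L" "L \<le> K * N" for q L K N :: real
  proof -
    have "max 0 q \<le> c * L\<^sup>2" using q c(1) by (simp add: power2_eq_square mult.assoc)
    hence "sqrt (max 0 q) \<le> sqrt (c * L\<^sup>2)" by simp
    also have "\<dots> = sqrt c * L" using L by (simp add: real_sqrt_mult)
    also have "\<dots> \<le> sqrt c * (K * N)" using L c(1) by (intro mult_left_mono) auto
    finally show ?thesis by (simp add: mult.assoc)
  qed
  have "dist_v v v0 \<le> (sqrt c * C) * L2norm (\<lambda>t. v t - v0 t)" if "v \<in> L2" "v0 \<in> L2" for v v0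
  proof -
    have p: "square_integrable (\<lambda>t. v t - v0 t)" using that by (intro square_integrable_diff) (simp_all add: L2_eq)
    show ?thesis unfolding dist_v_def
      by (rule root[OF c(2) L2norm_nonneg C(2)[OF p]]) (intro sq_resp p square_integrable_zero)+
  qed
  thus "\<exists>C. \<forall>v\<in>L2. \<forall>v0\<in>L2. dist_v v v0 \<le> C * L2norm (\<lambda>t. v t - v0 t)" by blast
  have "dist_w w w0 \<le> (sqrt c * D) * L2norm (\<lambda>t. w t - w0 t)" if "w \<in> L2" "w0 \<in> L2" for w w0
  proof -
    have p: "square_integrable (\<lambda>t. w t - w0 t)" using that by (intro square_integrable_diff) (simp_all add: L2_eq)
    have "\<bar>- qform Q (respw (\<lambda>t. w t - w0 t)) (respw (\<lambda>t. w t - w0 t))\<bar>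
      \<le> c * L2norm (respw (\<lambda>t. w t - w0 t)) * L2norm (respw (\<lambda>t. w t - w0 t))"
      using c(2)[OF sq_resp[OF square_integrable_zero p] sq_resp[OF square_integrable_zero p]] by simp
    thus ?thesis unfolding dist_w_def by (rule root[OF _ L2norm_nonneg D(2)[OF p]])
  qed
  thus "\<exists>C. \<forall>w\<in>L2. \<forall>w0\<in>L2. dist_w w w0 \<le> C * L2norm (\<lambda>t. w t - w0 t)" by blast
qed

lemma gfun_continuous:
  assumes v: "v \<in> L2" and w: "w \<in> L2" and s: "s > 0"
  shows "\<exists>\<delta>>0. \<forall>v'\<in>L2. L2norm (\<lambda>t. v' t - v t) < \<delta> \<longrightarrow> \<bar>gfun A B1 B2 Q a v' w - gfun A B1 B2 Q a v w\<bar> < s"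
    "\<exists>\<delta>>0. \<forall>w'\<in>L2. L2norm (\<lambda>t. w' t - w t) < \<delta> \<longrightarrow> \<bar>gfun A B1 B2 Q a v w' - gfun A B1 B2 Q a v w\<bar> < s"
proof -
  obtain c where c: "c \<ge> 0" "\<And>f h. square_integrable f \<Longrightarrow> square_integrable h \<Longrightarrow> \<bar>qform Q f h\<bar> \<le> c * L2norm f * L2norm h"
    using qform_bound by blast
  obtain C where C: "C \<ge> 0" "\<And>p. square_integrable p \<Longrightarrow> L2norm (respv p) \<le> C * L2norm p" using response_norm_bound(1) by blast
  obtain D where D: "D \<ge> 0" "\<And>u. square_integrable u \<Longrightarrow> L2norm (respw u) \<le> D * L2norm u" using response_norm_bound(2) by blast
  have sv: "square_integrable v" and sw: "square_integrable w" using v w by (simp_all add: L2_eq)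
  define f where "f = resp a v w"
  have sf: "square_integrable f" unfolding f_def by (rule sq_resp[OF sv sw])
  have est: "\<bar>2 * qform Q f h + qform Q h h\<bar> \<le> (2 * c * L2norm f * K) * N + (c * K\<^sup>2) * N\<^sup>2"
    if h: "square_integrable h" "L2norm h \<le> K * N" for h K N
  proof -
    have "\<bar>qform Q f h\<bar> \<le> c * L2norm f * (K * N)"
      using c(2)[OF sf h(1)] mult_left_mono[OF h(2), of "c * L2norm f"] c(1) L2norm_nonneg[of f] by simp
    moreover have "\<bar>qform Q h h\<bar> \<le> c * ((K * N) * (K * N))"
    proof -
      have "L2norm h * L2norm h \<le> (K * N) * (K * N)" using h(2) L2norm_nonneg[of h] by (intro mult_mono) auto
      hence "c * (L2norm h * L2norm h) \<le> c * ((K * N) * (K * N))" using c(1) by (rule mult_left_mono)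
      thus ?thesis using c(2)[OF h(1) h(1)] by (simp add: mult.assoc)
    qed
    ultimately have "\<bar>2 * qform Q f h + qform Q h h\<bar> \<le> 2 * (c * L2norm f * (K * N)) + c * ((K * N) * (K * N))" by linarith
    thus ?thesis by (simp add: power2_eq_square mult_ac)
  qed
  have nn: "2 * c * L2norm f * K \<ge> 0" "c * K\<^sup>2 \<ge> 0" if "K \<ge> 0" for K using c(1) that L2norm_nonneg[of f] by simp_all
  obtain \<delta> where \<delta>: "\<delta> > 0" "\<And>N. N \<ge> 0 \<Longrightarrow> N < \<delta> \<Longrightarrow> (2 * c * L2norm f * C) * N + (c * C\<^sup>2) * N\<^sup>2 < s"
    using linear_quadratic_small[OF nn[OF C(1)] s] by blast
  have "\<bar>gfun A B1 B2 Q a v' w - gfun A B1 B2 Q a v w\<bar> < s" if v': "v' \<in> L2" and N: "L2norm (\<lambda>t. v' t - v t) < \<delta>" for v'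
  proof -
    define p where "p t = v' t - v t" for t
    have p: "square_integrable p" unfolding p_def using v' v by (intro square_integrable_diff) (simp_all add: L2_eq)
    have "v' = (\<lambda>t. v t + 1 *\<^sub>R p t)" by (simp add: p_def)
    hence "gfun A B1 B2 Q a v' w - gfun A B1 B2 Q a v w = 2 * qform Q f (respv p) + qform Q (respv p) (respv p)"
      using qform_shift[OF sv sw p square_integrable_zero, of a 1 0] by (simp add: f_def)
    hence "\<bar>gfun A B1 B2 Q a v' w - gfun A B1 B2 Q a v w\<bar> \<le> (2 * c * L2norm f * C) * L2norm p + (c * C\<^sup>2) * (L2norm p)\<^sup>2"
      using est[OF sq_resp[OF p square_integrable_zero] C(2)[OF p]] by simp
    also have "\<dots> < s" using N by (intro \<delta>(2) L2norm_nonneg) (simp add: p_def[abs_def])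
    finally show ?thesis .
  qed
  thus "\<exists>\<delta>>0. \<forall>v'\<in>L2. L2norm (\<lambda>t. v' t - v t) < \<delta> \<longrightarrow> \<bar>gfun A B1 B2 Q a v' w - gfun A B1 B2 Q a v w\<bar> < s" using \<delta>(1) by blast
  obtain \<delta>' where \<delta>': "\<delta>' > 0" "\<And>N. N \<ge> 0 \<Longrightarrow> N < \<delta>' \<Longrightarrow> (2 * c * L2norm f * D) * N + (c * D\<^sup>2) * N\<^sup>2 < s"
    using linear_quadratic_small[OF nn[OF D(1)] s] by blast
  have "\<bar>gfun A B1 B2 Q a v w' - gfun A B1 B2 Q a v w\<bar> < s" if w': "w' \<in> L2" and N: "L2norm (\<lambda>t. w' t - w t) < \<delta>'" for w'
  proof -
    define p where "p t = w' t - w t" for t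
    have p: "square_integrable p" unfolding p_def using w' w by (intro square_integrable_diff) (simp_all add: L2_eq)
    have "w' = (\<lambda>t. w t + 1 *\<^sub>R p t)" by (simp add: p_def)
    hence "gfun A B1 B2 Q a v w' - gfun A B1 B2 Q a v w = 2 * qform Q f (respw p) + qform Q (respw p) (respw p)"
      using qform_shift[OF sv sw square_integrable_zero p, of a 0 1] by (simp add: f_def)
    hence "\<bar>gfun A B1 B2 Q a v w' - gfun A B1 B2 Q a v w\<bar> \<le> (2 * c * L2norm f * D) * L2norm p + (c * D\<^sup>2) * (L2norm p)\<^sup>2"
      using est[OF sq_resp[OF square_integrable_zero p] D(2)[OF p]] by simp
    also have "\<dots> < s" using N by (intro \<delta>'(2) L2norm_nonneg) (simp add: p_def[abs_def])
    finally show ?thesis .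
  qed
  thus "\<exists>\<delta>>0. \<forall>w'\<in>L2. L2norm (\<lambda>t. w' t - w t) < \<delta> \<longrightarrow> \<bar>gfun A B1 B2 Q a v w' - gfun A B1 B2 Q a v w\<bar> < s" using \<delta>'(1) by blast
qed

lemma values_finite_continuous_minimax:
  "(\<forall>w\<in>(L2::(real \<Rightarrow> real^'q) set).
        \<bar>INF v\<in>(L2::(real \<Rightarrow> real^'k) set). ereal (gfun A B1 B2 Q a v w)\<bar> \<noteq> \<infinity>)
   \<and> L2_continuous (\<lambda>w::real \<Rightarrow> real^'q.
        real_of_ereal (INF v\<in>(L2::(real \<Rightarrow> real^'k) set). ereal (gfun A B1 B2 Q a v w)))
   \<and> (\<forall>v\<in>(L2::(real \<Rightarrow> real^'k) set).
        \<bar>SUP w\<in>(L2::(real \<Rightarrow> real^'q) set). ereal (gfun A B1 B2 Q a v w)\<bar> \<noteq> \<infinity>)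
   \<and> L2_continuous (\<lambda>v::real \<Rightarrow> real^'k.
        real_of_ereal (SUP w\<in>(L2::(real \<Rightarrow> real^'q) set). ereal (gfun A B1 B2 Q a v w)))
   \<and> (INF v\<in>(L2::(real \<Rightarrow> real^'k) set). SUP w\<in>(L2::(real \<Rightarrow> real^'q) set).
          ereal (gfun A B1 B2 Q a v w))
     = (SUP w\<in>(L2::(real \<Rightarrow> real^'q) set). INF v\<in>(L2::(real \<Rightarrow> real^'k) set).
          ereal (gfun A B1 B2 Q a v w))"
proof -
  interpret convex_concave "L2::(real \<Rightarrow> real^'k) set" "L2::(real \<Rightarrow> real^'q) set" "gfun A B1 B2 Q a" dist_v dist_w "4 / \<epsilon>" by (rule gfun_convex_concave)
  obtain C where C: "\<And>v v0. v \<in> L2 \<Longrightarrow> v0 \<in> L2 \<Longrightarrow> dist_v v v0 \<le> C * L2norm (\<lambda>t. v t - v0 t)" using dist_bound(1) by blast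
  obtain D where D: "\<And>w w0. w \<in> L2 \<Longrightarrow> w0 \<in> L2 \<Longrightarrow> dist_w w w0 \<le> D * L2norm (\<lambda>t. w t - w0 t)" using dist_bound(2) by blast
  have "L2_continuous (\<lambda>w::real \<Rightarrow> real^'q. real_of_ereal (INF v\<in>(L2::(real \<Rightarrow> real^'k) set). ereal (gfun A B1 B2 Q a v w)))"
    unfolding L2_continuous_def
  proof (intro ballI allI impI)
    fix w0 :: "real \<Rightarrow> real^'q" and r assume w0: "w0 \<in> L2" and r: "r > (0::real)"
    have "\<exists>\<delta>>0. \<forall>w\<in>L2. L2norm (\<lambda>t. w t - w0 t) < \<delta> \<longrightarrow> \<bar>lower w - lower w0\<bar> < r"
      by (rule lower_continuous[OF w0 r L2norm_nonneg D[OF _ w0] gfun_continuous(2)[OF _ w0]])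
    thus "\<exists>\<delta>>0. \<forall>w\<in>L2. L2norm (\<lambda>t. w t - w0 t) < \<delta> \<longrightarrow>
       \<bar>real_of_ereal (INF v\<in>(L2::(real \<Rightarrow> real^'k) set). ereal (gfun A B1 B2 Q a v w)) - real_of_ereal (INF v\<in>(L2::(real \<Rightarrow> real^'k) set). ereal (gfun A B1 B2 Q a v w0))\<bar> < r"
      using w0 by (simp add: ereal_lower)
  qed
  moreover have "L2_continuous (\<lambda>v::real \<Rightarrow> real^'k. real_of_ereal (SUP w\<in>(L2::(real \<Rightarrow> real^'q) set). ereal (gfun A B1 B2 Q a v w)))"
    unfolding L2_continuous_def
  proof (intro ballI allI impI)
    fix v0 :: "real \<Rightarrow> real^'k" and r assume v0: "v0 \<in> L2" and r: "r > (0::real)"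
    have "\<exists>\<delta>>0. \<forall>v\<in>L2. L2norm (\<lambda>t. v t - v0 t) < \<delta> \<longrightarrow> \<bar>upper v - upper v0\<bar> < r"
      by (rule upper_continuous[OF v0 r L2norm_nonneg C[OF _ v0] gfun_continuous(1)[OF v0]])
    thus "\<exists>\<delta>>0. \<forall>v\<in>L2. L2norm (\<lambda>t. v t - v0 t) < \<delta> \<longrightarrow>
       \<bar>real_of_ereal (SUP w\<in>(L2::(real \<Rightarrow> real^'q) set). ereal (gfun A B1 B2 Q a v w)) - real_of_ereal (SUP w\<in>(L2::(real \<Rightarrow> real^'q) set). ereal (gfun A B1 B2 Q a v0 w))\<bar> < r"
      using v0 by (simp add: ereal_upper)
  qed
  ultimately show ?thesis using minimax by (simp add: ereal_lower ereal_upper)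
qed

end

text \<open>The extrema are taken in the extended reals, so that finiteness is a genuine assertion
  and \<open>real_of_ereal\<close> returns true values. Points of the imaginary axis are written as
  i \<omega>.\<close>

theorem theorem2p3:
  fixes A :: "real^'n^'n" and B1 :: "real^'k^'n" and B2 :: "real^'q^'n"
    and Q :: "real^('n + ('k + 'q))^('n + ('k + 'q))"
  assumes hur: "hurwitz A"
    and symQ: "transpose Q = Q"
    and eps: "\<epsilon> > 0"
    and fdi: "\<forall>\<omega>::real. psd_c (Pi_mod \<epsilon> (Pi_mat A B1 B2 Q (\<i> * complex_of_real \<omega>)))"
    and pd: "pd_c (Pi11 (Pi_mat A B1 B2 Q (\<i> * complex_of_real \<omega>0)))"
    and nd: "nd_c (Pi22 (Pi_mat A B1 B2 Q (\<i> * complex_of_real \<omega>0)))"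
  shows "\<forall>a::real^'n.
     (\<forall>w\<in>(L2::(real \<Rightarrow> real^'q) set).
        \<bar>INF v\<in>(L2::(real \<Rightarrow> real^'k) set). ereal (gfun A B1 B2 Q a v w)\<bar> \<noteq> \<infinity>)
   \<and> L2_continuous (\<lambda>w::real \<Rightarrow> real^'q.
        real_of_ereal (INF v\<in>(L2::(real \<Rightarrow> real^'k) set). ereal (gfun A B1 B2 Q a v w)))
   \<and> (\<forall>v\<in>(L2::(real \<Rightarrow> real^'k) set).
        \<bar>SUP w\<in>(L2::(real \<Rightarrow> real^'q) set). ereal (gfun A B1 B2 Q a v w)\<bar> \<noteq> \<infinity>)
   \<and> L2_continuous (\<lambda>v::real \<Rightarrow> real^'k.
        real_of_ereal (SUP w\<in>(L2::(real \<Rightarrow> real^'q) set). ereal (gfun A B1 B2 Q a v w)))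
   \<and> (INF v\<in>(L2::(real \<Rightarrow> real^'k) set). SUP w\<in>(L2::(real \<Rightarrow> real^'q) set).
          ereal (gfun A B1 B2 Q a v w))
     = (SUP w\<in>(L2::(real \<Rightarrow> real^'q) set). INF v\<in>(L2::(real \<Rightarrow> real^'k) set).
          ereal (gfun A B1 B2 Q a v w))"
proof -
  interpret minimax_problem A B1 B2 Q \<epsilon> \<omega>0 by (rule minimax_problem.intro) fact+
  show ?thesis using values_finite_continuous_minimax by blast
qed

end
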